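(* Let $0<p<\infty$ and let $\omega$ be a radial weight. Then for all $f\in H(\mathbb{B})$, $$\|f\|_{A_\omega^p}^p\le\|N(f)\|_{L_\omega^p}^p\lesssim\|f\|_{A_\omega^p}^p .$$
   Context: $\mathbb{B}$ is the open unit ball of $\mathbb{C}^n$ ($n\ge 1$), $dV$ the normalized volume measure on $\mathbb{B}$, $H(\mathbb{B})$ the space of holomorphic functions on $\mathbb{B}$, and $\langle z,w\rangle=\sum_j z_j\overline{w_j}$. A radial weight is a positive integrable function $\omega$ on $\mathbb{B}$ with $\omega(z)=\omega(|z|)$. For measurable $\varphi$ on $\mathbb{B}$, $\|\varphi\|_{L_\omega^p}^p=\int_{\mathbb{B}}|\varphi|^p\omega\,dV$, and for $f\in H(\mathbb{B})$, $\|f\|_{A_\omega^p}=\|f\|_{L_\omega^p}$ (values in $[0,\infty]$). Fix $\alpha>2$. For $u\in\overline{\mathbb{B}}\setminus\{0\}$ let $$\Gamma_u=\Big\{z\in\mathbb{B}:\Big|1-\Big\langle z,\frac{u}{|u|^2}\Big\rangle\Big|<\frac{\alpha}{2}\Big(1-\frac{|z|^2}{|u|^2}\Big)\Big\},\qquad N(f)(u)=\sup_{z\in\Gamma_u}|f(z)| .$$ $A\lesssim B$ means $A\le CB$ with a constant $C>0$ independent of $f$. *)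

theory Defs
  imports "HOL-Analysis.Analysis"
begin

abbreviation unit_ball :: "(complex ^ 'n) set" where
  "unit_ball \<equiv> ball 0 1"

definition dV :: "(complex ^ 'n) measure" where
  "dV = uniform_measure (lebesgue_on unit_ball) unit_ball"

definition herm :: "complex ^ 'n \<Rightarrow> complex ^ 'n \<Rightarrow> complex" where
  "herm z w = (\<Sum>j\<in>UNIV. z $ j * cnj (w $ j))"

text \<open>Holomorphy on an open subset of complex n-space: Frechet differentiability with a
  complex-linear derivative at every point.\<close>

definition holomorphic_cn :: "(complex ^ 'n \<Rightarrow> complex) \<Rightarrow> (complex ^ 'n) set \<Rightarrow> bool" where
  "holomorphic_cn f S \<longleftrightarrow>
     (\<forall>z\<in>S. \<exists>D. (f has_derivative D) (at z) \<and> (\<forall>c v. D (c *s v) = c * D v))"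

definition radial_weight :: "(complex ^ 'n \<Rightarrow> real) \<Rightarrow> bool" where
  "radial_weight \<omega> \<longleftrightarrow>
     (\<forall>z\<in>unit_ball. 0 < \<omega> z) \<and> integrable dV \<omega> \<and>
     (\<forall>z\<in>unit_ball. \<forall>w\<in>unit_ball. norm z = norm w \<longrightarrow> \<omega> z = \<omega> w)"

text \<open>Real powers on the extended half-line, meant for positive exponents.\<close>

definition epowr :: "ennreal \<Rightarrow> real \<Rightarrow> ennreal" where
  "epowr x p = (if x = \<infinity> then \<infinity> else ennreal (enn2real x powr p))"

text \<open>The p-th powers of the weighted norms. The maximal function below takes values in the
  extended half-line, so the first one takes the modulus of a function as its argument.\<close>

definition Lnorm_pow :: "(complex ^ 'n \<Rightarrow> real) \<Rightarrow> real \<Rightarrow> (complex ^ 'n \<Rightarrow> ennreal) \<Rightarrow> ennreal" where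
  "Lnorm_pow \<omega> p \<phi> = (\<integral>\<^sup>+ z. epowr (\<phi> z) p * ennreal (\<omega> z) \<partial>dV)"

definition Anorm_pow :: "(complex ^ 'n \<Rightarrow> real) \<Rightarrow> real \<Rightarrow> (complex ^ 'n \<Rightarrow> complex) \<Rightarrow> ennreal" where
  "Anorm_pow \<omega> p f = Lnorm_pow \<omega> p (\<lambda>z. ennreal (cmod (f z)))"

text \<open>The point \<open>u = 0\<close> is excluded in the mathematical definition; the value which the formula
  takes there is irrelevant because \<open>{0}\<close> is a null set.\<close>

definition approach_region :: "real \<Rightarrow> complex ^ 'n \<Rightarrow> (complex ^ 'n) set" where
  "approach_region \<alpha> u = {z \<in> unit_ball.
     cmod (1 - herm z (u /\<^sub>R (norm u)\<^sup>2)) < \<alpha> / 2 * (1 - (norm z)\<^sup>2 / (norm u)\<^sup>2)}"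

definition nt_maximal :: "real \<Rightarrow> (complex ^ 'n \<Rightarrow> complex) \<Rightarrow> complex ^ 'n \<Rightarrow> ennreal" where
  "nt_maximal \<alpha> f u = (SUP z\<in>approach_region \<alpha> u. ennreal (cmod (f z)))"

end

theory Submission
  imports Defs "HOL-Complex_Analysis.Cauchy_Integral_Formula"
begin

text \<open>
  Integration in polar coordinates reduces the second inequality to a single sphere \<open>|z| = r\<close>,
  where the weight is constant, and by dilation to functions holomorphic beyond the closed unit ball.
  On the unit sphere put \<open>q = p / 2\<close>. A function \<open>G\<close> satisfies
  \<open>|G(z)|^q \<lesssim> (1 - |z|\<^sup>2)^(-n) \<integral> |G|^q d\<sigma>\<close>. Applying this to \<open>f\<close> times a high power of
  \<open>(1 - |z|\<^sup>2) / (1 - \<langle>w, z\<rangle>)\<close> localises the integral and shows that \<open>|f|^q\<close> on the approach region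
  at \<open>\<xi>\<close> is dominated by the Hardy-Littlewood maximal function of \<open>|f|^q\<close> at \<open>\<xi>\<close> over the
  nonisotropic balls \<open>{\<zeta>. |1 - \<langle>\<zeta>, \<xi>\<rangle>| < t}\<close>. That maximal function is bounded on \<open>L\<^sup>2\<close>.
\<close>

subsection \<open>Isometries and the Hermitian form\<close>

text \<open>The exponent \<open>p / 2\<close> lets one argument serve every \<open>p > 0\<close>:
  the maximal operator is bounded on L^2 but not on L^1, so it acts on \<open>|f|^(p/2)\<close> and
  the outcome is squared. Small exponents are harmless because \<open>f\<close> is holomorphic. The
  obstacle is a zero of \<open>f\<close>, near which \<open>|f|^q\<close> need not be the modulus of
  a holomorphic function. Truncating \<open>|f|\<close> from below at some \<epsilon> > 0 gives the
  sub-mean value property on all discs up to one common size, and averaging over circularly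
  symmetric measures turns this local property into a monotonicity of means, from which the
  pointwise bound follows without the reproducing kernels of the ball. That bound involves the whole
  sphere; localisation pays because a nonisotropic ball of radius \<open>t\<close> has measure at
  most of order \<open>t^n\<close>, which balances the loss \<open>(1 - |z|^2)^(-n)\<close> at the
  scale \<open>t = 1 - |z|^2\<close>. All constants depend on \<open>n\<close>, \<alpha> and
  \<open>p\<close> only, never on the radius of the sphere, so that the spherical estimate can be
  integrated against any radial weight.\<close>

lemma nn_integral_lborel_translate:
  fixes g :: "'a::euclidean_space \<Rightarrow> ennreal"
  assumes [measurable]: "g \<in> borel_measurable borel"
  shows "(\<integral>\<^sup>+x. g (a + x) \<partial>lborel) = (\<integral>\<^sup>+x. g x \<partial>lborel)"
proof -
  have "(\<integral>\<^sup>+x. g x \<partial>lborel) = (\<integral>\<^sup>+x. g x \<partial>(distr lborel borel ((+) a)))"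
    by (simp add: lborel_distr_plus)
  also have "\<dots> = (\<integral>\<^sup>+x. g (a + x) \<partial>lborel)"
    by (subst nn_integral_distr) auto
  finally show ?thesis by simp
qed

lemma nn_integral_lborel_scaleR:
  fixes g :: "'a::euclidean_space \<Rightarrow> ennreal"
  assumes [measurable]: "g \<in> borel_measurable borel" and "c > 0"
  shows "(\<integral>\<^sup>+x. g x \<partial>lborel) = ennreal (c ^ DIM('a)) * (\<integral>\<^sup>+x. g (c *\<^sub>R x) \<partial>lborel)"
proof -
  have "(\<integral>\<^sup>+x. g x \<partial>lborel)
      = (\<integral>\<^sup>+x. g x \<partial>(density (distr lborel borel (\<lambda>x. 0 + c *\<^sub>R x)) (\<lambda>_. \<bar>c\<bar>^DIM('a))))"
    using lborel_affine[of c "0::'a"] \<open>c > 0\<close> by simp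
  also have "\<dots> = ennreal (c ^ DIM('a)) * (\<integral>\<^sup>+x. g (c *\<^sub>R x) \<partial>lborel)"
    using \<open>c > 0\<close> by (simp add: nn_integral_density nn_integral_distr nn_integral_cmult)
  finally show ?thesis .
qed

text \<open>Uniqueness of translation invariant measures, specialised: convolve with the indicator of the
  unit ball, which the isometry maps to itself.\<close>

lemma nn_integral_lborel_isometry:
  fixes g :: "'a::euclidean_space \<Rightarrow> ennreal" and U :: "'a \<Rightarrow> 'a"
  assumes lin: "linear U" and iso: "\<And>x. norm (U x) = norm x"
    and [measurable]: "g \<in> borel_measurable borel"
  shows "(\<integral>\<^sup>+x. g (U x) \<partial>lborel) = (\<integral>\<^sup>+x. g x \<partial>lborel)"
proof -
  interpret U: linear U by fact
  have [measurable]: "U \<in> borel_measurable borel"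
    by (intro borel_measurable_continuous_onI linear_continuous_on
        linear_conv_bounded_linear[THEN iffD1] lin)
  have "inj U"
    using iso U.inj_iff_eq_0 by (metis norm_eq_zero)
  then have surj: "surj U"
    by (rule linear_injective_imp_surjective[OF lin]) simp
  have [measurable]: "ball (0::'a) 1 \<in> sets borel" by simp
  define \<beta> where "\<beta> = emeasure lborel (ball (0::'a) 1)"
  have ball: "emeasure lborel (ball x 1) = \<beta>" for x :: 'a
    unfolding \<beta>_def by (simp add: emeasure_ball)
  have \<beta>: "0 < \<beta>" "\<beta> < \<infinity>"
    unfolding \<beta>_def by (auto simp: emeasure_ball unit_ball_vol_pos)
  have "\<beta> * (\<integral>\<^sup>+y. g (U y) \<partial>lborel)
      = (\<integral>\<^sup>+x. indicator (ball (0::'a) 1) x * (\<integral>\<^sup>+y. g (U y) \<partial>lborel) \<partial>lborel)"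
    by (subst nn_integral_multc) (simp_all add: \<beta>_def borel_measurable_indicator)
  also have "\<dots> = (\<integral>\<^sup>+x. indicator (ball (0::'a) 1) x * (\<integral>\<^sup>+y. g (x + U y) \<partial>lborel) \<partial>lborel)"
  proof (rule nn_integral_cong, rule arg_cong2[where f="(*)"], rule refl)
    fix x
    obtain x' where x': "x = U x'" using surj by blast
    show "(\<integral>\<^sup>+y. g (U y) \<partial>lborel) = (\<integral>\<^sup>+y. g (x + U y) \<partial>lborel)"
      using nn_integral_lborel_translate[of "\<lambda>y. g (U y)" x'] by (simp add: x' U.add)
  qed
  also have "\<dots> = (\<integral>\<^sup>+x. (\<integral>\<^sup>+y. indicator (ball 0 1) x * g (x + U y) \<partial>lborel) \<partial>lborel)"
    by (subst nn_integral_cmult) auto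
  also have "\<dots> = (\<integral>\<^sup>+y. (\<integral>\<^sup>+x. indicator (ball 0 1) x * g (x + U y) \<partial>lborel) \<partial>lborel)"
    by (rule lborel_pair.Fubini') measurable
  also have "\<dots> = (\<integral>\<^sup>+y. (\<integral>\<^sup>+x. indicator (ball 0 1) (x - U y) * g x \<partial>lborel) \<partial>lborel)"
  proof (rule nn_integral_cong)
    fix y
    show "(\<integral>\<^sup>+x. indicator (ball 0 1) x * g (x + U y) \<partial>lborel)
        = (\<integral>\<^sup>+x. indicator (ball 0 1) (x - U y) * g x \<partial>lborel)"
      using nn_integral_lborel_translate[of "\<lambda>x. indicator (ball 0 1) (x - U y) * g x" "U y"]
      by (simp add: add.commute)
  qed
  also have "\<dots> = (\<integral>\<^sup>+x. (\<integral>\<^sup>+y. indicator (ball 0 1) (x - U y) * g x \<partial>lborel) \<partial>lborel)"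
    by (rule lborel_pair.Fubini') measurable
  also have "\<dots> = (\<integral>\<^sup>+x. \<beta> * g x \<partial>lborel)"
  proof (rule nn_integral_cong)
    fix x
    \<comment> \<open>Since \<open>x - U y = U (x' - y)\<close>, the isometry disappears from the
      indicator and the unit ball about \<open>x'\<close> remains.\<close>
    obtain x' where x': "x = U x'" using surj by blast
    have "(\<integral>\<^sup>+y. indicator (ball 0 1) (x - U y) * g x \<partial>lborel)
        = (\<integral>\<^sup>+y. indicator (ball 0 1) (x - U y) \<partial>lborel) * g x"
      by (rule nn_integral_multc) measurable
    also have "(\<integral>\<^sup>+y. indicator (ball 0 1) (x - U y) \<partial>lborel)
        = (\<integral>\<^sup>+y. indicator (ball x' 1) y \<partial>(lborel :: 'a measure))"
      by (intro nn_integral_cong)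
        (simp add: x' U.diff[symmetric] iso indicator_def dist_norm)
    also have "\<dots> = \<beta>" by (simp add: ball)
    finally show "(\<integral>\<^sup>+y. indicator (ball 0 1) (x - U y) * g x \<partial>lborel) = \<beta> * g x" .
  qed
  also have "\<dots> = \<beta> * (\<integral>\<^sup>+x. g x \<partial>lborel)"
    by (rule nn_integral_cmult) simp
  finally show ?thesis
    using \<beta> by (metis ennreal_mult_cancel_left infinity_ennreal_def order_less_irrefl)
qed

lemma norm_cvec_smult: "norm (c *s x) = cmod c * norm (x :: complex ^ 'n)"
  by (simp add: norm_vec_def L2_set_def norm_mult power_mult_distrib
      flip: sum_distrib_left real_sqrt_mult) (simp add: real_sqrt_mult)

lemma linear_cvec_smult: "linear (\<lambda>x. c *s (x :: complex ^ 'n))"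
  by (intro linearI) (auto simp: vec_eq_iff algebra_simps)

lemma continuous_on_cvec_smult [continuous_intros]:
  "continuous_on S f \<Longrightarrow> continuous_on S g \<Longrightarrow>
    continuous_on S (\<lambda>x. f x *s (g x :: complex ^ 'n))"
  unfolding vector_scalar_mult_def by (intro continuous_intros)

lemma continuous_on_herm [continuous_intros]:
  "continuous_on S f \<Longrightarrow> continuous_on S g \<Longrightarrow>
    continuous_on S (\<lambda>x. herm (f x) (g x :: complex ^ 'n))"
  unfolding herm_def by (intro continuous_intros)

lemma cnj_herm: "cnj (herm x y) = herm y x"
  by (simp add: herm_def mult.commute)

lemma herm_simps:
  "herm (x + y) z = herm x z + herm y z" "herm z (x + y) = herm z x + herm z y"
  "herm (x - y) z = herm x z - herm y z" "herm z (x - y) = herm z x - herm z y"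
  "herm (c *s x) z = c * herm x z" "herm z (c *s x) = cnj c * herm z x"
  "herm (r *\<^sub>R x) z = r * herm x z" "herm z (r *\<^sub>R x) = r * herm z x"
  "herm 0 z = 0" "herm z 0 = 0"
  unfolding herm_def vector_scaleR_component
  by (auto simp: algebra_simps sum.distrib sum_subtractf sum_distrib_left
      scaleR_conv_of_real[where 'a=complex])

lemma herm_self: "herm x x = of_real ((norm x)\<^sup>2)"
  unfolding herm_def norm_vec_def L2_set_def
  by (simp add: complex_norm_square[symmetric] sum_nonneg flip: of_real_sum of_real_power)

lemma Re_herm: "Re (herm x y) = inner x y"
  by (simp add: herm_def inner_vec_def inner_complex_def)

text \<open>Multiplying \<open>x\<close> by a phase makes the form real and nonnegative, hence equal
  to the real inner product, for which the Cauchy-Schwarz inequality is available.\<close>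

lemma norm_herm_le: "cmod (herm x y) \<le> norm x * norm y"
proof (cases "herm x y = 0")
  case False
  define c where "c = cnj (sgn (herm x y))"
  have "cmod c = 1" using False by (simp add: c_def norm_sgn)
  have "c * herm x y = cmod (herm x y)"
    using False by (simp add: c_def sgn_eq complex_norm_square[symmetric] power2_eq_square
        field_simps flip: of_real_mult)
  then have "cmod (herm x y) = Re (herm (c *s x) y)" by (simp add: herm_simps)
  also have "\<dots> \<le> norm (c *s x) * norm y" by (simp add: Re_herm norm_cauchy_schwarz)
  finally show ?thesis by (simp add: norm_cvec_smult \<open>cmod c = 1\<close>)
qed simp

lemma linear_herm_preserving_norm:
  assumes "\<And>x y. herm (U x) (U y) = herm x y"
  shows "norm (U x) = norm x"
  using assms[of x x] by (simp add: herm_self flip: of_real_power)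

text \<open>A complex Householder reflection, after a phase that makes the inner product real.\<close>

lemma unitary_map_exists:
  fixes x y :: "complex ^ 'n"
  assumes x: "norm x = 1" and y: "norm y = 1"
  obtains U :: "complex ^ 'n \<Rightarrow> complex ^ 'n"
  where "linear U" "\<And>v w. herm (U v) (U w) = herm v w" "U x = y"
proof -
  define c where "c = (if herm x y = 0 then 1 else cnj (sgn (herm x y)))"
  have c: "cmod c = 1" by (simp add: c_def norm_sgn)
  then have cc: "c * cnj c = 1" "cnj c * c = 1"
    by (simp_all add: complex_norm_square[symmetric] mult.commute[of "cnj c"])
  define x' where "x' = c *s x"
  have nx': "norm x' = 1" using c x by (simp add: x'_def norm_cvec_smult)
  have "herm x' y = cmod (herm x y)"
    by (simp add: x'_def c_def herm_simps sgn_eq complex_norm_square[symmetric] power2_eq_square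
        field_simps flip: of_real_mult)
  then obtain r where r: "herm x' y = of_real r" by blast
  then have r': "herm y x' = of_real r" using cnj_herm[of x' y] by simp
  show ?thesis
  proof (cases "x' = y")
    case True
    show ?thesis
      by (rule that[of "\<lambda>w. c *s w"]) (use True cc in \<open>auto simp: x'_def linear_cvec_smult herm_simps\<close>)
  next
    case False
    define v where "v = x' - y"
    define N where "N = (norm v)\<^sup>2"
    have N0: "N \<noteq> 0" using False by (simp add: N_def v_def)
    have hv: "herm v v = of_real N" by (simp add: herm_self N_def)
    \<comment> \<open>Because \<open>herm x' y\<close> is real, \<open>N\<close> equals
      \<open>2 * herm x' v\<close>; this is exactly what makes the reflection along \<open>v\<close>
      carry \<open>x'\<close> to \<open>y\<close>.\<close>
    have Nr: "of_real N = (2 * (1 - of_real r) :: complex)"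
      unfolding hv[symmetric] v_def herm_simps r r' by (simp add: herm_self nx' y)
    define R where "R = (\<lambda>w. w - (2 * herm w v / of_real N) *s v)"
    have lin: "linear R"
      unfolding R_def by (intro linearI)
        (auto simp: vec_eq_iff herm_simps field_simps add_divide_distrib scaleR_conv_of_real[where 'a=complex])
    have "herm (R w) (R w') = herm w w'" for w w'
    proof -
      have "cnj (herm w' v) = herm v w'" by (rule cnj_herm)
      then show ?thesis
        unfolding R_def using N0 by (simp add: herm_simps hv field_simps)
    qed
    moreover have "R x' = y"
    proof -
      have "herm x' v = 1 - of_real r"
        by (simp add: v_def herm_simps r herm_self nx')
      then have "2 * herm x' v / of_real N = 1"
        using N0 Nr by (metis divide_self of_real_eq_0_iff)
      then show ?thesis by (simp add: R_def v_def)
    qed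
    ultimately show ?thesis
      by (intro that[of "\<lambda>w. R (c *s w)"])
        (use cc linear_compose[OF linear_cvec_smult lin, of c] in \<open>auto simp: herm_simps o_def x'_def\<close>)
  qed
qed

text \<open>Real and imaginary half-widths are kept apart because the box around the cone over a
  nonisotropic ball is long in one real direction and short in its multiple by the imaginary
  unit.\<close>

lemma emeasure_complex_box:
  fixes a b :: "'n::finite \<Rightarrow> real"
  assumes "\<And>j. a j \<ge> 0" "\<And>j. b j \<ge> 0"
  shows "emeasure lborel {w :: complex ^ 'n. \<forall>j. \<bar>Re (w $ j)\<bar> < a j \<and> \<bar>Im (w $ j)\<bar> < b j}
    = ennreal (\<Prod>j\<in>UNIV. 4 * a j * b j)"
proof -
  define u :: "complex ^ 'n" where "u = (\<chi> j. Complex (a j) (b j))"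
  have B: "(Basis :: (complex ^ 'n) set) = (\<lambda>(i, z). axis i z) ` (UNIV \<times> {1, \<i>})"
    by (auto simp: Basis_vec_def Basis_complex_def)
  have inj: "inj_on (\<lambda>(i, z). axis i z) (UNIV \<times> {1, \<i>} :: ('n \<times> complex) set)"
    by (auto simp: inj_on_def axis_eq_axis)
  have eq: "{w :: complex ^ 'n. \<forall>j. \<bar>Re (w $ j)\<bar> < a j \<and> \<bar>Im (w $ j)\<bar> < b j} = box (- u) u"
    unfolding box_def B
    by (auto simp: u_def inner_axis inner_complex_def abs_less_iff) (metis minus_less_iff)+
  have "emeasure lborel (box (-u) u) = ennreal (\<Prod>v\<in>Basis. (u - (-u)) \<bullet> v)"
    by (rule emeasure_lborel_box) (use assms in \<open>auto simp: B u_def inner_axis inner_complex_def\<close>)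
  also have "(\<Prod>v\<in>Basis. (u - (-u)) \<bullet> v)
      = (\<Prod>(j, z)\<in>UNIV \<times> {1, \<i>}. (u - (-u)) \<bullet> axis j z)"
    unfolding B prod.reindex[OF inj] by (auto intro!: prod.cong)
  also have "\<dots> = (\<Prod>j\<in>UNIV. 4 * a j * b j)"
    unfolding prod.cartesian_product[symmetric]
    by (auto simp: u_def inner_axis inner_complex_def intro!: prod.cong)
  finally show ?thesis unfolding eq .
qed

lemma one_minus_herm_commute: "cmod (1 - herm x y) = cmod (1 - herm y x)"
  by (metis cnj_herm complex_cnj_diff complex_cnj_one complex_mod_cnj)

text \<open>Split \<open>x\<close> and \<open>w\<close> into components along \<open>y\<close> and
  orthogonal to it. The components along \<open>y\<close> contribute
  \<open>cmod (1 - a) + cmod (1 - b)\<close>. The orthogonal parts have squared length at most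
  \<open>2 * cmod (1 - a)\<close> and \<open>2 * cmod (1 - b)\<close>, so their product contributes
  the same amount again; hence the factor 2.\<close>

lemma quasi_triangle_sphere:
  fixes x y w :: "complex ^ 'n"
  assumes x: "norm x \<le> 1" and w: "norm w \<le> 1" and y: "norm y = 1"
  shows "cmod (1 - herm x w) \<le> 2 * (cmod (1 - herm x y) + cmod (1 - herm y w))"
proof -
  define a b where "a = herm x y" and "b = herm w y"
  define x' w' where "x' = x - a *s y" and "w' = w - b *s y"
  have yy: "herm y y = 1" by (simp add: herm_self y)
  have na: "cmod a \<le> 1" using norm_herm_le[of x y] x y by (simp add: a_def)
  have nb: "cmod b \<le> 1" using norm_herm_le[of w y] w y by (simp add: b_def)
  have bound: "(norm (v - herm v y *s y))\<^sup>2 \<le> 2 * cmod (1 - herm v y)" if v: "norm v \<le> 1" for v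
  proof -
    have c: "herm v y * cnj (herm v y) = of_real ((cmod (herm v y))\<^sup>2)"
      by (rule complex_norm_square[symmetric])
    have "complex_of_real ((norm (v - herm v y *s y))\<^sup>2)
        = herm v v - herm v y * herm y v - cnj (herm v y) * herm v y + herm v y * cnj (herm v y)"
      by (simp add: herm_self[symmetric] herm_simps yy algebra_simps del: of_real_power)
    also have "\<dots> = of_real ((norm v)\<^sup>2 - (cmod (herm v y))\<^sup>2)"
      by (simp add: c[symmetric] cnj_herm herm_self[symmetric] algebra_simps del: of_real_power)
    finally have "(norm (v - herm v y *s y))\<^sup>2 = (norm v)\<^sup>2 - (cmod (herm v y))\<^sup>2"
      using of_real_eq_iff by blast
    also have "\<dots> \<le> 1 - (cmod (herm v y))\<^sup>2"
      using v by (simp add: power_le_one)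
    also have "\<dots> = (1 - cmod (herm v y)) * (1 + cmod (herm v y))"
      by (simp add: power2_eq_square algebra_simps)
    also have "\<dots> \<le> (1 - cmod (herm v y)) * 2"
      using norm_herm_le[of v y] v y by (intro mult_left_mono) auto
    also have "1 - cmod (herm v y) \<le> cmod (1 - herm v y)"
      using norm_triangle_ineq2[of 1 "herm v y"] by simp
    finally show ?thesis by simp
  qed
  have "herm x w = a * cnj b + herm x' w'"
    by (simp add: x'_def w'_def herm_simps yy a_def b_def cnj_herm)
  then have "1 - herm x w = ((1 - a) + a * (1 - cnj b)) - herm x' w'"
    by (simp add: algebra_simps)
  then have "cmod (1 - herm x w) \<le> cmod ((1 - a) + a * (1 - cnj b)) + cmod (herm x' w')"
    by (metis norm_triangle_ineq4)
  also have "cmod ((1 - a) + a * (1 - cnj b)) \<le> cmod (1 - a) + cmod a * cmod (1 - cnj b)"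
    by (metis norm_triangle_ineq norm_mult)
  also have "cmod a * cmod (1 - cnj b) \<le> 1 * cmod (1 - b)"
    using na by (intro mult_mono) (auto simp flip: complex_mod_cnj[of "1 - b"])
  also have "cmod (herm x' w') \<le> norm x' * norm w'" by (rule norm_herm_le)
  also have "norm x' * norm w' \<le> ((norm x')\<^sup>2 + (norm w')\<^sup>2) / 2"
    using sum_squares_bound[of "norm x'" "norm w'"] by simp
  finally have "cmod (1 - herm x w)
      \<le> cmod (1 - a) + cmod (1 - b) + ((norm x')\<^sup>2 + (norm w')\<^sup>2) / 2" by simp
  moreover have "(norm x')\<^sup>2 \<le> 2 * cmod (1 - a)" using bound[OF x] by (simp add: x'_def a_def)
  moreover have "(norm w')\<^sup>2 \<le> 2 * cmod (1 - b)" using bound[OF w] by (simp add: w'_def b_def)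
  ultimately have "cmod (1 - herm x w) \<le> 2 * cmod (1 - a) + 2 * cmod (1 - b)" by argo
  then show ?thesis by (simp add: a_def b_def one_minus_herm_commute[of w y])
qed

text \<open>An interior middle point \<open>y\<close> is pushed radially to the sphere, which at
  most doubles its distance to any point of the closed ball; with the factor 2 for points on the
  sphere this makes 4. Interior points are needed since \<open>y\<close> will be a point of an
  approach region.\<close>

lemma quasi_triangle:
  fixes x y w :: "complex ^ 'n"
  assumes x: "norm x \<le> 1" and w: "norm w \<le> 1" and y: "norm y \<le> 1"
  shows "cmod (1 - herm x w) \<le> 4 * (cmod (1 - herm x y) + cmod (1 - herm y w))"
proof (cases "y = 0")
  case True
  have "cmod (1 - herm x w) \<le> 1 + cmod (herm x w)"
    using norm_triangle_ineq4[of 1 "herm x w"] by simp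
  also have "\<dots> \<le> 1 + 1 * 1"
    using norm_herm_le[of x w] mult_mono[OF x w] by (auto intro: order_trans)
  finally show ?thesis using True by (simp add: herm_simps)
next
  case False
  define e where "e = y /\<^sub>R norm y"
  have e: "norm e = 1" using False by (simp add: e_def)
  have "cmod (1 - herm v e) \<le> 2 * cmod (1 - herm v y)" if v: "norm v \<le> 1" for v
  proof -
    define a where "a = herm v e"
    have na: "cmod a \<le> 1" using norm_herm_le[of v e] v e by (simp add: a_def)
    have vy: "herm v y = a * norm y" using False by (simp add: a_def e_def herm_simps)
    have "1 - a = (1 - a * norm y) - a * (1 - norm y)" by (simp add: algebra_simps)
    then have "cmod (1 - a) \<le> cmod (1 - a * norm y) + cmod (a * (1 - norm y))"
      by (metis norm_triangle_ineq4)
    also have "cmod (a * (1 - norm y)) = cmod a * (1 - norm y)"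
      using y norm_of_real[of "1 - norm y", where 'a=complex] by (simp add: norm_mult)
    also have "\<dots> \<le> 1 * (1 - norm y)" using na y by (intro mult_right_mono) auto
    also have "1 * (1 - norm y) \<le> 1 - cmod (a * norm y)"
      using na by (simp add: norm_mult mult_left_le_one_le)
    also have "\<dots> \<le> cmod (1 - a * norm y)"
      using norm_triangle_ineq2[of 1 "a * norm y"] by simp
    finally show ?thesis by (simp add: a_def[symmetric] vy)
  qed
  from this[OF x] this[OF w] quasi_triangle_sphere[OF x w e] show ?thesis
    by (simp add: one_minus_herm_commute[of e w] one_minus_herm_commute[of y w])
qed

subsection \<open>The surface measure and polar coordinates\<close>

text \<open>A constant multiple of the surface measure of the unit sphere.\<close>

definition surf :: "'a::euclidean_space measure" where
  "surf = distr (density lborel (indicator (ball 0 1))) borel sgn"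

lemma borel_measurable_sgn_euclidean [measurable]:
  "(sgn :: 'a::euclidean_space \<Rightarrow> 'a) \<in> borel_measurable borel"
proof -
  have "sgn = (\<lambda>x::'a. inverse (norm x) *\<^sub>R x)" by (simp add: sgn_div_norm fun_eq_iff)
  then show ?thesis by simp
qed

lemma sets_surf [simp, measurable_cong]: "sets surf = sets borel"
  and space_surf [simp]: "space surf = UNIV"
  by (simp_all add: surf_def)

lemma ball_in_borel [measurable]: "ball (x::'a::metric_space) r \<in> sets borel"
  by simp

lemma nn_integral_surf:
  fixes h :: "'a::euclidean_space \<Rightarrow> ennreal"
  assumes [measurable]: "h \<in> borel_measurable borel"
  shows "(\<integral>\<^sup>+\<xi>. h \<xi> \<partial>surf) = (\<integral>\<^sup>+w. indicator (ball 0 1) w * h (sgn w) \<partial>lborel)"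
  unfolding surf_def by (simp add: nn_integral_distr nn_integral_density)

text \<open>The measure is defined on the Borel sets of the whole space, and
  \<open>sgn 0 = 0\<close> lies off the sphere; but the origin is a null set.\<close>

lemma AE_surf: "AE \<xi> in surf. norm (\<xi> :: 'a::euclidean_space) = 1"
proof -
  have "AE w in (lborel :: 'a measure). w \<noteq> 0" by (rule AE_lborel_singleton)
  then show ?thesis
    unfolding surf_def by (simp add: AE_distr_iff AE_density norm_sgn)
qed

lemma finite_measure_surf: "finite_measure (surf :: 'a::euclidean_space measure)"
proof
  have "emeasure surf (space (surf :: 'a measure)) = (\<integral>\<^sup>+\<xi>. 1 \<partial>(surf :: 'a measure))" by simp
  also have "\<dots> = emeasure lborel (ball (0::'a) 1)" by (subst nn_integral_surf) simp_all
  also have "\<dots> \<noteq> \<infinity>" by (simp add: emeasure_ball)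
  finally show "emeasure surf (space (surf :: 'a measure)) \<noteq> \<infinity>" .
qed

lemma nn_integral_surf_isometry:
  fixes h :: "'a::euclidean_space \<Rightarrow> ennreal" and U :: "'a \<Rightarrow> 'a"
  assumes lin: "linear U" and iso: "\<And>x. norm (U x) = norm x"
    and [measurable]: "h \<in> borel_measurable borel"
  shows "(\<integral>\<^sup>+\<xi>. h (U \<xi>) \<partial>surf) = (\<integral>\<^sup>+\<xi>. h \<xi> \<partial>surf)"
proof -
  interpret U: linear U by fact
  have [measurable]: "U \<in> borel_measurable borel"
    by (intro borel_measurable_continuous_onI linear_continuous_on
        linear_conv_bounded_linear[THEN iffD1] lin)
  have "(\<integral>\<^sup>+\<xi>. h (U \<xi>) \<partial>surf) = (\<integral>\<^sup>+w. indicator (ball 0 1) (U w) * h (sgn (U w)) \<partial>lborel)"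
    by (subst nn_integral_surf) (simp_all add: iso sgn_div_norm U.scaleR indicator_def)
  also have "\<dots> = (\<integral>\<^sup>+\<xi>. h \<xi> \<partial>surf)"
    by (subst nn_integral_lborel_isometry[OF lin iso]) (simp_all add: nn_integral_surf)
  finally show ?thesis .
qed

text \<open>Applied with \<open>a = norm y\<close>, this cancels the factor
  \<open>norm y ^ D\<close> that the substitutions in the polar coordinate formula leave
  behind.\<close>

lemma nn_integral_powr_tail:
  assumes "a > 0" and "D > 0"
  shows "(\<integral>\<^sup>+s. indicator {a<..} s * ennreal (of_nat D / s ^ Suc D) \<partial>lborel) = ennreal (1 / a ^ D)"
proof -
  have "(\<integral>\<^sup>+s. ennreal (of_nat D / s ^ Suc D) * indicator {a..} s \<partial>lborel) = ennreal (0 - (- (1 / a ^ D)))"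
  proof (rule nn_integral_FTC_atLeast)
    fix s assume "a \<le> s"
    then have "s > 0" using assms by simp
    have "((\<lambda>s. - (inverse s ^ D)) has_real_derivative
        - (of_nat D * (- (inverse s ^ Suc (Suc 0))) * inverse s ^ (D - 1))) (at s)"
      using \<open>s > 0\<close> by (auto intro!: derivative_eq_intros)
    moreover have "inverse s ^ Suc (Suc 0) * inverse s ^ (D - 1) = inverse s ^ Suc D"
      using \<open>D > 0\<close> by (cases D) simp_all
    ultimately have "((\<lambda>s. - (inverse s ^ D)) has_real_derivative of_nat D * inverse s ^ Suc D) (at s)"
      by (simp only: mult.assoc mult_minus_right mult_minus_left minus_minus)
    then show "((\<lambda>s. - (1 / s ^ D)) has_real_derivative of_nat D / s ^ Suc D) (at s)"
      by (simp only: power_inverse divide_inverse mult_1)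
    show "0 \<le> of_nat D / s ^ Suc D" using \<open>s > 0\<close> by simp
  next
    have "((\<lambda>s::real. - (inverse s ^ D)) \<longlongrightarrow> - (0 ^ D)) at_top"
      by (intro tendsto_intros tendsto_inverse_0_at_top filterlim_ident)
    then show "((\<lambda>s::real. - (1 / s ^ D)) \<longlongrightarrow> 0) at_top"
      using \<open>D > 0\<close> by (simp add: power_one_over inverse_eq_divide zero_power)
  qed simp
  moreover have "(\<integral>\<^sup>+s. indicator {a<..} s * ennreal (of_nat D / s ^ Suc D) \<partial>lborel)
      = (\<integral>\<^sup>+s. ennreal (of_nat D / s ^ Suc D) * indicator {a..} s \<partial>lborel)"
    using AE_lborel_singleton[of a]
    by (intro nn_integral_cong_AE) (auto simp: indicator_def elim!: eventually_mono)
  ultimately show ?thesis by simp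
qed

text \<open>No differentiation of volumes is involved. Unfolding \<open>surf\<close> gives a double
  integral over \<open>r\<close> and a point \<open>w\<close> of the ball; substitute
  \<open>r = norm w * s\<close> for fixed \<open>w\<close>, then \<open>y = s *\<^sub>R w\<close>
  for fixed \<open>s\<close>, and integrate out \<open>s\<close>. The factor \<open>DIM('a)\<close>
  appears because the total mass of \<open>surf\<close> is the volume of the ball and not the area
  of the sphere.\<close>

lemma nn_integral_polar:
  fixes h :: "'a::euclidean_space \<Rightarrow> ennreal"
  assumes [measurable]: "h \<in> borel_measurable borel"
  shows "(\<integral>\<^sup>+y. indicator (ball 0 1) y * h y \<partial>lborel)
    = (\<integral>\<^sup>+r. indicator {0<..<1} r * ennreal (DIM('a) * r ^ (DIM('a) - 1))
        * (\<integral>\<^sup>+\<xi>. h (r *\<^sub>R \<xi>) \<partial>surf) \<partial>lborel)"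
proof -
  define D where "D = DIM('a)"
  have D: "D > 0" by (simp add: D_def)
  define j :: "'a \<Rightarrow> ennreal" where "j = indicator (ball 0 1)"
  have [measurable]: "j \<in> borel_measurable borel" unfolding j_def by measurable
  have ne0: "AE w in (lborel :: 'a measure). w \<noteq> 0" by (rule AE_lborel_singleton)
  have "(\<integral>\<^sup>+r. indicator {0<..<1} r * ennreal (D * r ^ (D - 1)) * (\<integral>\<^sup>+\<xi>. h (r *\<^sub>R \<xi>) \<partial>surf) \<partial>lborel)
     = (\<integral>\<^sup>+r. (\<integral>\<^sup>+w. indicator {0<..<1} r * ennreal (D * r ^ (D - 1)) * (j w * h (r *\<^sub>R sgn w)) \<partial>lborel) \<partial>lborel)"
    by (simp add: nn_integral_surf nn_integral_cmult j_def)
  also have "\<dots> = (\<integral>\<^sup>+w. (\<integral>\<^sup>+r. indicator {0<..<1} r * ennreal (D * r ^ (D - 1)) * (j w * h (r *\<^sub>R sgn w)) \<partial>lborel) \<partial>lborel)"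
    by (rule lborel_pair.Fubini') measurable
  also have "\<dots> = (\<integral>\<^sup>+w. (\<integral>\<^sup>+s. j w * h (s *\<^sub>R w) * indicator {0<..} s * indicator {..<1} (norm w * s)
      * ennreal (D * norm w ^ D * s ^ (D - 1)) \<partial>lborel) \<partial>lborel)"
  proof (rule nn_integral_cong_AE, use ne0 in eventually_elim)
    fix w :: 'a assume w: "w \<noteq> 0"
    then have nw: "norm w > 0" by simp
    have "(\<integral>\<^sup>+r. indicator {0<..<1} r * ennreal (D * r ^ (D - 1)) * (j w * h (r *\<^sub>R sgn w)) \<partial>lborel)
      = ennreal (norm w) * (\<integral>\<^sup>+s. indicator {0<..<1} (norm w * s) * ennreal (D * (norm w * s) ^ (D - 1))
            * (j w * h ((norm w * s) *\<^sub>R sgn w)) \<partial>lborel)"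
      using nn_integral_lborel_scaleR[OF _ nw, of "\<lambda>r::real. indicator {0<..<1} r * ennreal (D * r ^ (D - 1)) * (j w * h (r *\<^sub>R sgn w))"]
      by simp
    also have "\<dots> = (\<integral>\<^sup>+s. ennreal (norm w) * (indicator {0<..<1} (norm w * s) * ennreal (D * (norm w * s) ^ (D - 1))
            * (j w * h ((norm w * s) *\<^sub>R sgn w))) \<partial>lborel)"
      by (subst nn_integral_cmult) auto
    also have "\<dots> = (\<integral>\<^sup>+s. j w * h (s *\<^sub>R w) * indicator {0<..} s * indicator {..<1} (norm w * s)
      * ennreal (D * norm w ^ D * s ^ (D - 1)) \<partial>lborel)"
    proof (rule nn_integral_cong)
      fix s :: real
      have 1: "(norm w * s) *\<^sub>R sgn w = s *\<^sub>R w" using w by (simp add: sgn_div_norm)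
      have "norm w * norm w ^ (D - 1) = norm w ^ D" using D by (cases D) auto
      then have 2: "ennreal (norm w) * ennreal (D * (norm w * s) ^ (D - 1)) = ennreal (D * norm w ^ D * s ^ (D - 1))"
        if "s > 0" using that by (simp add: power_mult_distrib mult_ac flip: ennreal_mult)
      have 3: "0 < norm w * s \<longleftrightarrow> 0 < s" using nw by (simp add: zero_less_mult_iff)
      show "ennreal (norm w) * (indicator {0<..<1} (norm w * s) * ennreal (D * (norm w * s) ^ (D - 1))
            * (j w * h ((norm w * s) *\<^sub>R sgn w))) = j w * h (s *\<^sub>R w) * indicator {0<..} s * indicator {..<1} (norm w * s)
      * ennreal (D * norm w ^ D * s ^ (D - 1))"
      proof (cases "s > 0")
        case True
        have "ennreal (norm w) * (indicator {0<..<1} (norm w * s) * ennreal (D * (norm w * s) ^ (D - 1))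
            * (j w * h (s *\<^sub>R w))) = indicator {0<..<1} (norm w * s) * (ennreal (norm w) * ennreal (D * (norm w * s) ^ (D - 1)))
            * (j w * h (s *\<^sub>R w))"
          by (simp only: mult_ac)
        then show ?thesis
          unfolding 1 2[OF True] using True nw by (simp add: indicator_def mult_ac)
      qed (use 1 3 in \<open>simp add: indicator_def\<close>)
    qed
    finally show "(\<integral>\<^sup>+r. indicator {0<..<1} r * ennreal (D * r ^ (D - 1)) * (j w * h (r *\<^sub>R sgn w)) \<partial>lborel)
      = (\<integral>\<^sup>+s. j w * h (s *\<^sub>R w) * indicator {0<..} s * indicator {..<1} (norm w * s)
      * ennreal (D * norm w ^ D * s ^ (D - 1)) \<partial>lborel)" .
  qed
  also have "\<dots> = (\<integral>\<^sup>+s. (\<integral>\<^sup>+w. j w * h (s *\<^sub>R w) * indicator {0<..} s * indicator {..<1} (norm w * s)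
      * ennreal (D * norm w ^ D * s ^ (D - 1)) \<partial>lborel) \<partial>lborel)"
    by (rule lborel_pair.Fubini') measurable
  also have "\<dots> = (\<integral>\<^sup>+s. (\<integral>\<^sup>+y. j y * h y * ennreal (norm y ^ D) *
      (indicator {0<..} (s - norm y) * ennreal (D / s ^ Suc D)) \<partial>lborel) \<partial>lborel)"
  proof (rule nn_integral_cong)
    fix s :: real
    show "(\<integral>\<^sup>+w. j w * h (s *\<^sub>R w) * indicator {0<..} s * indicator {..<1} (norm w * s)
      * ennreal (D * norm w ^ D * s ^ (D - 1)) \<partial>lborel)
      = (\<integral>\<^sup>+y. j y * h y * ennreal (norm y ^ D) *
      (indicator {0<..} (s - norm y) * ennreal (D / s ^ Suc D)) \<partial>lborel)"
    proof (cases "s > 0")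
      case False
      then have "indicator {0<..} s = (0::ennreal)" "\<And>y::'a. indicator {0<..} (s - norm y) = (0::ennreal)"
        using norm_ge_zero le_less_trans by (auto simp: indicator_def simp del: norm_ge_zero)
      then show ?thesis by simp
    next
      case True
      have "(\<integral>\<^sup>+w. j w * h (s *\<^sub>R w) * indicator {0<..} s * indicator {..<1} (norm w * s)
          * ennreal (D * norm w ^ D * s ^ (D - 1)) \<partial>lborel)
        = ennreal ((1/s) ^ D) * (\<integral>\<^sup>+y. j ((1/s) *\<^sub>R y) * h y * indicator {0<..} s * indicator {..<1} (norm y)
          * ennreal (D * (norm y / s) ^ D * s ^ (D - 1)) \<partial>lborel)"
        using True by (subst nn_integral_lborel_scaleR[of _ "1/s"]) (auto simp: D_def)
      also have "\<dots> = (\<integral>\<^sup>+y. ennreal ((1/s) ^ D) * (j ((1/s) *\<^sub>R y) * h y * indicator {0<..} s * indicator {..<1} (norm y)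
          * ennreal (D * (norm y / s) ^ D * s ^ (D - 1))) \<partial>lborel)"
        by (subst nn_integral_cmult) auto
      also have "\<dots> = (\<integral>\<^sup>+y. j y * h y * ennreal (norm y ^ D) *
          (indicator {0<..} (s - norm y) * ennreal (D / s ^ Suc D)) \<partial>lborel)"
      proof (rule nn_integral_cong)
        fix y :: 'a
        \<comment> \<open>The two cut-offs exchange roles: \<open>norm w < 1\<close> becomes
          \<open>norm y < s\<close>, and \<open>r < 1\<close> becomes
          \<open>norm y < 1\<close>.\<close>
        have 1: "j ((1/s) *\<^sub>R y) = indicator {0<..} (s - norm y)" "j y = indicator {..<1} (norm y)"
          using True by (auto simp: j_def indicator_def)
        have "(1/s) ^ D * (D * (norm y / s) ^ D * s ^ (D - 1)) = norm y ^ D * (D / s ^ Suc D)"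
        proof -
          have "s ^ D = s * s ^ (D - 1)" using D by (cases D) auto
          then show ?thesis using True by (simp add: field_simps)
        qed
        then have 2: "ennreal ((1/s) ^ D) * ennreal (D * (norm y / s) ^ D * s ^ (D - 1))
            = ennreal (norm y ^ D) * ennreal (D / s ^ Suc D)"
          using True by (simp flip: ennreal_mult)
        show "ennreal ((1/s) ^ D) * (j ((1/s) *\<^sub>R y) * h y * indicator {0<..} s * indicator {..<1} (norm y)
          * ennreal (D * (norm y / s) ^ D * s ^ (D - 1)))
          = j y * h y * ennreal (norm y ^ D) * (indicator {0<..} (s - norm y) * ennreal (D / s ^ Suc D))"
          unfolding 1 using 2 True by (auto simp: indicator_def mult_ac)
      qed
      finally show ?thesis .
    qed
  qed
  also have "\<dots> = (\<integral>\<^sup>+y. (\<integral>\<^sup>+s. j y * h y * ennreal (norm y ^ D) *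
      (indicator {0<..} (s - norm y) * ennreal (D / s ^ Suc D)) \<partial>lborel) \<partial>lborel)"
    by (rule lborel_pair.Fubini') measurable
  also have "\<dots> = (\<integral>\<^sup>+y. j y * h y \<partial>lborel)"
  proof (rule nn_integral_cong_AE, use ne0 in eventually_elim)
    fix y :: 'a assume y: "y \<noteq> 0"
    have "(\<integral>\<^sup>+s. j y * h y * ennreal (norm y ^ D) * (indicator {0<..} (s - norm y) * ennreal (D / s ^ Suc D)) \<partial>lborel)
      = j y * h y * ennreal (norm y ^ D) * ennreal (1 / norm y ^ D)"
    proof -
      have "indicator {0<..} (s - norm y) = (indicator {norm y<..} s :: ennreal)" for s
        by (simp add: indicator_def)
      then show ?thesis
        using y D by (subst nn_integral_cmult)
          (simp_all add: nn_integral_powr_tail del: power_Suc)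
    qed
    also have "\<dots> = j y * h y * ennreal (norm y ^ D * (1 / norm y ^ D))"
      by (simp only: mult.assoc) (subst ennreal_mult[symmetric], auto)
    also have "norm y ^ D * (1 / norm y ^ D) = 1" using y by simp
    finally show "(\<integral>\<^sup>+s. j y * h y * ennreal (norm y ^ D) * (indicator {0<..} (s - norm y) * ennreal (D / s ^ Suc D)) \<partial>lborel)
      = j y * h y" by simp
  qed
  finally show ?thesis by (simp add: D_def j_def)
qed

subsection \<open>The sub-mean value property of powers of the modulus\<close>

lemma nn_integral_eq_henstock:
  fixes f :: "'a::euclidean_space \<Rightarrow> real"
  assumes "f integrable_on S" and "\<And>x. x \<in> S \<Longrightarrow> 0 \<le> f x"
  shows "(\<integral>\<^sup>+x. indicator S x * ennreal (f x) \<partial>lborel) = ennreal (integral S f)"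
proof -
  have "(\<integral>\<^sup>+x. indicator S x * ennreal (f x) \<partial>lborel) = (\<integral>\<^sup>+x. ennreal (indicator S x * f x) \<partial>lborel)"
    by (rule nn_integral_cong) (simp add: indicator_def)
  also have "\<dots> = ennreal (integral S f)"
    using assms by (intro nn_integral_has_integral_lebesgue) (auto simp: integrable_integral)
  finally show ?thesis .
qed

text \<open>On a disc without zeros \<open>g = exp L\<close>, so \<open>|g|^q\<close> is the modulus
  of the holomorphic function \<open>exp (q L)\<close>, to which the Cauchy integral formula
  applies.\<close>

lemma nonvanishing_mean_value:
  fixes g :: "complex \<Rightarrow> complex"
  assumes hol: "g holomorphic_on ball c R" and nz: "\<And>w. w \<in> ball c R \<Longrightarrow> g w \<noteq> 0"
    and r: "0 < r" "r < R"
  shows "ennreal (cmod (g c) powr q)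
    \<le> (\<integral>\<^sup>+t. indicator {0..1} t * ennreal (cmod (g (circlepath c r t)) powr q) \<partial>lborel)"
proof -
  have "c \<in> ball c R" using r by simp
  then obtain L where L: "L holomorphic_on ball c R" and eL: "\<And>w. w \<in> ball c R \<Longrightarrow> exp (L w) = g w"
    using holomorphic_logarithm_exists[of "ball c R" g c] hol nz by (metis convex_ball open_ball)
  define k where "k = (\<lambda>w. exp (of_real q * L w))"
  have sub: "cball c r \<subseteq> ball c R" using r by auto
  have holk: "k holomorphic_on cball c r"
    unfolding k_def by (intro holomorphic_intros holomorphic_on_subset[OF L sub])
  have nk: "cmod (k w) = cmod (g w) powr q" if "w \<in> ball c R" for w
  proof -
    have "cmod (g w) = exp (Re (L w))" using eL[OF that] by (metis norm_exp_eq_Re)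
    then show ?thesis by (simp add: k_def norm_exp_eq_Re powr_def)
  qed
  have inb: "circlepath c r t \<in> cball c r" for t
    using r by (simp add: circlepath dist_norm norm_mult)
  have "((\<lambda>t. k (circlepath c r t) * (2 * pi * \<i>)) has_integral (2 * pi * \<i> * k c)) {0..1}"
  proof -
    have "((\<lambda>u. k u / (u - c)) has_contour_integral (2 * of_real pi * \<i> * k c)) (circlepath c r)"
      by (rule Cauchy_integral_circlepath_simple[OF holk]) (use r in simp)
    then have "((\<lambda>t. k (circlepath c r t) / (circlepath c r t - c)
        * (2 * pi * \<i> * r * exp (2 * of_real pi * \<i> * t))) has_integral (2 * pi * \<i> * k c)) {0..1}"
      by (simp add: has_contour_integral vector_derivative_circlepath)
    then show ?thesis
      by (rule has_integral_eq[rotated]) (use r in \<open>simp add: circlepath\<close>)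
  qed
  moreover define C :: complex where "C = 2 * pi * \<i>"
  ultimately have "((\<lambda>t. k (circlepath c r t) * C) has_integral (C * k c)) {0..1}" by simp
  then have "((\<lambda>t. k (circlepath c r t) * C * inverse C) has_integral (C * k c * inverse C)) {0..1}"
    by (rule has_integral_mult_left)
  moreover have "C \<noteq> 0" by (simp add: C_def)
  ultimately have I: "((\<lambda>t. k (circlepath c r t)) has_integral k c) {0..1}"
    by (simp add: field_simps)
  have cont: "continuous_on {0..1} (\<lambda>t. cmod (k (circlepath c r t)))"
    by (intro continuous_intros continuous_on_compose2[OF holomorphic_on_imp_continuous_on[OF holk]])
      (use inb in \<open>auto simp: circlepath intro!: continuous_intros\<close>)
  have "cmod (k c) \<le> integral {0..1} (\<lambda>t. cmod (k (circlepath c r t)))"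
    using integral_norm_bound_integral[of "\<lambda>t. k (circlepath c r t)" "{0..1}" "\<lambda>t. cmod (k (circlepath c r t))"]
      I integrable_continuous_interval[OF cont] by (auto simp: has_integral_iff)
  then have "ennreal (cmod (k c)) \<le> ennreal (integral {0..1} (\<lambda>t. cmod (k (circlepath c r t))))"
    by (rule ennreal_leI)
  also have "\<dots> = (\<integral>\<^sup>+t. indicator {0..1} t * ennreal (cmod (k (circlepath c r t))) \<partial>lborel)"
    by (rule nn_integral_eq_henstock[symmetric]) (use integrable_continuous_interval[OF cont] in auto)
  also have "\<dots> = (\<integral>\<^sup>+t. indicator {0..1} t * ennreal (cmod (g (circlepath c r t)) powr q) \<partial>lborel)"
    using nk inb sub by (intro nn_integral_cong) (auto simp: indicator_def subset_iff)
  finally show ?thesis using r by (simp add: nk)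
qed

text \<open>By radiality the maximum is attained at a real radius; take the largest such radius
  \<rho>. If it were less than 1, the sub-mean value property on a small circle about \<rho> would
  force the maximum on the whole circle, which reaches beyond \<rho>.\<close>

lemma radial_submean_maximum:
  fixes \<phi> :: "complex \<Rightarrow> real"
  assumes cont: "continuous_on (cball 0 1) \<phi>" and nonneg: "\<And>w. cmod w \<le> 1 \<Longrightarrow> 0 \<le> \<phi> w"
    and radial: "\<And>w. cmod w \<le> 1 \<Longrightarrow> \<phi> w = \<phi> (of_real (cmod w))"
    and \<eta>: "\<eta> > 0"
    and submean: "\<And>a r. 0 < r \<Longrightarrow> r \<le> \<eta> \<Longrightarrow> cball a r \<subseteq> cball 0 1 \<Longrightarrow>
      ennreal (\<phi> a) \<le> (\<integral>\<^sup>+t. indicator {0..1} t * ennreal (\<phi> (circlepath a r t)) \<partial>lborel)"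
    and w: "cmod w \<le> 1"
  shows "\<phi> w \<le> \<phi> 1"
proof -
  obtain a where a: "cmod a \<le> 1" and amax: "\<And>v. cmod v \<le> 1 \<Longrightarrow> \<phi> v \<le> \<phi> a"
    using continuous_attains_sup[OF _ _ cont] by fastforce
  define S where "S = {\<rho>\<in>{0..1::real}. \<phi> (of_real \<rho>) = \<phi> a}"
  have contR: "continuous_on {0..1} (\<lambda>\<rho>::real. \<phi> (of_real \<rho>))"
    by (rule continuous_on_compose2[OF cont]) (auto intro!: continuous_intros)
  have Sne: "S \<noteq> {}" using a radial[OF a] by (auto simp: S_def)
  have Sco: "compact S"
  proof -
    have "closed S"
      unfolding S_def by (rule continuous_closed_preimage_constant[OF contR]) simp
    moreover have "bounded S" by (rule bounded_subset[of "{0..1}"]) (auto simp: S_def)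
    ultimately show ?thesis by (simp add: compact_eq_bounded_closed)
  qed
  obtain \<rho> where \<rho>: "\<rho> \<in> S" and \<rho>max: "\<And>x. x \<in> S \<Longrightarrow> x \<le> \<rho>"
    using compact_attains_sup[OF Sco Sne] by blast
  have \<rho>01: "0 \<le> \<rho>" "\<rho> \<le> 1" "\<phi> \<rho> = \<phi> a" using \<rho> by (auto simp: S_def)
  have "\<rho> = 1"
  proof (rule ccontr)
    assume "\<rho> \<noteq> 1"
    define r where "r = min \<eta> (1 - \<rho>)"
    have r: "0 < r" "r \<le> \<eta>" "\<rho> + r \<le> 1" using \<eta> \<rho>01 \<open>\<rho> \<noteq> 1\<close> by (auto simp: r_def)
    have sub: "cball (complex_of_real \<rho>) r \<subseteq> cball 0 1"
    proof
      fix v assume "v \<in> cball (complex_of_real \<rho>) r"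
      then have "cmod (v - \<rho>) \<le> r" by (simp add: dist_norm norm_minus_commute)
      moreover have "cmod v \<le> cmod (v - \<rho>) + cmod \<rho>" using norm_triangle_sub[of v "of_real \<rho>"] by simp
      ultimately show "v \<in> cball 0 1" using r \<rho>01 by simp
    qed
    define \<psi> where "\<psi> = (\<lambda>t. \<phi> (circlepath (of_real \<rho>) r t))"
    have inb: "cmod (circlepath (of_real \<rho>) r t) \<le> 1" for t
      using sub r by (auto simp: circlepath dist_norm norm_mult subset_iff)
    have cont\<psi>: "continuous_on {0..1} \<psi>"
      unfolding \<psi>_def by (rule continuous_on_compose2[OF cont])
        (use inb in \<open>auto simp: circlepath intro!: continuous_intros\<close>)
    have int\<psi>: "\<psi> integrable_on {0..1}" by (rule integrable_continuous_interval[OF cont\<psi>])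
    have "ennreal (\<phi> a) \<le> (\<integral>\<^sup>+t. indicator {0..1} t * ennreal (\<psi> t) \<partial>lborel)"
      using submean[OF r(1,2) sub] \<rho>01 by (simp add: \<psi>_def)
    also have "\<dots> = ennreal (integral {0..1} \<psi>)"
      by (rule nn_integral_eq_henstock[OF int\<psi>]) (simp add: \<psi>_def nonneg inb)
    finally have "\<phi> a \<le> integral {0..1} \<psi>"
      using integral_nonneg[OF int\<psi>] nonneg inb by (simp add: \<psi>_def ennreal_le_iff)
    moreover have "integral {0..1} (\<lambda>t. \<phi> a - \<psi> t) = \<phi> a - integral {0..1} \<psi>"
      using int\<psi> by (subst integral_diff) auto
    moreover have "0 \<le> integral {0..1} (\<lambda>t. \<phi> a - \<psi> t)"
      using int\<psi> by (intro integral_nonneg integrable_diff) (auto simp: \<psi>_def amax inb)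
    ultimately have "integral {0..1} (\<lambda>t. \<phi> a - \<psi> t) = 0" by simp
    moreover have "continuous_on {0..1} (\<lambda>t. \<phi> a - \<psi> t)" by (intro continuous_intros cont\<psi>)
    \<comment> \<open>The parameter 0 of the circle is its point \<open>\<rho> + r\<close>, the one
      farthest from the origin.\<close>
    ultimately have "\<phi> a - \<psi> 0 = 0"
      using integral_eq_0_iff[of 0 1 "\<lambda>t. \<phi> a - \<psi> t"] amax inb by (auto simp: \<psi>_def)
    then have "\<phi> (of_real (\<rho> + r)) = \<phi> a" by (simp add: \<psi>_def circlepath)
    then have "\<rho> + r \<in> S" using r \<rho>01 by (simp add: S_def)
    then show False using \<rho>max r by fastforce
  qed
  then show ?thesis using amax[OF w] \<rho>01 by simp
qed

text \<open>Averaging over a circle invariant measure produces a radial function of the slice parameter,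
  so that the maximum principle needs the sub-mean value property only for small radii.\<close>

lemma circular_submean_mono:
  fixes u :: "complex ^ 'n \<Rightarrow> real" and \<mu> :: "(complex ^ 'n) measure"
  assumes sets\<mu> [measurable_cong]: "sets \<mu> = sets borel" and fin: "finite_measure \<mu>"
    and circ: "\<And>c. cmod c = 1 \<Longrightarrow> distr \<mu> borel ((*s) c) = \<mu>"
    and z: "AE e in \<mu>. norm e \<le> 1 \<and> (\<forall>w. cmod w \<le> 1 \<longrightarrow> z + w *s e \<in> cball 0 1)"
    and cont: "continuous_on (cball 0 1) u" and nonneg: "\<And>x. x \<in> cball 0 1 \<Longrightarrow> 0 \<le> u x"
    and \<eta>: "\<eta> > 0"
    and submean: "\<And>x e r. 0 < r \<Longrightarrow> r \<le> \<eta> \<Longrightarrow> norm e \<le> 1 \<Longrightarrow>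
      (\<And>w. cmod w \<le> r \<Longrightarrow> x + w *s e \<in> cball 0 1) \<Longrightarrow>
      ennreal (u x) \<le> (\<integral>\<^sup>+t. indicator {0..1} t * ennreal (u (x + circlepath 0 r t *s e)) \<partial>lborel)"
    and \<rho>: "cmod \<rho> \<le> 1"
  shows "(\<integral>\<^sup>+e. indicator (cball 0 1) (z + \<rho> *s e) * ennreal (u (z + \<rho> *s e)) \<partial>\<mu>)
    \<le> (\<integral>\<^sup>+e. indicator (cball 0 1) (z + e) * ennreal (u (z + e)) \<partial>\<mu>)"
proof -
  interpret finite_measure \<mu> by fact
  interpret P: pair_sigma_finite \<mu> lborel ..
  have space\<mu>: "space \<mu> = UNIV" using sets_eq_imp_space_eq[OF sets\<mu>] by simp
  define v where "v = (\<lambda>x. indicator (cball 0 1) x * u x)"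
  have [measurable]: "v \<in> borel_measurable borel"
    using borel_measurable_continuous_on_indicator[OF _ cont] by (simp add: v_def)
  have smult [measurable]: "(\<lambda>e. w *s e) \<in> borel_measurable borel" for w :: complex
    by (intro borel_measurable_continuous_onI continuous_intros)
  have vnn: "0 \<le> v x" for x using nonneg by (simp add: v_def indicator_def)
  have vu: "v x = u x" if "x \<in> cball 0 1" for x using that by (simp add: v_def)
  obtain B where B: "\<And>x. x \<in> cball 0 1 \<Longrightarrow> u x \<le> B"
    using continuous_attains_sup[OF compact_cball _ cont] by fastforce
  have Bv: "norm (v x) \<le> \<bar>B\<bar>" for x using B[of x] nonneg[of x] by (auto simp: v_def indicator_def)
  define \<phi> where "\<phi> = (\<lambda>w. \<integral>e. v (z + w *s e) \<partial>\<mu>)"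
  have int: "integrable \<mu> (\<lambda>e. v (z + w *s e))" for w
    by (rule integrable_const_bound[of _ "\<bar>B\<bar>"]) (auto simp: Bv[simplified])
  have \<phi>nn: "(\<integral>\<^sup>+e. ennreal (v (z + w *s e)) \<partial>\<mu>) = ennreal (\<phi> w)" for w
    unfolding \<phi>_def by (intro nn_integral_eq_integral int) (simp add: vnn)
  have iv: "indicator (cball 0 1) x * ennreal (u x) = ennreal (v x)" for x
    by (simp add: v_def indicator_def)
  have "\<phi> \<rho> \<le> \<phi> 1"
  proof (rule radial_submean_maximum[OF _ _ _ \<eta>])
    show "0 \<le> \<phi> w" for w by (simp add: \<phi>_def vnn)
    show "\<phi> w = \<phi> (of_real (cmod w))" if "cmod w \<le> 1" for w
    proof -
      \<comment> \<open>The phase of \<open>w\<close> can be moved onto \<open>e\<close>, where the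
        invariance of the measure absorbs it.\<close>
      define c where "c = (if w = 0 then 1 else sgn w)"
      have c: "cmod c = 1" "w = of_real (cmod w) * c" by (auto simp: c_def norm_sgn sgn_eq norm_divide)
      have "\<phi> (of_real (cmod w)) = (\<integral>e. v (z + of_real (cmod w) *s e) \<partial>(distr \<mu> borel ((*s) c)))"
        by (simp add: \<phi>_def circ[OF c(1)])
      also have "\<dots> = (\<integral>e. v (z + of_real (cmod w) *s (c *s e)) \<partial>\<mu>)"
        by (subst integral_distr) measurable
      also have "\<dots> = \<phi> w" using c(2) by (simp add: \<phi>_def)
      finally show ?thesis by simp
    qed
    show "continuous_on (cball 0 1) \<phi>"
      unfolding continuous_on_iff
    proof (intro ballI allI impI)
      fix w :: complex and \<epsilon> :: real assume w: "w \<in> cball 0 1" and "\<epsilon> > 0"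
      \<comment> \<open>The summand 1 keeps \<open>m\<close> positive when the measure vanishes and
        makes the final estimate strict.\<close>
      define m where "m = measure \<mu> UNIV + 1"
      have m: "m > 0" by (simp add: m_def add_nonneg_pos)
      obtain d where d: "d > 0" and ud: "\<And>x y. x \<in> cball 0 1 \<Longrightarrow> y \<in> cball 0 1 \<Longrightarrow>
          dist x y < d \<Longrightarrow> dist (u x) (u y) < \<epsilon> / m"
        using compact_uniformly_continuous[OF cont compact_cball] \<open>\<epsilon> > 0\<close> m
        unfolding uniformly_continuous_on_def by (metis divide_pos_pos)
      show "\<exists>d>0. \<forall>w'\<in>cball 0 1. dist w' w < d \<longrightarrow> dist (\<phi> w') (\<phi> w) < \<epsilon>"
      proof (intro exI[of _ d] conjI ballI impI d)
        fix w' :: complex assume w': "w' \<in> cball 0 1" "dist w' w < d"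
        have "\<bar>\<phi> w' - \<phi> w\<bar> = \<bar>\<integral>e. v (z + w' *s e) - v (z + w *s e) \<partial>\<mu>\<bar>"
          unfolding \<phi>_def using int by simp
        also have "\<dots> \<le> (\<integral>e. \<bar>v (z + w' *s e) - v (z + w *s e)\<bar> \<partial>\<mu>)"
          by (rule integral_abs_bound)
        also have "\<dots> \<le> (\<integral>e. \<epsilon> / m \<partial>\<mu>)"
        proof (rule integral_mono_AE)
          show "AE e in \<mu>. \<bar>v (z + w' *s e) - v (z + w *s e)\<bar> \<le> \<epsilon> / m"
            using z
          proof eventually_elim
            case (elim e)
            have "dist (z + w' *s e) (z + w *s e) = norm ((w' - w) *s e)"
              by (simp add: dist_norm vector_sub_rdistrib)
            also have "\<dots> \<le> cmod (w' - w) * 1"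
              unfolding norm_cvec_smult using elim by (intro mult_left_mono) auto
            also have "\<dots> < d" using w' by (simp add: dist_norm)
            finally show ?case
              using ud[of "z + w' *s e" "z + w *s e"] elim w w' vu by (simp add: dist_real_def)
          qed
        qed (use int in auto)
        also have "\<dots> = measure \<mu> UNIV * (\<epsilon> / m)" by (simp add: space\<mu>)
        also have "\<dots> < m * (\<epsilon> / m)"
          using \<open>\<epsilon> > 0\<close> m by (intro mult_strict_right_mono) (auto simp: m_def)
        finally show "dist (\<phi> w') (\<phi> w) < \<epsilon>" using m by (simp add: dist_real_def)
      qed
    qed
  next
    fix a :: complex and r :: real assume r: "0 < r" "r \<le> \<eta>" and sub: "cball a r \<subseteq> cball 0 1"
    have cm [measurable]: "(\<lambda>t. circlepath b r t) \<in> borel_measurable borel" for b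
      unfolding circlepath by (intro borel_measurable_continuous_onI continuous_intros)
    have [measurable]: "(\<lambda>(e :: complex ^ 'n, t). circlepath a r t *s e) \<in> borel_measurable (\<mu> \<Otimes>\<^sub>M lborel)"
    proof -
      have "(\<lambda>x. circlepath a r (snd x) *s (fst x :: complex ^ 'n)) \<in> borel_measurable borel"
        unfolding circlepath by (intro borel_measurable_continuous_onI continuous_intros)
      then show ?thesis
        by (simp add: split_beta' borel_prod
            measurable_cong_sets[OF sets_pair_measure_cong[OF sets\<mu> sets_lborel] refl])
    qed
    have "ennreal (\<phi> a) = (\<integral>\<^sup>+e. ennreal (v (z + a *s e)) \<partial>\<mu>)" by (rule \<phi>nn[symmetric])
    \<comment> \<open>The disc about \<open>a\<close> lies in the closed unit disc, so for almost
      every direction \<open>e\<close> its image about \<open>z + a *s e\<close> lies in the closed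
      ball, where the hypothesis on \<open>u\<close> applies; Fubini then passes the inequality on
      to the average.\<close>
    also have "\<dots> \<le> (\<integral>\<^sup>+e. (\<integral>\<^sup>+t. indicator {0..1} t * ennreal (v (z + circlepath a r t *s e)) \<partial>lborel) \<partial>\<mu>)"
    proof (rule nn_integral_mono_AE, use z in eventually_elim)
      case (elim e)
      have *: "z + a *s e + w *s e = z + (a + w) *s e" for w
        by (simp add: vec.scale_left_distrib)
      have in1: "z + a *s e + w *s e \<in> cball 0 1" if "cmod w \<le> r" for w
      proof -
        have "a + w \<in> cball a r" using that by (simp add: dist_norm)
        then have "cmod (a + w) \<le> 1" using sub by auto
        then show ?thesis unfolding * using elim by blast
      qed
      have "ennreal (u (z + a *s e)) \<le> (\<integral>\<^sup>+t. indicator {0..1} t * ennreal (u (z + a *s e + circlepath 0 r t *s e)) \<partial>lborel)"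
        using elim in1 by (intro submean r) auto
      also have "\<dots> = (\<integral>\<^sup>+t. indicator {0..1} t * ennreal (v (z + circlepath a r t *s e)) \<partial>lborel)"
      proof (rule nn_integral_cong)
        fix t
        have "a + circlepath 0 r t = circlepath a r t" by (simp add: circlepath)
        moreover have "cmod (circlepath 0 r t) \<le> r" using r by (simp add: circlepath norm_mult)
        ultimately show "indicator {0..1} t * ennreal (u (z + a *s e + circlepath 0 r t *s e))
            = indicator {0..1} t * ennreal (v (z + circlepath a r t *s e))"
          using in1 vu * by metis
      qed
      finally show ?case using in1[of 0] r vu by simp
    qed
    also have "\<dots> = (\<integral>\<^sup>+t. (\<integral>\<^sup>+e. indicator {0..1} t * ennreal (v (z + circlepath a r t *s e)) \<partial>\<mu>) \<partial>lborel)"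
      by (rule P.Fubini'[symmetric]) measurable
    also have "\<dots> = (\<integral>\<^sup>+t. indicator {0..1} t * ennreal (\<phi> (circlepath a r t)) \<partial>lborel)"
      by (subst nn_integral_cmult) (auto simp: \<phi>nn)
    finally show "ennreal (\<phi> a) \<le> \<dots>" .
  qed (use \<rho> in auto)
  then show ?thesis
    unfolding iv using \<phi>nn[of \<rho>] \<phi>nn[of 1] by (simp add: ennreal_leI)
qed

section \<open>Holomorphic functions of several variables and their powers\<close>

lemma holomorphic_cn_subset: "holomorphic_cn f S \<Longrightarrow> T \<subseteq> S \<Longrightarrow> holomorphic_cn f T"
  unfolding holomorphic_cn_def by blast

lemma holomorphic_cn_imp_continuous_on: "holomorphic_cn f S \<Longrightarrow> continuous_on S f"
  unfolding holomorphic_cn_def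
  by (metis continuous_at_imp_continuous_on has_derivative_continuous)

lemma holomorphic_cn_mult:
  assumes "holomorphic_cn f S" "holomorphic_cn g S"
  shows "holomorphic_cn (\<lambda>z. f z * g z) S"
  unfolding holomorphic_cn_def
proof
  fix z assume "z \<in> S"
  then obtain D E where "(f has_derivative D) (at z)" "\<And>c v. D (c *s v) = c * D v"
    and "(g has_derivative E) (at z)" "\<And>c v. E (c *s v) = c * E v"
    using assms unfolding holomorphic_cn_def by meson
  then show "\<exists>D. ((\<lambda>z. f z * g z) has_derivative D) (at z) \<and> (\<forall>c v. D (c *s v) = c * D v)"
    by (intro exI[of _ "\<lambda>v. f z * E v + D v * g z"] conjI)
      (rule has_derivative_mult, assumption+, simp add: algebra_simps)
qed

lemma holomorphic_cn_compose:
  assumes "holomorphic_cn f S" and "\<And>z. z \<in> S \<Longrightarrow> g field_differentiable at (f z)"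
  shows "holomorphic_cn (\<lambda>z. g (f z)) S"
  unfolding holomorphic_cn_def
proof
  fix z assume z: "z \<in> S"
  then obtain D where D: "(f has_derivative D) (at z)" "\<And>c v. D (c *s v) = c * D v"
    using assms unfolding holomorphic_cn_def by meson
  obtain g' where "(g has_field_derivative g') (at (f z))"
    using assms(2)[OF z] unfolding field_differentiable_def by blast
  then have "((\<lambda>z. g (f z)) has_derivative (\<lambda>v. g' * D v)) (at z)"
    by (intro has_derivative_compose[OF D(1), of g "\<lambda>h. g' * h"])
      (simp add: has_field_derivative_def)
  then show "\<exists>D. ((\<lambda>z. g (f z)) has_derivative D) (at z) \<and> (\<forall>c v. D (c *s v) = c * D v)"
    using D(2) by (intro exI[of _ "\<lambda>v. g' * D v"]) (simp add: algebra_simps)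
qed

lemma holomorphic_cn_herm: "holomorphic_cn (\<lambda>z. herm z w) S"
  unfolding holomorphic_cn_def
proof
  fix z :: "complex ^ 'a"
  have "bounded_linear (\<lambda>z. herm z w)"
    by (rule bounded_linear_intro[where K="norm w"])
      (auto simp: herm_simps norm_herm_le scaleR_conv_of_real[where 'a=complex])
  then show "\<exists>D. ((\<lambda>z. herm z w) has_derivative D) (at z) \<and> (\<forall>c v. D (c *s v) = c * D v)"
    by (intro exI[of _ "\<lambda>z. herm z w"]) (auto simp: herm_simps intro: bounded_linear_imp_has_derivative)
qed

lemma holomorphic_cn_scaleR:
  assumes "holomorphic_cn f S" and "\<And>z. z \<in> T \<Longrightarrow> r *\<^sub>R z \<in> S"
  shows "holomorphic_cn (\<lambda>z. f (r *\<^sub>R z)) T"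
  unfolding holomorphic_cn_def
proof
  fix z assume "z \<in> T"
  then obtain D where D: "(f has_derivative D) (at (r *\<^sub>R z))" "\<And>c v. D (c *s v) = c * D v"
    using assms unfolding holomorphic_cn_def by meson
  have "((\<lambda>z. f (r *\<^sub>R z)) has_derivative (\<lambda>v. D (r *\<^sub>R v))) (at z)"
    by (rule has_derivative_compose[where f="\<lambda>z. r *\<^sub>R z", OF _ D(1)]) (auto intro!: derivative_eq_intros)
  moreover have "r *\<^sub>R (c *s v) = c *s (r *\<^sub>R v)" for c and v :: "complex ^ 'a"
    by (simp add: vec_eq_iff)
  ultimately show "\<exists>D. ((\<lambda>z. f (r *\<^sub>R z)) has_derivative D) (at z) \<and> (\<forall>c v. D (c *s v) = c * D v)"
    using D(2) by (intro exI[of _ "\<lambda>v. D (r *\<^sub>R v)"]) simp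
qed

text \<open>Complex linearity of the derivative \<open>D\<close> turns it, along the direction
  \<open>e\<close>, into multiplication by \<open>D e\<close>; this gives access to one-variable
  theory on complex lines.\<close>

lemma holomorphic_cn_slice:
  assumes "holomorphic_cn f S" and "\<And>w. w \<in> T \<Longrightarrow> x + w *s e \<in> S"
  shows "(\<lambda>w. f (x + w *s e)) holomorphic_on T"
  unfolding holomorphic_on_def
proof
  fix w assume w: "w \<in> T"
  then obtain D where D: "(f has_derivative D) (at (x + w *s e))" "\<And>c v. D (c *s v) = c * D v"
    using assms unfolding holomorphic_cn_def by meson
  have "bounded_linear (\<lambda>h. h *s e)"
    by (rule bounded_linear_intro[where K="norm e"])
      (auto simp: norm_cvec_smult vec_eq_iff algebra_simps)
  then have "((\<lambda>w. x + w *s e) has_derivative (\<lambda>h. h *s e)) (at w)"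
    by (auto intro!: derivative_eq_intros bounded_linear_imp_has_derivative)
  then have "((\<lambda>w. f (x + w *s e)) has_derivative (\<lambda>h. D (h *s e))) (at w)"
    by (rule has_derivative_compose[where f="\<lambda>w. x + w *s e", OF _ D(1)])
  then have "((\<lambda>w. f (x + w *s e)) has_field_derivative D e) (at w)"
    by (simp add: has_field_derivative_def D(2) mult_commute_abs)
  then show "(\<lambda>w. f (x + w *s e)) field_differentiable at w within T"
    using field_differentiable_at_within field_differentiable_def by blast
qed

text \<open>The truncation \<open>max |G| \<epsilon>\<close> has the sub-mean value property for all radii below a bound
  independent of the centre: either the value at the centre is the minimum \<open>\<epsilon>\<close>, or \<open>G\<close> has no zero
  nearby.\<close>

lemma truncated_modulus_submean:
  fixes G :: "complex ^ 'n \<Rightarrow> complex"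
  assumes G: "holomorphic_cn G (ball 0 R)" and R: "R > 1" and q: "q > 0" and \<epsilon>: "\<epsilon> > 0"
  obtains \<eta> where "\<eta> > 0"
    "\<And>x e r. 0 < r \<Longrightarrow> r \<le> \<eta> \<Longrightarrow> norm e \<le> 1 \<Longrightarrow> x \<in> cball 0 1 \<Longrightarrow>
      ennreal (max (cmod (G x)) \<epsilon> powr q)
      \<le> (\<integral>\<^sup>+t. indicator {0..1} t * ennreal (max (cmod (G (x + circlepath 0 r t *s e))) \<epsilon> powr q) \<partial>lborel)"
proof -
  define R' where "R' = (1 + R) / 2"
  have R': "1 < R'" "R' < R" using R by (auto simp: R'_def)
  have "continuous_on (cball 0 R') G"
    using holomorphic_cn_imp_continuous_on[OF G] by (rule continuous_on_subset) (use R' in auto)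
  then obtain d where d: "d > 0"
    and ud: "\<And>x y. x \<in> cball 0 R' \<Longrightarrow> y \<in> cball 0 R' \<Longrightarrow> dist x y < d \<Longrightarrow> dist (G x) (G y) < \<epsilon>"
    using compact_uniformly_continuous[OF _ compact_cball] \<epsilon>
    unfolding uniformly_continuous_on_def by metis
  \<comment> \<open>The half leaves room: on the open disc of radius \<open>2 * \<eta>\<close> the
    slice stays in the ball of radius \<open>R'\<close> and \<open>G\<close> varies by less than
    \<epsilon>, and this disc contains every closed disc of radius at most \<eta>.\<close>
  define \<eta> where "\<eta> = min d (R' - 1) / 2"
  have \<eta>: "\<eta> > 0" "2 * \<eta> \<le> d" "2 * \<eta> \<le> R' - 1" using d R' by (auto simp: \<eta>_def)
  show ?thesis
  proof (rule that[OF \<eta>(1)])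
    fix x e :: "complex ^ 'n" and r :: real
    assume r: "0 < r" "r \<le> \<eta>" and e: "norm e \<le> 1" and x: "x \<in> cball 0 1"
    show "ennreal (max (cmod (G x)) \<epsilon> powr q)
      \<le> (\<integral>\<^sup>+t. indicator {0..1} t * ennreal (max (cmod (G (x + circlepath 0 r t *s e))) \<epsilon> powr q) \<partial>lborel)"
    proof (cases "cmod (G x) \<le> \<epsilon>")
      case True
      have "ennreal (max (cmod (G x)) \<epsilon> powr q) = (\<integral>\<^sup>+t. indicator {0..1::real} t * ennreal (\<epsilon> powr q) \<partial>lborel)"
        using True by (simp add: nn_integral_multc max_absorb2)
      also have "\<dots> \<le> (\<integral>\<^sup>+t. indicator {0..1} t * ennreal (max (cmod (G (x + circlepath 0 r t *s e))) \<epsilon> powr q) \<partial>lborel)"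
        using \<epsilon> q by (intro nn_integral_mono mult_left_mono ennreal_leI powr_mono2) auto
      finally show ?thesis .
    next
      case False
      have near: "x + w *s e \<in> cball 0 R'" "dist (x + w *s e) x < d" if "cmod w < 2 * \<eta>" for w
      proof -
        have "norm (w *s e) \<le> cmod w * 1"
          unfolding norm_cvec_smult using e by (intro mult_left_mono) auto
        then have nw: "norm (w *s e) < 2 * \<eta>" using that by simp
        show "x + w *s e \<in> cball 0 R'" using nw x \<eta> norm_triangle_ineq[of x "w *s e"] by simp
        show "dist (x + w *s e) x < d" using nw \<eta> by (simp add: dist_norm)
      qed
      have hol: "(\<lambda>w. G (x + w *s e)) holomorphic_on ball 0 (2 * \<eta>)"
        by (rule holomorphic_cn_slice[OF G]) (use near(1) R' in fastforce)
      have nz: "G (x + w *s e) \<noteq> 0" if "w \<in> ball 0 (2 * \<eta>)" for w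
      proof
        assume "G (x + w *s e) = 0"
        moreover have "dist (G (x + w *s e)) (G x) < \<epsilon>"
          using near[of w] that x R' by (intro ud) auto
        ultimately show False using False by simp
      qed
      have "ennreal (max (cmod (G x)) \<epsilon> powr q) = ennreal (cmod (G (x + 0 *s e)) powr q)"
        using False by (simp add: max_absorb1)
      also have "\<dots> \<le> (\<integral>\<^sup>+t. indicator {0..1} t * ennreal (cmod (G (x + circlepath 0 r t *s e)) powr q) \<partial>lborel)"
        by (rule nonvanishing_mean_value[OF hol nz]) (use r \<eta> in auto)
      also have "\<dots> \<le> (\<integral>\<^sup>+t. indicator {0..1} t * ennreal (max (cmod (G (x + circlepath 0 r t *s e))) \<epsilon> powr q) \<partial>lborel)"
        using q by (intro nn_integral_mono mult_left_mono ennreal_leI powr_mono2) auto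
      finally show ?thesis .
    qed
  qed
qed

lemma borel_measurable_holomorphic_modulus:
  fixes G :: "complex ^ 'n \<Rightarrow> complex"
  assumes G: "holomorphic_cn G S" and "K \<subseteq> S" "K \<in> sets borel" and q: "q > 0"
  shows "(\<lambda>x. indicator K x * ennreal (cmod (G x) powr q)) \<in> borel_measurable borel"
proof -
  have "continuous_on K G"
    using holomorphic_cn_imp_continuous_on[OF G] assms(2) by (rule continuous_on_subset)
  then have "(\<lambda>x. indicator K x *\<^sub>R (cmod (G x) powr q)) \<in> borel_measurable borel"
    using q by (intro borel_measurable_continuous_on_indicator continuous_on_powr' continuous_intros assms) auto
  then have "(\<lambda>x. ennreal (indicator K x *\<^sub>R (cmod (G x) powr q))) \<in> borel_measurable borel"
    by simp
  then show ?thesis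
    by (rule measurable_cong[THEN iffD1, rotated]) (simp add: indicator_def)
qed

text \<open>The truncation at \<epsilon> costs at most \<open>\<epsilon> powr q\<close> times the
  total mass, which can be made arbitrarily small. Two cases are used: \<open>\<rho> = 0\<close>
  bounds the value at \<open>z\<close> by a mean over a circular neighbourhood, and
  \<open>z = 0\<close> on \<open>surf\<close> says that spherical means increase with the radius.
  The indicator cuts off the region where \<open>G\<close> is arbitrary.\<close>

lemma circular_mean_mono:
  fixes G :: "complex ^ 'n \<Rightarrow> complex" and \<mu> :: "(complex ^ 'n) measure"
  assumes sets\<mu> [measurable_cong]: "sets \<mu> = sets borel" and fin: "finite_measure \<mu>"
    and circ: "\<And>c. cmod c = 1 \<Longrightarrow> distr \<mu> borel ((*s) c) = \<mu>"
    and z: "AE e in \<mu>. norm e \<le> 1 \<and> (\<forall>w. cmod w \<le> 1 \<longrightarrow> z + w *s e \<in> cball 0 1)"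
    and G: "holomorphic_cn G (ball 0 R)" and R: "R > 1" and q: "q > 0"
    and \<rho>: "cmod \<rho> \<le> 1"
  shows "(\<integral>\<^sup>+e. indicator (cball 0 1) (z + \<rho> *s e) * ennreal (cmod (G (z + \<rho> *s e)) powr q) \<partial>\<mu>)
    \<le> (\<integral>\<^sup>+e. indicator (cball 0 1) (z + e) * ennreal (cmod (G (z + e)) powr q) \<partial>\<mu>)"
    (is "?L \<le> ?I")
proof (rule ennreal_le_epsilon)
  fix \<kappa> :: real assume "\<kappa> > 0"
  interpret finite_measure \<mu> by fact
  have space\<mu>: "space \<mu> = UNIV" using sets_eq_imp_space_eq[OF sets\<mu>] by simp
  define m where "m = measure \<mu> UNIV"
  have m: "emeasure \<mu> UNIV = ennreal m" "m \<ge> 0" by (auto simp: m_def emeasure_eq_measure)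
  \<comment> \<open>Chosen so that \<open>\<epsilon> powr q * m\<close> is at most \<kappa>, also
    when the total mass \<open>m\<close> is 0.\<close>
  define \<epsilon> where "\<epsilon> = (\<kappa> / (m + 1)) powr (1 / q)"
  have \<epsilon>: "\<epsilon> > 0" using \<open>\<kappa> > 0\<close> m by (simp add: \<epsilon>_def)
  have \<epsilon>q: "\<epsilon> powr q * m \<le> \<kappa>"
    using \<open>\<kappa> > 0\<close> m q by (simp add: \<epsilon>_def powr_powr field_simps)
  define u where "u = (\<lambda>x. max (cmod (G x)) \<epsilon> powr q)"
  have contG: "continuous_on (cball 0 1) G"
    using holomorphic_cn_imp_continuous_on[OF G] by (rule continuous_on_subset) (use R in auto)
  have [measurable]: "(\<lambda>x. indicator (cball 0 1) x * ennreal (cmod (G x) powr q)) \<in> borel_measurable borel"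
    by (rule borel_measurable_holomorphic_modulus[OF G _ _ q]) (use R in auto)
  have le: "ennreal (cmod (G x) powr q) \<le> ennreal (u x)" "ennreal (u x) \<le> ennreal (cmod (G x) powr q) + ennreal (\<epsilon> powr q)" for x
    unfolding u_def using q \<epsilon>
    by (auto intro!: ennreal_leI powr_mono2 simp: max_def simp flip: ennreal_plus)
  obtain \<eta> where \<eta>: "\<eta> > 0" and submean': "\<And>x e r. 0 < r \<Longrightarrow> r \<le> \<eta> \<Longrightarrow> norm e \<le> 1 \<Longrightarrow> x \<in> cball 0 1 \<Longrightarrow>
      ennreal (max (cmod (G x)) \<epsilon> powr q)
      \<le> (\<integral>\<^sup>+t. indicator {0..1} t * ennreal (max (cmod (G (x + circlepath 0 r t *s e))) \<epsilon> powr q) \<partial>lborel)"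
    by (rule truncated_modulus_submean[OF G R q \<epsilon>]) (rule that)
  have submean: "ennreal (u x) \<le> (\<integral>\<^sup>+t. indicator {0..1} t * ennreal (u (x + circlepath 0 r t *s e)) \<partial>lborel)"
    if "0 < r" "r \<le> \<eta>" "norm e \<le> 1" "x \<in> cball 0 1" for x e r
    unfolding u_def by (rule submean'[OF that])
  have "?L \<le> (\<integral>\<^sup>+e. indicator (cball 0 1) (z + \<rho> *s e) * ennreal (u (z + \<rho> *s e)) \<partial>\<mu>)"
    by (intro nn_integral_mono mult_left_mono le) simp
  also have "\<dots> \<le> (\<integral>\<^sup>+e. indicator (cball 0 1) (z + e) * ennreal (u (z + e)) \<partial>\<mu>)"
  proof (rule circular_submean_mono[OF sets\<mu> fin circ z _ _ \<eta> _ \<rho>])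
    show "continuous_on (cball 0 1) u"
      unfolding u_def using \<epsilon> q by (intro continuous_intros contG) auto
    show "0 \<le> u x" for x by (simp add: u_def)
    fix x e :: "complex ^ 'n" and r :: real
    assume r: "0 < r" "r \<le> \<eta>" "norm e \<le> 1" "\<And>w. cmod w \<le> r \<Longrightarrow> x + w *s e \<in> cball 0 1"
    show "ennreal (u x) \<le> (\<integral>\<^sup>+t. indicator {0..1} t * ennreal (u (x + circlepath 0 r t *s e)) \<partial>lborel)"
      by (rule submean[OF r(1-3)]) (use r(1) r(4)[of 0] in simp)
  qed
  also have "\<dots> \<le> (\<integral>\<^sup>+e. indicator (cball 0 1) (z + e) * ennreal (cmod (G (z + e)) powr q) + ennreal (\<epsilon> powr q) \<partial>\<mu>)"
    by (intro nn_integral_mono) (use le(2) in \<open>simp add: indicator_def\<close>)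
  also have "\<dots> = ?I + ennreal (\<epsilon> powr q) * ennreal m"
    by (subst nn_integral_add) (simp_all add: space\<mu> m)
  also have "\<dots> \<le> ?I + ennreal \<kappa>"
    using \<epsilon>q m by (intro add_left_mono) (simp flip: ennreal_mult add: ennreal_leI)
  finally show "?L \<le> ?I + ennreal \<kappa>" .
qed

subsection \<open>Nonisotropic balls\<close>

lemma borel_measurable_herm [measurable]:
  assumes "f \<in> borel_measurable M" "g \<in> borel_measurable M"
  shows "(\<lambda>x. herm (f x) (g x :: complex ^ 'n)) \<in> borel_measurable M"
  by (rule borel_measurable_continuous_Pair[OF assms]) (intro continuous_intros)

lemma borel_measurable_cvec_nth [measurable]:
  "(\<lambda>x :: complex ^ 'n. x $ j) \<in> borel_measurable borel"
  by (intro borel_measurable_continuous_onI continuous_intros)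

lemma herm_axis: "herm x (axis k 1) = x $ k"
  by (simp add: herm_def axis_def if_distrib[of cnj] if_distrib[of "(*) _"] cong: if_cong)

lemma norm_cvec_axis: "norm (axis k 1 :: complex ^ 'n) = 1"
proof -
  have "complex_of_real ((norm (axis k 1 :: complex ^ 'n))\<^sup>2) = 1"
    unfolding herm_self[symmetric] herm_axis by (simp add: axis_def)
  then have "(norm (axis k 1 :: complex ^ 'n))\<^sup>2 = 1"
    using of_real_eq_1_iff by blast
  then show ?thesis using norm_ge_zero power2_eq_1_iff by fastforce
qed

text \<open>A unitary map turns \<open>z\<close> into the direction of a coordinate axis. The set
  then contains a box of half-width of order \<delta> in that complex coordinate and of order
  \<open>sqrt \<delta>\<close> in the \<open>n - 1\<close> others, with volume of order
  \<open>\<delta>^2 * \<delta>^(n-1)\<close>.\<close>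

lemma emeasure_koranyi_neighbourhood_ge:
  fixes z :: "complex ^ 'n"
  assumes z: "norm z \<le> 1" and \<delta>: "0 < \<delta>" "\<delta> \<le> 1"
  shows "ennreal (4 / (8 * CARD('n)) ^ 2 * (1 / (2 * CARD('n))) ^ (CARD('n) - 1) * \<delta> ^ (CARD('n) + 1))
    \<le> emeasure lborel {e. cmod (herm e z) < \<delta> / 4 \<and> (norm e)\<^sup>2 < \<delta> / 4}"
proof -
  define n where "n = CARD('n)"
  have n: "n > 0" by (simp add: n_def)
  define E where "E = {e. cmod (herm e z) < \<delta> / 4 \<and> (norm e)\<^sup>2 < \<delta> / 4}"
  have [measurable]: "E \<in> sets borel" unfolding E_def by measurable
  define k :: 'n where "k = undefined"
  define \<xi> where "\<xi> = (if z = 0 then axis k 1 else z /\<^sub>R norm z)"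
  have \<xi>: "norm \<xi> = 1" "z = norm z *\<^sub>R \<xi>" by (auto simp: \<xi>_def norm_cvec_axis)
  obtain U :: "complex ^ 'n \<Rightarrow> complex ^ 'n" where lin: "linear U"
    and U: "\<And>v w. herm (U v) (U w) = herm v w" and U\<xi>: "U (axis k 1) = \<xi>"
    using unitary_map_exists[of "axis k 1" \<xi>] \<xi> by (auto simp: norm_cvec_axis)
  have iso: "norm (U x) = norm x" for x by (rule linear_herm_preserving_norm[OF U])
  \<comment> \<open>Each of the \<open>2 * n\<close> real coordinates has square below
    \<open>s\<close>, so that the squared norm stays below
    \<open>2 * n * s = \<delta> / 4\<close>.\<close>
  define s where "s = \<delta> / (8 * n)"
  have s: "0 < s" "s \<le> 1" using \<delta> n by (auto simp: s_def field_simps)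
  define a where "a = (\<lambda>j. if j = k then s else sqrt s)"
  have a0: "0 \<le> a j" for j using s by (simp add: a_def)
  have a2: "(a j)\<^sup>2 \<le> s" for j
    using s by (simp add: a_def power2_eq_square mult_left_le_one_le)
  define Q where "Q = {w :: complex ^ 'n. \<forall>j. \<bar>Re (w $ j)\<bar> < a j \<and> \<bar>Im (w $ j)\<bar> < a j}"
  have QE: "U w \<in> E" if w: "w \<in> Q" for w
  proof -
    have sq: "(cmod (w $ j))\<^sup>2 < 2 * s" for j
    proof -
      have "(Re (w $ j))\<^sup>2 < (a j)\<^sup>2" "(Im (w $ j))\<^sup>2 < (a j)\<^sup>2"
        using w a0[of j] by (auto simp: Q_def abs_square_less_1 power2_strict_mono intro: power2_strict_mono)
      then show ?thesis using a2[of j] by (simp add: cmod_power2)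
    qed
    have "(norm w)\<^sup>2 = (\<Sum>j\<in>UNIV. (cmod (w $ j))\<^sup>2)"
      by (simp add: norm_vec_def L2_set_def sum_nonneg)
    also have "\<dots> < (\<Sum>j\<in>(UNIV :: 'n set). 2 * s)"
      by (rule sum_strict_mono) (use sq in auto)
    also have "\<dots> = \<delta> / 4" using n by (simp add: s_def n_def)
    finally have "(norm w)\<^sup>2 < \<delta> / 4" .
    moreover have "cmod (herm (U w) z) < \<delta> / 4"
    proof -
      have "herm (U w) z = norm z * (w $ k)"
        by (subst \<xi>(2)) (simp add: herm_simps U U\<xi>[symmetric] herm_axis)
      then have "cmod (herm (U w) z) \<le> 1 * cmod (w $ k)"
        using z by (simp add: norm_mult mult_left_le_one_le)
      also have "cmod (w $ k) < s + s"
      proof -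
        have "\<bar>Re (w $ k)\<bar> < a k" "\<bar>Im (w $ k)\<bar> < a k" using w unfolding Q_def by blast+
        then show ?thesis using cmod_le[of "w $ k"] by (simp add: a_def)
      qed
      also have "s + s \<le> \<delta> / 4" using \<delta> n by (simp add: s_def field_simps)
      finally show ?thesis by simp
    qed
    ultimately show ?thesis by (simp add: E_def iso)
  qed
  have Q: "emeasure lborel Q = ennreal (\<Prod>j\<in>UNIV. 4 * a j * a j)"
    unfolding Q_def by (rule emeasure_complex_box) (use a0 in auto)
  have "(\<Prod>j\<in>UNIV. 4 * a j * a j) = (4 * a k * a k) * (\<Prod>j\<in>UNIV - {k}. 4 * a j * a j)"
    by (rule prod.remove) auto
  also have "(\<Prod>j\<in>UNIV - {k}. 4 * a j * a j) = (\<Prod>j\<in>UNIV - {k}. 4 * s)"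
    using s by (intro prod.cong) (auto simp: a_def)
  also have "\<dots> = (4 * s) ^ (n - 1)" by (simp add: n_def card_Diff_singleton)
  also have "4 * a k * a k * (4 * s) ^ (n - 1)
      = 4 / (8 * n) ^ 2 * (1 / (2 * n)) ^ (n - 1) * (\<delta> ^ 2 * \<delta> ^ (n - 1))"
    by (simp add: a_def s_def power_mult_distrib power_divide power2_eq_square field_simps)
  also have "\<delta> ^ 2 * \<delta> ^ (n - 1) = \<delta> ^ (n + 1)"
    using n by (simp flip: power_add)
  finally have "ennreal (4 / (8 * n) ^ 2 * (1 / (2 * n)) ^ (n - 1) * \<delta> ^ (n + 1)) = emeasure lborel Q"
    by (simp add: Q)
  also have "\<dots> = (\<integral>\<^sup>+w. indicator Q w \<partial>lborel)"
  proof -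
    have "Q \<in> sets borel" unfolding Q_def by measurable
    then show ?thesis by simp
  qed
  also have "\<dots> \<le> (\<integral>\<^sup>+w. indicator E (U w) \<partial>lborel)"
    by (intro nn_integral_mono) (use QE in \<open>auto simp: indicator_def\<close>)
  also have "\<dots> = (\<integral>\<^sup>+w. indicator E w \<partial>lborel)"
    by (rule nn_integral_lborel_isometry[OF lin iso]) simp
  also have "\<dots> = emeasure lborel E" by simp
  finally show ?thesis by (simp add: E_def n_def)
qed

text \<open>The measure is the volume of the cone over the ball. With \<xi> rotated to an axis, a
  point \<open>y\<close> of the sphere with \<open>cmod (1 - y $ k) < t\<close> has
  \<open>\<bar>Im (y $ k)\<bar> < t\<close> and \<open>(cmod (y $ j))\<^sup>2 \<le> 1 - (cmod (y $
  k))\<^sup>2 < 2 * t\<close> for the other \<open>j\<close>. The real part in coordinate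
  \<open>k\<close> is bounded only by 1, as it runs along the cone; so the volume is of order
  \<open>t * t^(n-1)\<close>.\<close>

lemma emeasure_surf_koranyi_ball_le:
  fixes \<xi> :: "complex ^ 'n"
  assumes \<xi>: "norm \<xi> = 1" and t: "0 < t"
  shows "emeasure surf {\<zeta>. cmod (1 - herm \<zeta> \<xi>) < t} \<le> ennreal (8 ^ CARD('n) * t ^ CARD('n))"
proof -
  define n where "n = CARD('n)"
  have n: "n > 0" by (simp add: n_def)
  define B where "B = {\<zeta>. cmod (1 - herm \<zeta> \<xi>) < t}"
  have [measurable]: "B \<in> sets borel" unfolding B_def by measurable
  define k :: 'n where "k = undefined"
  obtain U :: "complex ^ 'n \<Rightarrow> complex ^ 'n" where lin: "linear U"
    and U: "\<And>v w. herm (U v) (U w) = herm v w" and U\<xi>: "U (axis k 1) = \<xi>"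
    using unitary_map_exists[of "axis k 1" \<xi>] \<xi> by (auto simp: norm_cvec_axis)
  have iso: "norm (U x) = norm x" for x by (rule linear_herm_preserving_norm[OF U])
  define a where "a = (\<lambda>j. if j = k then 1 else sqrt (2 * t))"
  define b where "b = (\<lambda>j. if j = k then t else sqrt (2 * t))"
  have ab: "0 \<le> a j" "0 \<le> b j" for j using t by (auto simp: a_def b_def)
  define Q where "Q = {w :: complex ^ 'n. \<forall>j. \<bar>Re (w $ j)\<bar> < a j \<and> \<bar>Im (w $ j)\<bar> < b j}"
  have Q: "emeasure lborel Q = ennreal (\<Prod>j\<in>UNIV. 4 * a j * b j)"
    unfolding Q_def by (rule emeasure_complex_box) (use ab in auto)
  have inQ: "x \<in> Q" if x: "x \<noteq> 0" "norm x < 1" and xB: "cmod (1 - sgn x $ k) < t" for x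
  proof -
    define y where "y = sgn x"
    have y: "norm y = 1" "x = norm x *\<^sub>R y" using x by (auto simp: y_def norm_sgn sgn_div_norm)
    have yk1: "cmod (y $ k) \<le> 1" using Finite_Cartesian_Product.norm_nth_le[of y k] y by simp
    have xy: "\<bar>Re (x $ j)\<bar> \<le> \<bar>Re (y $ j)\<bar>" "\<bar>Im (x $ j)\<bar> \<le> \<bar>Im (y $ j)\<bar>" for j
      using x by (subst y(2), simp add: abs_mult mult_left_le_one_le)+
    have "\<bar>Re (x $ j)\<bar> < a j \<and> \<bar>Im (x $ j)\<bar> < b j" for j
    proof (cases "j = k")
      case True
      have "\<bar>Re (x $ k)\<bar> \<le> norm x" using abs_Re_le_cmod[of "x $ k"] Finite_Cartesian_Product.norm_nth_le[of x k] by linarith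
      moreover have "\<bar>Im (y $ k)\<bar> \<le> cmod (1 - y $ k)" using abs_Im_le_cmod[of "1 - y $ k"] by simp
      ultimately show ?thesis using True x xB xy(2)[of k] by (simp add: a_def b_def y_def)
    next
      case False
      have "(cmod (y $ j))\<^sup>2 + (cmod (y $ k))\<^sup>2 = (\<Sum>i\<in>{j, k}. (cmod (y $ i))\<^sup>2)" using False by simp
      also have "\<dots> \<le> (\<Sum>i\<in>UNIV. (cmod (y $ i))\<^sup>2)" by (rule sum_mono2) auto
      also have "\<dots> = 1" using y(1) by (simp add: norm_vec_def L2_set_def)
      finally have "(cmod (y $ j))\<^sup>2 \<le> (1 - cmod (y $ k)) * (1 + cmod (y $ k))"
        by (simp add: power2_eq_square algebra_simps)
      also have "\<dots> \<le> (1 - cmod (y $ k)) * 2" using yk1 by (intro mult_left_mono) auto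
      also have "1 - cmod (y $ k) \<le> cmod (1 - y $ k)" using norm_triangle_ineq2[of 1 "y $ k"] by simp
      finally have "(cmod (y $ j))\<^sup>2 < 2 * t" using xB by (simp add: y_def)
      then have "cmod (y $ j) < sqrt (2 * t)" by (simp add: real_less_rsqrt)
      then show ?thesis
        using False xy[of j] abs_Re_le_cmod[of "y $ j"] abs_Im_le_cmod[of "y $ j"] by (simp add: a_def b_def)
    qed
    then show ?thesis by (simp add: Q_def)
  qed
  have "emeasure surf B = (\<integral>\<^sup>+w. indicator (ball 0 1) w * indicator B (sgn w) \<partial>lborel)"
    by (subst nn_integral_surf[symmetric]) auto
  also have "\<dots> = (\<integral>\<^sup>+x. indicator (ball 0 1) (U x) * indicator B (sgn (U x)) \<partial>lborel)"
    by (rule nn_integral_lborel_isometry[OF lin iso, symmetric]) simp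
  also have "\<dots> \<le> (\<integral>\<^sup>+x. indicator Q x \<partial>lborel)"
  proof (rule nn_integral_mono_AE, use AE_lborel_singleton[of "0 :: complex ^ 'n"] in eventually_elim)
    fix x :: "complex ^ 'n" assume x: "x \<noteq> 0"
    have "herm (sgn (U x)) \<xi> = sgn x $ k"
    proof -
      have "sgn (U x) = U (sgn x)" by (simp add: sgn_div_norm iso linear_scale[OF lin])
      then show ?thesis by (simp add: U\<xi>[symmetric] U herm_axis)
    qed
    then show "indicator (ball 0 1) (U x) * indicator B (sgn (U x)) \<le> (indicator Q x :: ennreal)"
      using inQ[OF x] by (auto simp: indicator_def iso B_def)
  qed
  also have "\<dots> = emeasure lborel Q"
  proof -
    have "Q \<in> sets borel" unfolding Q_def by measurable
    then show ?thesis by simp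
  qed
  finally have BQ: "emeasure surf B \<le> emeasure lborel Q" .
  have "(\<Prod>j\<in>UNIV. 4 * a j * b j) = (4 * a k * b k) * (\<Prod>j\<in>UNIV - {k}. 4 * a j * b j)"
    by (rule prod.remove) auto
  also have "(\<Prod>j\<in>UNIV - {k}. 4 * a j * b j) = (\<Prod>j\<in>UNIV - {k}. 8 * t)"
    using t by (intro prod.cong) (auto simp: a_def b_def)
  also have "\<dots> = (8 * t) ^ (n - 1)" by (simp add: n_def card_Diff_singleton)
  also have "4 * a k * b k * (8 * t) ^ (n - 1) \<le> (8 * t) * (8 * t) ^ (n - 1)"
    using t by (intro mult_right_mono) (auto simp: a_def b_def)
  also have "\<dots> = 8 ^ n * t ^ n" using n by (cases n) (simp_all add: power_mult_distrib)
  finally have "emeasure lborel Q \<le> ennreal (8 ^ n * t ^ n)" unfolding Q by (rule ennreal_leI)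
  with BQ show ?thesis by (auto simp: B_def n_def)
qed

section \<open>Pointwise growth in terms of the integral over the sphere\<close>

lemma distr_eqI_nn_integral:
  assumes sets: "sets \<mu> = sets borel" and [measurable]: "T \<in> borel_measurable borel"
    and inv: "\<And>h. h \<in> borel_measurable borel \<Longrightarrow> (\<integral>\<^sup>+x. h (T x) \<partial>\<mu>) = (\<integral>\<^sup>+x. h x \<partial>\<mu>)"
  shows "distr \<mu> borel T = \<mu>"
proof (rule measure_eqI)
  show "sets (distr \<mu> borel T) = sets \<mu>" by (simp add: sets)
  fix A assume "A \<in> sets (distr \<mu> borel T)"
  then have A: "A \<in> sets borel" by simp
  have T: "T \<in> measurable \<mu> borel" by (simp add: measurable_cong_sets[OF sets refl])
  have "emeasure (distr \<mu> borel T) A = (\<integral>\<^sup>+x. indicator A x \<partial>(distr \<mu> borel T))"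
    using A by simp
  also have "\<dots> = (\<integral>\<^sup>+x. indicator A (T x) \<partial>\<mu>)"
    using A by (intro nn_integral_distr T) simp
  also have "\<dots> = (\<integral>\<^sup>+x. indicator A x \<partial>\<mu>)" using A by (intro inv) simp
  also have "\<dots> = emeasure \<mu> A" using A by (simp add: sets)
  finally show "emeasure (distr \<mu> borel T) A = emeasure \<mu> A" .
qed

lemma borel_measurable_cvec_smult [measurable]:
  "(\<lambda>x :: complex ^ 'n. c *s x) \<in> borel_measurable borel"
  by (intro borel_measurable_continuous_onI continuous_intros)

lemma surf_circular:
  assumes "cmod c = 1" shows "distr surf borel ((*s) c :: complex ^ 'n \<Rightarrow> _) = surf"
  by (rule distr_eqI_nn_integral)
    (auto intro!: nn_integral_surf_isometry linear_cvec_smult simp: norm_cvec_smult assms)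

lemma surf_mean_mono:
  fixes G :: "complex ^ 'n \<Rightarrow> complex"
  assumes G: "holomorphic_cn G (ball 0 R)" and R: "R > 1" and q: "q > 0" and r: "0 \<le> r" "r \<le> 1"
  shows "(\<integral>\<^sup>+\<xi>. indicator (cball 0 1) (r *\<^sub>R \<xi>) * ennreal (cmod (G (r *\<^sub>R \<xi>)) powr q) \<partial>surf)
    \<le> (\<integral>\<^sup>+\<xi>. indicator (cball 0 1) \<xi> * ennreal (cmod (G \<xi>) powr q) \<partial>surf)"
proof -
  have rs: "r *\<^sub>R \<xi> = of_real r *s \<xi>" for \<xi> :: "complex ^ 'n"
    by (simp add: vec_eq_iff scaleR_conv_of_real[where 'a=complex])
  have "AE e in (surf :: (complex ^ 'n) measure). norm e \<le> 1 \<and> (\<forall>w. cmod w \<le> 1 \<longrightarrow> 0 + w *s e \<in> cball 0 1)"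
    using AE_surf by eventually_elim (simp add: norm_cvec_smult)
  from circular_mean_mono[OF sets_surf finite_measure_surf surf_circular this G R q, of "of_real r"] r
  show ?thesis by (simp add: rs)
qed

text \<open>The mean over the circular neighbourhood \<open>E\<close> is a mean over a thin shell, whose spherical
  averages increase with the radius.\<close>

lemma hardy_pointwise_bound:
  obtains K :: real where "K > 0"
    "\<And>(G :: complex ^ 'n \<Rightarrow> complex) R q z. holomorphic_cn G (ball 0 R) \<Longrightarrow> R > 1 \<Longrightarrow> q > 0 \<Longrightarrow> norm z < 1 \<Longrightarrow>
      ennreal (K * (1 - (norm z)\<^sup>2) ^ CARD('n) * cmod (G z) powr q)
      \<le> (\<integral>\<^sup>+\<zeta>. indicator (cball 0 1) \<zeta> * ennreal (cmod (G \<zeta>) powr q) \<partial>surf)"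
proof -
  define n where "n = CARD('n)"
  have n: "n > 0" by (simp add: n_def)
  define c :: real where "c = 4 / (8 * n) ^ 2 * (1 / (2 * n)) ^ (n - 1)"
  have c: "c > 0" using n by (simp add: c_def)
  show ?thesis
  proof (rule that[of "c / (4 * n)"])
    show "c / (4 * n) > 0" using c n by simp
    fix G :: "complex ^ 'n \<Rightarrow> complex" and R q :: real and z :: "complex ^ 'n"
    assume G: "holomorphic_cn G (ball 0 R)" and R: "R > 1" and q: "q > 0" and z: "norm z < 1"
    define \<delta> where "\<delta> = 1 - (norm z)\<^sup>2"
    have \<delta>: "0 < \<delta>" "\<delta> \<le> 1" using z by (auto simp: \<delta>_def power_less_one_iff abs_square_less_1)
    define v where "v = (\<lambda>x. indicator (cball 0 1) x * ennreal (cmod (G x) powr q))"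
    have v [measurable]: "v \<in> borel_measurable borel"
      unfolding v_def by (rule borel_measurable_holomorphic_modulus[OF G _ _ q]) (use R in auto)
    define I where "I = (\<integral>\<^sup>+\<zeta>. v \<zeta> \<partial>surf)"
    \<comment> \<open>In the expansion of \<open>(norm (z + w *s e))\<^sup>2\<close> about
      \<open>(norm z)\<^sup>2 = 1 - \<delta>\<close> the linear term is then below
      \<open>\<delta> / 2\<close> in modulus and the quadratic one below
      \<open>\<delta> / 4\<close>, so all these discs stay inside the ball and close to the
      sphere.\<close>
    define E where "E = {e. cmod (herm e z) < \<delta> / 4 \<and> (norm e)\<^sup>2 < \<delta> / 4}"
    have [measurable]: "E \<in> sets borel" unfolding E_def by measurable
    have Ec: "c *s e \<in> E \<longleftrightarrow> e \<in> E" if "cmod c = 1" for c e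
      using that by (simp add: E_def herm_simps norm_mult norm_cvec_smult)
    define \<mu> where "\<mu> = density lborel (indicator E)"
    have nnE: "(\<integral>\<^sup>+e. h e \<partial>\<mu>) = (\<integral>\<^sup>+e. indicator E e * h e \<partial>lborel)" if "h \<in> borel_measurable borel" for h
      unfolding \<mu>_def using that by (intro nn_integral_density) auto
    have Elow: "ennreal (c * \<delta> ^ (n + 1)) \<le> emeasure lborel E"
      using emeasure_koranyi_neighbourhood_ge[of z \<delta>] z \<delta> by (simp add: c_def n_def E_def)
    have Eball: "norm e < 1" if "e \<in> E" for e
    proof -
      have "(norm e)\<^sup>2 < 1\<^sup>2" using that \<delta> by (simp add: E_def)
      then show ?thesis by (rule power2_less_imp_less) simp
    qed
    have Efin: "emeasure lborel E < \<infinity>"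
    proof -
      have "emeasure lborel E \<le> emeasure lborel (ball (0 :: complex ^ 'n) 1)"
        using Eball by (intro emeasure_mono) auto
      also have "\<dots> < \<infinity>" by (simp add: emeasure_ball)
      finally show ?thesis .
    qed
    have shell: "1 - 2 * \<delta> < (norm (z + w *s e))\<^sup>2" "norm (z + w *s e) < 1" if e: "e \<in> E" and w: "cmod w \<le> 1" for w e
    proof -
      have "complex_of_real ((norm (z + w *s e))\<^sup>2)
          = of_real ((norm z)\<^sup>2) + (w * herm e z + cnj (w * herm e z)) + of_real ((norm (w *s e))\<^sup>2)"
        unfolding herm_self[symmetric] herm_simps by (simp add: cnj_herm algebra_simps)
      also have "\<dots> = of_real ((norm z)\<^sup>2 + 2 * Re (w * herm e z) + (norm (w *s e))\<^sup>2)"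
        by (simp only: complex_add_cnj of_real_add)
      finally have eq: "(norm (z + w *s e))\<^sup>2 = (norm z)\<^sup>2 + 2 * Re (w * herm e z) + (norm (w *s e))\<^sup>2"
        using of_real_eq_iff by blast
      have "cmod (w * herm e z) \<le> 1 * cmod (herm e z)"
        unfolding norm_mult using w by (intro mult_right_mono) auto
      then have "\<bar>Re (w * herm e z)\<bar> < \<delta> / 4"
        using e abs_Re_le_cmod[of "w * herm e z"] by (simp add: E_def)
      moreover have "(norm (w *s e))\<^sup>2 \<le> (norm e)\<^sup>2"
        unfolding norm_cvec_smult using w by (intro power_mono mult_left_le_one_le) auto
      moreover have "(norm e)\<^sup>2 < \<delta> / 4" using e by (simp add: E_def)
      moreover have "0 \<le> (norm (w *s e))\<^sup>2" by simp
      ultimately have "1 - 2 * \<delta> < (norm (z + w *s e))\<^sup>2 \<and> (norm (z + w *s e))\<^sup>2 < 1"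
        using eq \<delta> \<delta>_def by linarith
      then show "1 - 2 * \<delta> < (norm (z + w *s e))\<^sup>2" "norm (z + w *s e) < 1"
        by (auto intro: power2_less_imp_less)
    qed
    have ae: "AE e in \<mu>. norm e \<le> 1 \<and> (\<forall>w. cmod w \<le> 1 \<longrightarrow> z + w *s e \<in> cball 0 1)"
      unfolding \<mu>_def by (subst AE_density) (use shell(2) Eball in \<open>auto simp: indicator_def less_imp_le\<close>)
    have "v z * emeasure lborel E = (\<integral>\<^sup>+e. v (z + 0 *s e) \<partial>\<mu>)"
      using nnE[of "\<lambda>_. v z"] nn_integral_cmult_indicator[of E lborel "v z"]
      by (simp add: mult.commute)
    also have "\<dots> \<le> (\<integral>\<^sup>+e. v (z + e) \<partial>\<mu>)"
      unfolding v_def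
    proof (rule circular_mean_mono[OF _ _ _ ae G R q])
      show "sets \<mu> = sets borel" by (simp add: \<mu>_def)
      show "finite_measure \<mu>"
        using Efin by (intro finite_measureI) (simp add: \<mu>_def emeasure_density space_density)
      fix a :: complex assume a: "cmod a = 1"
      show "distr \<mu> borel ((*s) a) = \<mu>"
      proof (rule distr_eqI_nn_integral)
        fix h :: "complex ^ 'n \<Rightarrow> ennreal" assume h [measurable]: "h \<in> borel_measurable borel"
        have "(\<integral>\<^sup>+x. h (a *s x) \<partial>\<mu>) = (\<integral>\<^sup>+x. indicator E (a *s x) * h (a *s x) \<partial>lborel)"
          by (subst nnE) (simp_all add: indicator_def Ec[OF a])
        also have "\<dots> = (\<integral>\<^sup>+x. indicator E x * h x \<partial>lborel)"
          by (rule nn_integral_lborel_isometry) (simp_all add: linear_cvec_smult norm_cvec_smult a)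
        also have "\<dots> = (\<integral>\<^sup>+x. h x \<partial>\<mu>)" by (simp add: nnE)
        finally show "(\<integral>\<^sup>+x. h (a *s x) \<partial>\<mu>) = (\<integral>\<^sup>+x. h x \<partial>\<mu>)" .
      qed (auto simp: \<mu>_def)
    qed simp
    also have "\<dots> = (\<integral>\<^sup>+e. indicator E e * v (z + e) \<partial>lborel)" by (rule nnE) simp
    also have "\<dots> \<le> (\<integral>\<^sup>+e. indicator (ball 0 1) (z + e) * (indicator {1 - 2 * \<delta><..} ((norm (z + e))\<^sup>2) * v (z + e)) \<partial>lborel)"
      by (intro nn_integral_mono) (use shell[of _ 1] in \<open>auto simp: indicator_def\<close>)
    also have "\<dots> = (\<integral>\<^sup>+y. indicator (ball 0 1) y * (indicator {1 - 2 * \<delta><..} ((norm y)\<^sup>2) * v y) \<partial>lborel)"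
      by (rule nn_integral_lborel_translate) simp
    also have "\<dots> = (\<integral>\<^sup>+r. indicator {0<..<1} r * ennreal ((2 * n) * r ^ (2 * n - 1))
        * (\<integral>\<^sup>+\<xi>. indicator {1 - 2 * \<delta><..} ((norm (r *\<^sub>R \<xi>))\<^sup>2) * v (r *\<^sub>R \<xi>) \<partial>surf) \<partial>lborel)"
      by (subst nn_integral_polar) (simp_all add: n_def mult.commute[of _ 2])
    \<comment> \<open>Each sphere of the shell contributes at most \<open>I\<close>, and
      \<open>r\<^sup>2 < r\<close> turns the bound on the squared norm into an interval of radii of
      length \<open>2 * \<delta>\<close>.\<close>
    also have "\<dots> \<le> (\<integral>\<^sup>+r. indicator {1 - 2 * \<delta>..1} r * (ennreal (2 * n) * I) \<partial>lborel)"
    proof (rule nn_integral_mono)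
      fix r :: real
      show "indicator {0<..<1} r * ennreal ((2 * n) * r ^ (2 * n - 1))
        * (\<integral>\<^sup>+\<xi>. indicator {1 - 2 * \<delta><..} ((norm (r *\<^sub>R \<xi>))\<^sup>2) * v (r *\<^sub>R \<xi>) \<partial>surf)
        \<le> indicator {1 - 2 * \<delta>..1} r * (ennreal (2 * n) * I)"
      proof (cases "0 < r \<and> r < 1")
        case r: True
        have 1: "(\<integral>\<^sup>+\<xi>. indicator {1 - 2 * \<delta><..} ((norm (r *\<^sub>R \<xi>))\<^sup>2) * v (r *\<^sub>R \<xi>) \<partial>surf)
          \<le> (\<integral>\<^sup>+\<xi>. indicator {1 - 2 * \<delta>..1} r * v (r *\<^sub>R \<xi>) \<partial>surf)"
        proof (rule nn_integral_mono_AE, use AE_surf in eventually_elim)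
          fix \<xi> :: "complex ^ 'n" assume "norm \<xi> = 1"
          moreover have "r\<^sup>2 < r" using r by (simp add: power2_eq_square)
          ultimately show "indicator {1 - 2 * \<delta><..} ((norm (r *\<^sub>R \<xi>))\<^sup>2) * v (r *\<^sub>R \<xi>)
              \<le> indicator {1 - 2 * \<delta>..1} r * v (r *\<^sub>R \<xi>)"
            using r by (auto simp: indicator_def)
        qed
        have 2: "(\<integral>\<^sup>+\<xi>. v (r *\<^sub>R \<xi>) \<partial>surf) \<le> I"
          unfolding I_def v_def by (rule surf_mean_mono[OF G R q]) (use r in auto)
        have "ennreal ((2 * n) * r ^ (2 * n - 1)) \<le> ennreal (2 * n)"
          using r by (intro ennreal_leI mult_left_le power_le_one) auto
        then have "ennreal ((2 * n) * r ^ (2 * n - 1)) * (\<integral>\<^sup>+\<xi>. indicator {1 - 2 * \<delta><..} ((norm (r *\<^sub>R \<xi>))\<^sup>2) * v (r *\<^sub>R \<xi>) \<partial>surf)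
          \<le> ennreal (2 * n) * (indicator {1 - 2 * \<delta>..1} r * (\<integral>\<^sup>+\<xi>. v (r *\<^sub>R \<xi>) \<partial>surf))"
          using 1 by (intro mult_mono) (simp_all add: nn_integral_cmult)
        also have "\<dots> \<le> ennreal (2 * n) * (indicator {1 - 2 * \<delta>..1} r * I)"
          by (intro mult_left_mono 2) simp_all
        finally show ?thesis using r by (simp add: mult_ac)
      qed auto
    qed
    also have "\<dots> = emeasure lborel {1 - 2 * \<delta>..1} * (ennreal (2 * n) * I)"
      by (subst nn_integral_multc) simp_all
    also have "\<dots> = ennreal (4 * n * \<delta>) * I"
    proof -
      have "emeasure lborel {1 - 2 * \<delta>..1} = ennreal (2 * \<delta>)" using \<delta> by simp
      moreover have "ennreal (2 * \<delta>) * ennreal (2 * n) = ennreal (4 * n * \<delta>)"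
        using \<delta> by (subst ennreal_mult[symmetric]) (auto simp: mult_ac)
      ultimately show ?thesis by (simp add: mult.assoc[symmetric])
    qed
    \<comment> \<open>The volume of \<open>E\<close> is at least of order
      \<open>\<delta> ^ (n + 1)\<close>, the shell has thickness of order \<delta>; their quotient
      is the factor \<open>\<delta> ^ n\<close> of the claim.\<close>
    finally have main: "v z * emeasure lborel E \<le> ennreal (4 * n * \<delta>) * I" .
    have vz: "v z = ennreal (cmod (G z) powr q)" using z by (simp add: v_def)
    have "ennreal (c / (4 * n) * \<delta> ^ n * cmod (G z) powr q)
        = ennreal (1 / (4 * n * \<delta>)) * (v z * ennreal (c * \<delta> ^ (n + 1)))"
      unfolding vz using \<delta> c n by (simp flip: ennreal_mult add: field_simps)
    also have "\<dots> \<le> ennreal (1 / (4 * n * \<delta>)) * (ennreal (4 * n * \<delta>) * I)"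
      by (intro mult_left_mono order_trans[OF mult_left_mono[OF Elow] main]) simp_all
    also have "\<dots> = ennreal (1 / (4 * n * \<delta>) * (4 * n * \<delta>)) * I"
      using \<delta> by (subst ennreal_mult) (auto simp: mult.assoc)
    also have "\<dots> = I" using \<delta> n by simp
    finally show "ennreal (c / (4 * n) * (1 - (norm z)\<^sup>2) ^ CARD('n) * cmod (G z) powr q)
      \<le> (\<integral>\<^sup>+\<zeta>. indicator (cball 0 1) \<zeta> * ennreal (cmod (G \<zeta>) powr q) \<partial>surf)"
      by (simp add: I_def v_def \<delta>_def n_def)
  qed
qed

subsection \<open>The nonisotropic maximal function\<close>

text \<open>Greedy selection: keep an index with the largest \<open>t\<close>, discard every set
  that meets its set, and continue with the rest. Here \<open>t\<close> is an abstract size; the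
  geometry enters only when the selected sets are enlarged.\<close>

lemma finite_vitali_cover:
  fixes t :: "'i \<Rightarrow> real"
  assumes "finite F" and "\<And>i. i \<in> F \<Longrightarrow> A i \<noteq> {}"
  shows "\<exists>J\<subseteq>F. disjoint_family_on A J \<and> (\<forall>i\<in>F. \<exists>j\<in>J. t i \<le> t j \<and> A i \<inter> A j \<noteq> {})"
  using assms
proof (induction "card F" arbitrary: F rule: less_induct)
  case less
  show ?case
  proof (cases "F = {}")
    case False
    have "finite (t ` F)" "t ` F \<noteq> {}" using less False by auto
    then obtain m where m: "m \<in> F" "t m = Max (t ` F)" using Max_in by (metis imageE)
    have tm: "t i \<le> t m" if "i \<in> F" for i using that less m by simp
    define F' where "F' = {i\<in>F. A i \<inter> A m = {}}"
    have "F' \<subset> F" using m less.prems(2) by (auto simp: F'_def)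
    then have "card F' < card F" using less.prems(1) by (rule psubset_card_mono[rotated])
    then obtain J where J: "J \<subseteq> F'" "disjoint_family_on A J"
      "\<And>i. i \<in> F' \<Longrightarrow> \<exists>j\<in>J. t i \<le> t j \<and> A i \<inter> A j \<noteq> {}"
      using less.hyps[of F'] less.prems \<open>F' \<subset> F\<close> by (metis (no_types, lifting) finite_subset psubset_imp_subset subset_iff)
    show ?thesis
    proof (intro exI[of _ "insert m J"] conjI ballI)
      show "insert m J \<subseteq> F" using J(1) m \<open>F' \<subset> F\<close> by auto
      show "disjoint_family_on A (insert m J)"
        using J(1,2) unfolding disjoint_family_on_def F'_def by blast
      fix i assume i: "i \<in> F"
      show "\<exists>j\<in>insert m J. t i \<le> t j \<and> A i \<inter> A j \<noteq> {}"
        using J(3)[of i] tm[OF i] i by (cases "i \<in> F'") (auto simp: F'_def)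
    qed
  qed (use less.prems in \<open>auto simp: disjoint_family_on_def\<close>)
qed

text \<open>The radii are rational so that measurability is automatic; the averages are normalised by
  \<open>t ^ n\<close>, the order of magnitude of the measure of the balls.\<close>

definition koranyi_maximal :: "(complex ^ 'n \<Rightarrow> ennreal) \<Rightarrow> complex ^ 'n \<Rightarrow> ennreal" where
  "koranyi_maximal v \<xi> = (SUP t\<in>{t\<in>\<rat>. 0 < t}. ennreal (1 / t ^ CARD('n)) *
     (\<integral>\<^sup>+\<zeta>. indicator {..<t} (cmod (1 - herm \<zeta> \<xi>)) * v \<zeta> \<partial>surf))"

interpretation surf: finite_measure "surf :: 'a::euclidean_space measure"
  by (rule finite_measure_surf)

lemma borel_measurable_koranyi_maximal [measurable]:
  fixes v :: "complex ^ 'n \<Rightarrow> ennreal"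
  assumes [measurable]: "v \<in> borel_measurable borel"
  shows "koranyi_maximal v \<in> borel_measurable borel"
proof -
  have "countable {t::real. t \<in> \<rat> \<and> 0 < t}" by (rule countable_subset[OF _ countable_rat]) auto
  then show ?thesis
    unfolding koranyi_maximal_def by (intro borel_measurable_SUP) measurable
qed

text \<open>A rational radius between \<open>t\<close> and \<open>2 * t\<close> brings an arbitrary
  real radius under the supremum, at the price of the factor \<open>2 ^ n\<close>.\<close>

lemma koranyi_average_le:
  fixes v :: "complex ^ 'n \<Rightarrow> ennreal"
  assumes [measurable]: "v \<in> borel_measurable borel" and t: "0 < t"
  shows "(\<integral>\<^sup>+\<zeta>. indicator {..<t} (cmod (1 - herm \<zeta> \<xi>)) * v \<zeta> \<partial>surf)
    \<le> ennreal ((2 * t) ^ CARD('n)) * koranyi_maximal v \<xi>"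
proof -
  obtain s where s: "s \<in> \<rat>" "t < s" "s < 2 * t" using Rats_dense_in_real[of t "2 * t"] t by auto
  define J where "J = (\<integral>\<^sup>+\<zeta>. indicator {..<s} (cmod (1 - herm \<zeta> \<xi>)) * v \<zeta> \<partial>surf)"
  have "ennreal (1 / s ^ CARD('n)) * J \<le> koranyi_maximal v \<xi>"
    unfolding koranyi_maximal_def J_def by (rule SUP_upper) (use s t in auto)
  then have "ennreal (s ^ CARD('n)) * (ennreal (1 / s ^ CARD('n)) * J) \<le> ennreal (s ^ CARD('n)) * koranyi_maximal v \<xi>"
    by (rule mult_left_mono) simp
  moreover have "ennreal (s ^ CARD('n)) * (ennreal (1 / s ^ CARD('n)) * J) = J"
  proof -
    have "ennreal (s ^ CARD('n)) * ennreal (1 / s ^ CARD('n)) = 1"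
      using s t by (subst ennreal_mult[symmetric]) auto
    then show ?thesis by (simp add: mult.assoc[symmetric])
  qed
  moreover have "ennreal (s ^ CARD('n)) * koranyi_maximal v \<xi> \<le> ennreal ((2 * t) ^ CARD('n)) * koranyi_maximal v \<xi>"
    using s t by (intro mult_right_mono ennreal_leI power_mono) auto
  moreover have "(\<integral>\<^sup>+\<zeta>. indicator {..<t} (cmod (1 - herm \<zeta> \<xi>)) * v \<zeta> \<partial>surf) \<le> J"
    unfolding J_def using s by (intro nn_integral_mono) (auto simp: indicator_def)
  ultimately show ?thesis by auto
qed

text \<open>Inner regularity reduces the superlevel set to its compact subsets, which have finite
  covers by balls with large averages. A disjoint selection of these sums to at most the integral of
  \<open>v\<close>, while its 36-fold enlargements still cover. The factor \<open>8 ^ n\<close>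
  comes from the measure of a ball.\<close>

lemma koranyi_maximal_weak_type:
  fixes v :: "complex ^ 'n \<Rightarrow> ennreal"
  assumes [measurable]: "v \<in> borel_measurable borel" and l: "l > 0"
  shows "ennreal l * emeasure surf {\<xi>. norm \<xi> = 1 \<and> ennreal l < koranyi_maximal v \<xi>}
    \<le> ennreal (8 ^ CARD('n) * 36 ^ CARD('n)) * (\<integral>\<^sup>+\<zeta>. v \<zeta> \<partial>surf)"
proof -
  define n where "n = CARD('n)"
  define W where "W = {\<xi>. norm \<xi> = 1 \<and> ennreal l < koranyi_maximal v \<xi>}"
  have [measurable]: "W \<in> sets borel" unfolding W_def by measurable
  define B where "B = (\<lambda>\<xi> t. {\<zeta> :: complex ^ 'n. cmod (1 - herm \<zeta> \<xi>) < t})"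
  have [measurable]: "B \<xi> t \<in> sets borel" for \<xi> t unfolding B_def by measurable
  have compact_bound: "ennreal l * emeasure surf K \<le> ennreal (8 ^ n * 36 ^ n) * (\<integral>\<^sup>+\<zeta>. v \<zeta> \<partial>surf)"
    if K: "compact K" "K \<subseteq> W" for K
  proof -
    have "\<exists>t. 0 < t \<and> ennreal (l * t ^ n) \<le> (\<integral>\<^sup>+\<zeta>. indicator (B \<xi> t) \<zeta> * v \<zeta> \<partial>surf)" if "\<xi> \<in> K" for \<xi>
    proof -
      have "ennreal l < koranyi_maximal v \<xi>" using that K by (auto simp: W_def)
      then obtain t where t: "0 < t" and less: "ennreal l < ennreal (1 / t ^ n) *
          (\<integral>\<^sup>+\<zeta>. indicator {..<t} (cmod (1 - herm \<zeta> \<xi>)) * v \<zeta> \<partial>surf)"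
        unfolding koranyi_maximal_def n_def by (auto simp: less_SUP_iff)
      have "ennreal (l * t ^ n) = ennreal (t ^ n) * ennreal l"
        using l t by (subst ennreal_mult[symmetric]) (auto simp: mult.commute)
      also have "\<dots> \<le> ennreal (t ^ n) * (ennreal (1 / t ^ n) *
          (\<integral>\<^sup>+\<zeta>. indicator {..<t} (cmod (1 - herm \<zeta> \<xi>)) * v \<zeta> \<partial>surf))"
        using less by (intro mult_left_mono) auto
      also have "\<dots> = (ennreal (t ^ n) * ennreal (1 / t ^ n)) *
          (\<integral>\<^sup>+\<zeta>. indicator {..<t} (cmod (1 - herm \<zeta> \<xi>)) * v \<zeta> \<partial>surf)"
        by (simp only: mult.assoc)
      also have "ennreal (t ^ n) * ennreal (1 / t ^ n) = 1"
        using t by (subst ennreal_mult[symmetric]) auto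
      finally show ?thesis using t by (intro exI[of _ t]) (simp add: indicator_def B_def)
    qed
    then obtain t where t: "\<And>\<xi>. \<xi> \<in> K \<Longrightarrow> 0 < t \<xi>"
      and avg: "\<And>\<xi>. \<xi> \<in> K \<Longrightarrow> ennreal (l * t \<xi> ^ n) \<le> (\<integral>\<^sup>+\<zeta>. indicator (B \<xi> (t \<xi>)) \<zeta> * v \<zeta> \<partial>surf)"
      by metis
    have normK: "norm \<xi> = 1" if "\<xi> \<in> K" for \<xi> using that K by (auto simp: W_def)
    have self: "\<xi> \<in> B \<xi> (t \<xi>)" if "\<xi> \<in> K" for \<xi>
      using t[OF that] normK[OF that] by (simp add: B_def herm_self)
    have opB: "open (B \<xi> r)" for \<xi> r
      unfolding B_def by (intro open_Collect_less continuous_intros)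
    have "K \<subseteq> (\<Union>\<xi>\<in>K. B \<xi> (t \<xi>))" using self by blast
    then obtain F where F: "F \<subseteq> K" "finite F" "K \<subseteq> (\<Union>\<xi>\<in>F. B \<xi> (t \<xi>))"
      using compactE_image[OF K(1), of K "\<lambda>\<xi>. B \<xi> (t \<xi>)", OF opB] by metis
    define A where "A = (\<lambda>\<xi>. B \<xi> (t \<xi>) \<inter> sphere 0 1)"
    have [measurable]: "A \<xi> \<in> sets borel" for \<xi> unfolding A_def by measurable
    obtain J where J: "J \<subseteq> F" "disjoint_family_on A J"
      and cov: "\<And>i. i \<in> F \<Longrightarrow> \<exists>j\<in>J. t i \<le> t j \<and> A i \<inter> A j \<noteq> {}"
    proof -
      have Ane: "A i \<noteq> {}" if "i \<in> F" for i
      proof -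
        have "i \<in> K" using F that by blast
        then have "i \<in> A i" using self normK by (simp add: A_def)
        then show ?thesis by blast
      qed
      from finite_vitali_cover[OF F(2), of A t, OF Ane] show ?thesis using that by blast
    qed
    have finJ: "finite J" using J F finite_subset by blast
    have "K \<subseteq> (\<Union>j\<in>J. B j (36 * t j))"
    proof
      fix \<zeta> assume \<zeta>: "\<zeta> \<in> K"
      then obtain i where i: "i \<in> F" "\<zeta> \<in> B i (t i)" using F by blast
      obtain j y where j: "j \<in> J" "t i \<le> t j" and y: "y \<in> A i" "y \<in> A j" using cov[OF i(1)] by blast
      have nrm: "norm i = 1" "norm j = 1" "norm y = 1" "norm \<zeta> = 1"
        using i j J F \<zeta> y normK by (auto simp: A_def)
      have "cmod (1 - herm i j) \<le> 4 * (cmod (1 - herm i y) + cmod (1 - herm y j))"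
        by (rule quasi_triangle) (simp_all add: nrm)
      also have "\<dots> < 4 * (t j + t j)"
        using y j by (auto simp: A_def B_def one_minus_herm_commute[of i y])
      finally have "cmod (1 - herm i j) < 8 * t j" by simp
      moreover have "cmod (1 - herm \<zeta> j) \<le> 4 * (cmod (1 - herm \<zeta> i) + cmod (1 - herm i j))"
        by (rule quasi_triangle) (simp_all add: nrm)
      \<comment> \<open>The constant is \<open>4 * (1 + 8)\<close>: one quasi-triangle step between
        the centres gives 8, a second one from \<zeta> gives 36.\<close>
      ultimately have "cmod (1 - herm \<zeta> j) < 36 * t j" using i j by (auto simp: B_def)
      then show "\<zeta> \<in> (\<Union>j\<in>J. B j (36 * t j))" using j by (auto simp: B_def)
    qed
    then have "emeasure surf K \<le> emeasure surf (\<Union>j\<in>J. B j (36 * t j))"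
      using finJ by (intro emeasure_mono) auto
    also have "\<dots> \<le> (\<Sum>j\<in>J. emeasure surf (B j (36 * t j)))"
      using finJ by (intro emeasure_subadditive_finite) auto
    also have "\<dots> \<le> (\<Sum>j\<in>J. ennreal (8 ^ n * (36 * t j) ^ n))"
      unfolding B_def n_def using J F normK t
      by (intro sum_mono emeasure_surf_koranyi_ball_le) auto
    finally have "ennreal l * emeasure surf K \<le> ennreal l * (\<Sum>j\<in>J. ennreal (8 ^ n * (36 * t j) ^ n))"
      by (rule mult_left_mono) simp
    also have "\<dots> = (\<Sum>j\<in>J. ennreal (8 ^ n * 36 ^ n) * ennreal (l * t j ^ n))"
      unfolding sum_distrib_left
    proof (rule sum.cong[OF refl])
      fix j assume "j \<in> J"
      then have "0 < t j" using J F t by auto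
      then show "ennreal l * ennreal (8 ^ n * (36 * t j) ^ n) = ennreal (8 ^ n * 36 ^ n) * ennreal (l * t j ^ n)"
        using l by (simp flip: ennreal_mult add: power_mult_distrib mult_ac)
    qed
    also have "\<dots> \<le> (\<Sum>j\<in>J. ennreal (8 ^ n * 36 ^ n) * (\<integral>\<^sup>+\<zeta>. indicator (A j) \<zeta> * v \<zeta> \<partial>surf))"
    proof (intro sum_mono mult_left_mono)
      fix j assume "j \<in> J"
      then have "ennreal (l * t j ^ n) \<le> (\<integral>\<^sup>+\<zeta>. indicator (B j (t j)) \<zeta> * v \<zeta> \<partial>surf)"
        using J F avg by blast
      also have "\<dots> = (\<integral>\<^sup>+\<zeta>. indicator (A j) \<zeta> * v \<zeta> \<partial>surf)"
        by (rule nn_integral_cong_AE, use AE_surf in eventually_elim) (auto simp: A_def indicator_def)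
      finally show "ennreal (l * t j ^ n) \<le> (\<integral>\<^sup>+\<zeta>. indicator (A j) \<zeta> * v \<zeta> \<partial>surf)" .
    qed simp
    also have "\<dots> = ennreal (8 ^ n * 36 ^ n) * (\<integral>\<^sup>+\<zeta>. (\<Sum>j\<in>J. indicator (A j) \<zeta>) * v \<zeta> \<partial>surf)"
      by (simp add: sum_distrib_right sum_distrib_left[symmetric] nn_integral_sum)
    also have "\<dots> = ennreal (8 ^ n * 36 ^ n) * (\<integral>\<^sup>+\<zeta>. indicator (\<Union>j\<in>J. A j) \<zeta> * v \<zeta> \<partial>surf)"
      by (simp add: indicator_UN_disjoint[OF finJ J(2)])
    also have "\<dots> \<le> ennreal (8 ^ n * 36 ^ n) * (\<integral>\<^sup>+\<zeta>. v \<zeta> \<partial>surf)"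
      by (intro mult_left_mono nn_integral_mono) (auto simp: indicator_def)
    finally show ?thesis .
  qed
  have "emeasure surf W = (SUP K\<in>{K. K \<subseteq> W \<and> compact K}. emeasure surf K)"
    by (rule inner_regular) (auto simp: surf.emeasure_eq_measure)
  then have "ennreal l * emeasure surf W = (SUP K\<in>{K. K \<subseteq> W \<and> compact K}. ennreal l * emeasure surf K)"
    by (simp add: SUP_mult_left_ennreal)
  also have "\<dots> \<le> ennreal (8 ^ n * 36 ^ n) * (\<integral>\<^sup>+\<zeta>. v \<zeta> \<partial>surf)"
    by (rule SUP_least) (use compact_bound in blast)
  finally show ?thesis by (simp add: W_def n_def)
qed

lemma nn_integral_layer_cake_square:
  fixes x :: ennreal
  shows "x ^ 2 \<le> (\<integral>\<^sup>+s. indicator {0<..} s * (indicator {..<x} (ennreal s) * ennreal (2 * s)) \<partial>lborel)"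
    (is "_ \<le> ?I")
proof -
  have le: "ennreal (b ^ 2) \<le> ?I" if b: "0 \<le> b" "ennreal b \<le> x" for b
  proof -
    have "(\<integral>\<^sup>+s. ennreal (2 * s) * indicator {0..b} s \<partial>lborel) = ennreal (b ^ 2 - 0 ^ 2)"
      by (rule nn_integral_FTC_Icc) (use b in \<open>auto intro!: derivative_eq_intros\<close>)
    then have "ennreal (b ^ 2) = (\<integral>\<^sup>+s. ennreal (2 * s) * indicator {0..b} s \<partial>lborel)" by simp
    also have "\<dots> \<le> ?I"
    proof (rule nn_integral_mono_AE, use AE_lborel_singleton[of 0] AE_lborel_singleton[of b] in eventually_elim)
      fix s :: real assume "s \<noteq> 0" "s \<noteq> b"
      then show "ennreal (2 * s) * indicator {0..b} s \<le> indicator {0<..} s * (indicator {..<x} (ennreal s) * ennreal (2 * s))"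
        using b less_le_trans[of "ennreal s" "ennreal b" x] by (auto simp: indicator_def ennreal_less_iff)
    qed
    finally show ?thesis .
  qed
  show ?thesis
  proof (cases x)
    case (real b)
    then show ?thesis using le[of b] by (simp add: ennreal_power)
  next
    case top
    \<comment> \<open>The bound for every finite \<open>b\<close> covers the infinite value too: a
      finite integral \<open>y\<close> would be at least \<open>(y + 1)^2\<close>.\<close>
    have "?I = top"
    proof (rule ccontr)
      assume "?I \<noteq> top"
      then obtain y where y: "?I = ennreal y" "0 \<le> y" by (cases ?I) auto
      have "ennreal ((y + 1) ^ 2) \<le> ennreal y" using le[of "y + 1"] y top by simp
      then have "(y + 1) ^ 2 \<le> y" using y by (simp add: ennreal_le_iff)
      moreover have "0 \<le> y * y" using y by simp
      ultimately show False using y by (simp add: power2_eq_square algebra_simps)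
    qed
    then show ?thesis by simp
  qed
qed

lemma nn_integral_level_le:
  fixes x :: ennreal
  assumes c: "c > 0"
  shows "(\<integral>\<^sup>+s. indicator {0<..} s * indicator {..<x} (ennreal (c * s)) \<partial>lborel) \<le> x * ennreal (1 / c)"
proof (cases x)
  case (real b)
  have "(\<integral>\<^sup>+s. indicator {0<..} s * indicator {..<x} (ennreal (c * s)) \<partial>lborel)
      \<le> (\<integral>\<^sup>+s. indicator {0..b / c} s \<partial>lborel)"
    using real c by (intro nn_integral_mono) (auto simp: indicator_def ennreal_less_iff field_simps)
  also have "\<dots> = x * ennreal (1 / c)"
    using real c by (simp flip: ennreal_mult)
  finally show ?thesis .
qed (use c in \<open>simp add: ennreal_top_mult\<close>)

text \<open>Marcinkiewicz interpolation between the weak type estimate and boundedness for the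
  supremum norm: at each level \<open>s\<close> cut \<open>v\<close> at the height
  \<open>c * s\<close>. The lower part has maximal function at most \<open>s / 2\<close>, so only
  the upper part \<open>v1\<close> needs the weak type estimate, at level
  \<open>s / 2\<close>.\<close>

lemma koranyi_maximal_L2:
  fixes v :: "complex ^ 'n \<Rightarrow> ennreal"
  assumes [measurable]: "v \<in> borel_measurable borel"
  shows "(\<integral>\<^sup>+\<xi>. koranyi_maximal v \<xi> ^ 2 \<partial>surf)
    \<le> ennreal (8 * 8 ^ CARD('n) * (8 ^ CARD('n) * 36 ^ CARD('n))) * (\<integral>\<^sup>+\<xi>. v \<xi> ^ 2 \<partial>surf)"
proof -
  define n where "n = CARD('n)"
  define A :: real where "A = 8 ^ n * 36 ^ n"
  \<comment> \<open>The maximal function of a constant is at most \<open>8 ^ n\<close> times it on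
    the sphere, so a remainder below \<open>c * s\<close> yields at most
    \<open>s / 2\<close>.\<close>
  define c :: real where "c = 1 / (2 * 8 ^ n)"
  have c: "c > 0" and A: "A > 0" by (auto simp: c_def A_def)
  let ?M = "koranyi_maximal v"
  have level: "ennreal (2 * s) * emeasure surf {\<xi>. ennreal s < ?M \<xi>}
      \<le> ennreal (4 * A) * (\<integral>\<^sup>+\<zeta>. indicator {..<v \<zeta>} (ennreal (c * s)) * v \<zeta> \<partial>surf)" if s: "s > 0" for s
  proof -
    define v1 where "v1 = (\<lambda>\<zeta>. indicator {..<v \<zeta>} (ennreal (c * s)) * v \<zeta>)"
    have [measurable]: "v1 \<in> borel_measurable borel"
    proof -
      have "v1 = (\<lambda>\<zeta>. (if ennreal (c * s) < v \<zeta> then 1 else 0) * v \<zeta>)" by (auto simp: v1_def indicator_def)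
      then show ?thesis by simp
    qed
    have v_le: "v \<zeta> \<le> v1 \<zeta> + ennreal (c * s)" for \<zeta>
      by (auto simp: v1_def indicator_def)
    have M_le: "?M \<xi> \<le> koranyi_maximal v1 \<xi> + ennreal (s / 2)" if \<xi>: "norm \<xi> = 1" for \<xi>
      unfolding koranyi_maximal_def[of v]
    proof (rule SUP_least)
      fix t :: real assume "t \<in> {t \<in> \<rat>. 0 < t}"
      then have t: "t \<in> \<rat>" "0 < t" by auto
      have [measurable]: "{\<zeta>. cmod (1 - herm \<zeta> \<xi>) < t} \<in> sets borel" by measurable
      have "(\<integral>\<^sup>+\<zeta>. indicator {..<t} (cmod (1 - herm \<zeta> \<xi>)) * v \<zeta> \<partial>surf)
        \<le> (\<integral>\<^sup>+\<zeta>. indicator {..<t} (cmod (1 - herm \<zeta> \<xi>)) * v1 \<zeta>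
            + ennreal (c * s) * indicator {\<zeta>. cmod (1 - herm \<zeta> \<xi>) < t} \<zeta> \<partial>surf)"
        by (intro nn_integral_mono) (use v_le in \<open>auto simp: indicator_def\<close>)
      also have "\<dots> = (\<integral>\<^sup>+\<zeta>. indicator {..<t} (cmod (1 - herm \<zeta> \<xi>)) * v1 \<zeta> \<partial>surf)
          + ennreal (c * s) * emeasure surf {\<zeta>. cmod (1 - herm \<zeta> \<xi>) < t}"
        by (subst nn_integral_add) (simp_all add: nn_integral_cmult_indicator)
      also have "\<dots> \<le> (\<integral>\<^sup>+\<zeta>. indicator {..<t} (cmod (1 - herm \<zeta> \<xi>)) * v1 \<zeta> \<partial>surf)
          + ennreal (c * s) * ennreal (8 ^ n * t ^ n)"
        unfolding n_def by (intro add_left_mono mult_left_mono emeasure_surf_koranyi_ball_le \<xi> t) simp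
      finally have "ennreal (1 / t ^ n) * (\<integral>\<^sup>+\<zeta>. indicator {..<t} (cmod (1 - herm \<zeta> \<xi>)) * v \<zeta> \<partial>surf)
        \<le> ennreal (1 / t ^ n) * ((\<integral>\<^sup>+\<zeta>. indicator {..<t} (cmod (1 - herm \<zeta> \<xi>)) * v1 \<zeta> \<partial>surf)
          + ennreal (c * s) * ennreal (8 ^ n * t ^ n))"
        by (rule mult_left_mono) simp
      also have "\<dots> = ennreal (1 / t ^ n) * (\<integral>\<^sup>+\<zeta>. indicator {..<t} (cmod (1 - herm \<zeta> \<xi>)) * v1 \<zeta> \<partial>surf)
          + ennreal (1 / t ^ n * (c * s * (8 ^ n * t ^ n)))"
      proof -
        have "ennreal (1 / t ^ n) * (ennreal (c * s) * ennreal (8 ^ n * t ^ n))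
            = ennreal (1 / t ^ n * (c * s * (8 ^ n * t ^ n)))"
          using c s t by (simp flip: ennreal_mult)
        then show ?thesis by (simp only: distrib_left)
      qed
      also have "1 / t ^ n * (c * s * (8 ^ n * t ^ n)) = s / 2"
        using t by (simp add: c_def)
      also have "ennreal (1 / t ^ n) * (\<integral>\<^sup>+\<zeta>. indicator {..<t} (cmod (1 - herm \<zeta> \<xi>)) * v1 \<zeta> \<partial>surf) \<le> koranyi_maximal v1 \<xi>"
        unfolding koranyi_maximal_def n_def by (rule SUP_upper) (use t in auto)
      finally show "ennreal (1 / t ^ CARD('n)) * (\<integral>\<^sup>+\<zeta>. indicator {..<t} (cmod (1 - herm \<zeta> \<xi>)) * v \<zeta> \<partial>surf)
        \<le> koranyi_maximal v1 \<xi> + ennreal (s / 2)" by (simp add: n_def add_right_mono)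
    qed
    have "emeasure surf {\<xi>. ennreal s < ?M \<xi>}
        \<le> emeasure surf {\<xi>. norm \<xi> = 1 \<and> ennreal (s / 2) < koranyi_maximal v1 \<xi>}"
    proof (rule emeasure_mono_AE)
      show "AE \<xi> in surf. \<xi> \<in> {\<xi>. ennreal s < ?M \<xi>}
          \<longrightarrow> \<xi> \<in> {\<xi>. norm \<xi> = 1 \<and> ennreal (s / 2) < koranyi_maximal v1 \<xi>}"
        using AE_surf
      proof eventually_elim
        fix \<xi> :: "complex ^ 'n" assume \<xi>: "norm \<xi> = 1"
        have "ennreal (s / 2) < koranyi_maximal v1 \<xi>" if "ennreal s < ?M \<xi>"
        proof (rule ccontr)
          assume "\<not> ennreal (s / 2) < koranyi_maximal v1 \<xi>"
          then have "?M \<xi> \<le> ennreal (s / 2) + ennreal (s / 2)"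
            using M_le[OF \<xi>] by (meson add_right_mono linorder_not_less order_trans)
          also have "\<dots> = ennreal s" using s by (simp flip: ennreal_plus)
          finally show False using that by simp
        qed
        then show "\<xi> \<in> {\<xi>. ennreal s < ?M \<xi>} \<longrightarrow> \<xi> \<in> {\<xi>. norm \<xi> = 1 \<and> ennreal (s / 2) < koranyi_maximal v1 \<xi>}"
          using \<xi> by simp
      qed
    qed measurable
    then have "ennreal (2 * s) * emeasure surf {\<xi>. ennreal s < ?M \<xi>}
        \<le> ennreal (2 * s) * emeasure surf {\<xi>. norm \<xi> = 1 \<and> ennreal (s / 2) < koranyi_maximal v1 \<xi>}"
      by (rule mult_left_mono) simp
    also have "\<dots> = ennreal 4 * ennreal (s / 2)
        * emeasure surf {\<xi>. norm \<xi> = 1 \<and> ennreal (s / 2) < koranyi_maximal v1 \<xi>}"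
      using s by (subst ennreal_mult[symmetric]) auto
    also have "ennreal 4 * ennreal (s / 2) * emeasure surf {\<xi>. norm \<xi> = 1 \<and> ennreal (s / 2) < koranyi_maximal v1 \<xi>}
        \<le> ennreal 4 * (ennreal A * (\<integral>\<^sup>+\<zeta>. v1 \<zeta> \<partial>surf))"
      unfolding mult.assoc A_def n_def
      by (intro mult_left_mono koranyi_maximal_weak_type) (use s in auto)
    also have "\<dots> = ennreal (4 * A) * (\<integral>\<^sup>+\<zeta>. v1 \<zeta> \<partial>surf)"
      using A by (simp add: ennreal_mult mult.assoc)
    finally show ?thesis by (simp add: v1_def)
  qed
  interpret P: pair_sigma_finite "surf :: (complex ^ 'n) measure" "lborel :: real measure" ..
  \<comment> \<open>In this form joint measurability is provable automatically, although the set in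
    the indicator varies with the integration variable.\<close>
  have ind: "indicator {..<x} y = (if y < x then 1 else 0 :: ennreal)" for x y :: ennreal
    by (simp add: indicator_def)
  have "(\<integral>\<^sup>+\<xi>. ?M \<xi> ^ 2 \<partial>surf)
      \<le> (\<integral>\<^sup>+\<xi>. (\<integral>\<^sup>+s. indicator {0<..} s * (indicator {..<?M \<xi>} (ennreal s) * ennreal (2 * s)) \<partial>lborel) \<partial>surf)"
    by (intro nn_integral_mono nn_integral_layer_cake_square)
  also have "\<dots> = (\<integral>\<^sup>+s. (\<integral>\<^sup>+\<xi>. indicator {0<..} s * (indicator {..<?M \<xi>} (ennreal s) * ennreal (2 * s)) \<partial>surf) \<partial>lborel)"
    unfolding ind by (rule P.Fubini'[symmetric]) measurable
  also have "\<dots> \<le> (\<integral>\<^sup>+s. (\<integral>\<^sup>+\<zeta>. ennreal (4 * A) * v \<zeta> * (indicator {0<..} s * indicator {..<v \<zeta>} (ennreal (c * s))) \<partial>surf) \<partial>lborel)"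
  proof (rule nn_integral_mono)
    fix s :: real
    show "(\<integral>\<^sup>+\<xi>. indicator {0<..} s * (indicator {..<?M \<xi>} (ennreal s) * ennreal (2 * s)) \<partial>surf)
      \<le> (\<integral>\<^sup>+\<zeta>. ennreal (4 * A) * v \<zeta> * (indicator {0<..} s * indicator {..<v \<zeta>} (ennreal (c * s))) \<partial>surf)"
    proof (cases "s > 0")
      case True
      have [measurable]: "{\<xi>. ennreal s < ?M \<xi>} \<in> sets borel" by measurable
      have "(\<integral>\<^sup>+\<xi>. indicator {0<..} s * (indicator {..<?M \<xi>} (ennreal s) * ennreal (2 * s)) \<partial>surf)
          = (\<integral>\<^sup>+\<xi>. ennreal (2 * s) * indicator {\<xi>. ennreal s < ?M \<xi>} \<xi> \<partial>surf)"
        using True by (intro nn_integral_cong) (simp add: indicator_def)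
      also have "\<dots> = ennreal (2 * s) * emeasure surf {\<xi>. ennreal s < ?M \<xi>}"
        by (simp add: nn_integral_cmult_indicator)
      also have "\<dots> \<le> ennreal (4 * A) * (\<integral>\<^sup>+\<zeta>. indicator {..<v \<zeta>} (ennreal (c * s)) * v \<zeta> \<partial>surf)"
        by (rule level[OF True])
      also have "\<dots> = (\<integral>\<^sup>+\<zeta>. ennreal (4 * A) * (indicator {..<v \<zeta>} (ennreal (c * s)) * v \<zeta>) \<partial>surf)"
        unfolding ind by (subst nn_integral_cmult) measurable
      also have "\<dots> = (\<integral>\<^sup>+\<zeta>. ennreal (4 * A) * v \<zeta> * (indicator {0<..} s * indicator {..<v \<zeta>} (ennreal (c * s))) \<partial>surf)"
        using True by (intro nn_integral_cong) (simp add: mult_ac)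
      finally show ?thesis .
    qed simp
  qed
  also have "\<dots> = (\<integral>\<^sup>+\<zeta>. (\<integral>\<^sup>+s. ennreal (4 * A) * v \<zeta> * (indicator {0<..} s * indicator {..<v \<zeta>} (ennreal (c * s))) \<partial>lborel) \<partial>surf)"
    unfolding ind by (rule P.Fubini') measurable
  also have "\<dots> = (\<integral>\<^sup>+\<zeta>. ennreal (4 * A) * v \<zeta> * (\<integral>\<^sup>+s. indicator {0<..} s * indicator {..<v \<zeta>} (ennreal (c * s)) \<partial>lborel) \<partial>surf)"
    unfolding ind by (subst nn_integral_cmult) measurable
  also have "\<dots> \<le> (\<integral>\<^sup>+\<zeta>. ennreal (4 * A) * v \<zeta> * (v \<zeta> * ennreal (1 / c)) \<partial>surf)"
    by (intro nn_integral_mono mult_left_mono nn_integral_level_le c) simp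
  also have "\<dots> = (\<integral>\<^sup>+\<zeta>. ennreal (4 * A * (1 / c)) * v \<zeta> ^ 2 \<partial>surf)"
  proof (rule nn_integral_cong)
    fix \<zeta>
    have "ennreal (4 * A * (1 / c)) = ennreal (4 * A) * ennreal (1 / c)" using A c by (intro ennreal_mult) auto
    then show "ennreal (4 * A) * v \<zeta> * (v \<zeta> * ennreal (1 / c)) = ennreal (4 * A * (1 / c)) * v \<zeta> ^ 2"
      by (simp add: power2_eq_square mult_ac)
  qed
  also have "\<dots> = ennreal (4 * A * (1 / c)) * (\<integral>\<^sup>+\<zeta>. v \<zeta> ^ 2 \<partial>surf)"
    by (rule nn_integral_cmult) measurable
  also have "4 * A * (1 / c) = 8 * 8 ^ n * (8 ^ n * 36 ^ n)" by (simp add: A_def c_def)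
  finally show ?thesis by (simp add: n_def)
qed

subsection \<open>The admissible maximal function\<close>

text \<open>The holomorphic factor \<open>(\<delta> / (1 - \<langle>w, z\<rangle>)) ^ m\<close>, which is 1 at \<open>w = z\<close>, turns the trivial
  pointwise bound into one whose kernel decays as fast as we like away from \<open>z\<close>.\<close>

lemma koranyi_maximal_dominates:
  assumes \<alpha>: "\<alpha> > 0" and q: "q > 0"
  obtains C :: real where "C > 0"
    "\<And>(G :: complex ^ 'n \<Rightarrow> complex) R z \<xi>. holomorphic_cn G (ball 0 R) \<Longrightarrow> R > 1 \<Longrightarrow>
      norm z < 1 \<Longrightarrow> norm \<xi> = 1 \<Longrightarrow> cmod (1 - herm z \<xi>) < \<alpha> / 2 * (1 - (norm z)\<^sup>2) \<Longrightarrow>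
      ennreal (cmod (G z) powr q)
      \<le> ennreal C * koranyi_maximal (\<lambda>\<zeta>. indicator (cball 0 1) \<zeta> * ennreal (cmod (G \<zeta>) powr q)) \<xi>"
proof -
  define n where "n = CARD('n)"
  obtain K :: real where K: "K > 0"
    and hardy: "\<And>(G :: complex ^ 'n \<Rightarrow> complex) R q z. holomorphic_cn G (ball 0 R) \<Longrightarrow> R > 1 \<Longrightarrow> q > 0 \<Longrightarrow> norm z < 1 \<Longrightarrow>
      ennreal (K * (1 - (norm z)\<^sup>2) ^ CARD('n) * cmod (G z) powr q)
      \<le> (\<integral>\<^sup>+\<zeta>. indicator (cball 0 1) \<zeta> * ennreal (cmod (G \<zeta>) powr q) \<partial>surf)"
    by (rule hardy_pointwise_bound[where 'n='n]) (rule that)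
  \<comment> \<open>The decay exponent \<open>m * q\<close> is at least \<open>n + 1\<close>: on the
    dyadic ball number \<open>k\<close>, the factor \<open>2 ^ (k * n)\<close> of its normalisation
    is then beaten by a spare \<open>2 ^ k\<close>, and the sum is geometric.\<close>
  define m where "m = nat \<lceil>(n + 1) / q\<rceil>"
  define b where "b = m * q"
  have "(n + 1) / q \<le> m" unfolding m_def by linarith
  then have b: "n + 1 \<le> b" using q by (simp add: b_def field_simps)
  \<comment> \<open>The factor 4 is the quasi-triangle constant; \<alpha> enters because
    \<open>z\<close> lies in the approach region at \<xi>. Thus the distance of \<zeta> to \<xi> is
    at most \<beta> times that to \<open>z\<close>.\<close>
  define \<beta> where "\<beta> = 4 * (1 + \<alpha>)"
  have \<beta>: "\<beta> \<ge> 2" using \<alpha> by (simp add: \<beta>_def)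
  \<comment> \<open>The 2 is the sum of the geometric series, and 4 comes from doubling the dyadic
    radius \<open>2 ^ (k + 1) * \<delta>\<close>.\<close>
  define C where "C = 2 * \<beta> powr b * 4 ^ n / K"
  show ?thesis
  proof (rule that[of C])
    show "C > 0" using K \<beta> by (simp add: C_def)
    fix G :: "complex ^ 'n \<Rightarrow> complex" and R and z \<xi> :: "complex ^ 'n"
    assume G: "holomorphic_cn G (ball 0 R)" and R: "R > 1" and z: "norm z < 1" and \<xi>: "norm \<xi> = 1"
      and cone: "cmod (1 - herm z \<xi>) < \<alpha> / 2 * (1 - (norm z)\<^sup>2)"
    define \<delta> where "\<delta> = 1 - (norm z)\<^sup>2"
    have \<delta>: "0 < \<delta>" using z by (simp add: \<delta>_def abs_square_less_1)
    have \<delta>2: "\<delta> \<le> 2 * (1 - norm z)"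
    proof -
      have "\<delta> = (1 - norm z) * (1 + norm z)" by (simp add: \<delta>_def power2_eq_square algebra_simps)
      also have "\<dots> \<le> (1 - norm z) * 2" using z by (intro mult_left_mono) auto
      finally show ?thesis by simp
    qed
    define v where "v = (\<lambda>\<zeta>. indicator (cball 0 1) \<zeta> * ennreal (cmod (G \<zeta>) powr q))"
    have v [measurable]: "v \<in> borel_measurable borel"
      unfolding v_def by (rule borel_measurable_holomorphic_modulus[OF G _ _ q]) (use R in auto)
    \<comment> \<open>Still larger than 1, but small enough that \<open>norm w * norm z < 1\<close>
      for all \<open>w\<close> in the ball, so that the denominator \<open>1 - herm w z\<close> has
      no zero there.\<close>
    define R2 where "R2 = min R (2 / (1 + norm z))"
    have "2 / (1 + norm z) > 1" using z by (subst less_divide_eq_1_pos) (auto simp: add_pos_nonneg)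
    then have R2: "R2 > 1" using R by (simp add: R2_def)
    have ne1: "herm w z \<noteq> 1" if "w \<in> ball 0 R2" for w
    proof
      assume 1: "herm w z = 1"
      have "1 \<le> norm w * norm z" using norm_herm_le[of w z] 1 by simp
      also have "\<dots> \<le> 2 / (1 + norm z) * norm z"
        using that by (intro mult_right_mono) (auto simp: R2_def)
      also have "\<dots> < 1" using z by (simp add: field_simps add_pos_nonneg)
      finally show False by simp
    qed
    define g where "g = (\<lambda>w. (of_real \<delta> / (1 - herm w z)) ^ m)"
    have "holomorphic_cn g (ball 0 R2)"
      unfolding g_def
      by (rule holomorphic_cn_compose[OF holomorphic_cn_herm, of _ "\<lambda>t. (of_real \<delta> / (1 - t)) ^ m" z])
        (use ne1 in \<open>auto intro!: derivative_intros\<close>)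
    then have hol: "holomorphic_cn (\<lambda>w. G w * g w) (ball 0 R2)"
      by (intro holomorphic_cn_mult holomorphic_cn_subset[OF G]) (auto simp: R2_def)
    have gz: "g z = 1" using \<delta> by (simp add: g_def herm_self \<delta>_def flip: of_real_power)
    define w where "w = (\<lambda>k. \<beta> powr b * (1/2) ^ (k * (n + 1)))"
    have pointwise: "ennreal (cmod (G \<zeta> * g \<zeta>) powr q)
        \<le> (\<Sum>k. ennreal (w k) * (indicator {..<2 ^ (k + 1) * \<delta>} (cmod (1 - herm \<zeta> \<xi>)) * v \<zeta>))" if \<zeta>: "norm \<zeta> = 1" for \<zeta>
    proof -
      define d x where "d = cmod (1 - herm \<zeta> \<xi>)" and "x = cmod (1 - herm \<zeta> z)"
      have "\<delta> / 2 \<le> 1 - norm \<zeta> * norm z" using \<zeta> \<delta>2 by simp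
      also have "\<dots> \<le> 1 - cmod (herm \<zeta> z)" using norm_herm_le[of \<zeta> z] by simp
      also have "\<dots> \<le> x" unfolding x_def using norm_triangle_ineq2[of 1 "herm \<zeta> z"] by simp
      finally have x: "\<delta> / 2 \<le> x" .
      have "d \<le> 4 * (x + cmod (1 - herm z \<xi>))"
        unfolding d_def x_def by (rule quasi_triangle) (use \<zeta> \<xi> z in auto)
      also have "\<dots> \<le> 4 * (x + \<alpha> * x)"
      proof -
        have "\<alpha> / 2 * (1 - (norm z)\<^sup>2) = \<alpha> * (\<delta> / 2)" by (simp add: \<delta>_def)
        also have "\<dots> \<le> \<alpha> * x" using x \<alpha> by (intro mult_left_mono) auto
        finally show ?thesis using cone by simp
      qed
      finally have dx: "d \<le> \<beta> * x" by (simp add: \<beta>_def algebra_simps)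
      have x0: "0 < x" using x \<delta> by linarith
      \<comment> \<open>Take the least dyadic scale that reaches \<zeta>. For \<open>k = 0\<close>
        the bounds \<open>\<delta> / 2 \<le> x\<close> and \<open>2 \<le> \<beta>\<close> suffice;
        otherwise minimality gives
        \<open>2 ^ k * \<delta> \<le> d \<le> \<beta> * x\<close>.\<close>
      obtain k where k: "d < 2 ^ (k + 1) * \<delta>" "\<delta> / x \<le> \<beta> * (1/2) ^ k"
      proof -
        have ex: "\<exists>k. d < 2 ^ (k + 1) * \<delta>"
        proof -
          obtain k where "d / \<delta> < 2 ^ k" using real_arch_pow[of 2 "d / \<delta>"] by auto
          then have "d < 2 ^ k * \<delta>" using \<delta> by (simp add: field_simps)
          also have "\<dots> \<le> 2 ^ (k + 1) * \<delta>" using \<delta> by simp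
          finally show ?thesis by blast
        qed
        define k where "k = (LEAST k. d < 2 ^ (k + 1) * \<delta>)"
        have k1: "d < 2 ^ (k + 1) * \<delta>" unfolding k_def by (rule LeastI_ex[OF ex])
        have "\<delta> / x \<le> \<beta> * (1/2) ^ k"
        proof (cases k)
          case 0
          have "\<delta> / x \<le> 2" using x x0 by (simp add: field_simps)
          then show ?thesis using 0 \<beta> by simp
        next
          case (Suc j)
          have "\<not> d < 2 ^ (j + 1) * \<delta>" using not_less_Least[of j "\<lambda>k. d < 2 ^ (k + 1) * \<delta>"] Suc k_def by simp
          then have "2 ^ k * \<delta> \<le> \<beta> * x" using dx Suc by simp
          then show ?thesis using x0 by (simp add: field_simps power_one_over)
        qed
        then show ?thesis using k1 that by blast
      qed
      have "cmod (g \<zeta>) powr q = (\<delta> / x) powr b"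
        using \<delta> x0 by (simp add: g_def norm_power norm_divide x_def[symmetric] b_def powr_powr flip: powr_realpow)
      also have "\<dots> \<le> (\<beta> * (1/2) ^ k) powr b"
        using k(2) \<delta> x0 b by (intro powr_mono2) auto
      also have "\<dots> = \<beta> powr b * ((1/2) ^ k) powr b"
        by (rule powr_mult)
      also have "((1/2::real) ^ k) powr b \<le> ((1/2) ^ k) powr (real (n + 1))"
        using b by (intro powr_mono') (auto simp: power_le_one)
      also have "((1/2::real) ^ k) powr (real (n + 1)) = (1/2) ^ (k * (n + 1))"
        by (simp only: powr_realpow zero_less_power half_gt_zero zero_less_one power_mult)
      finally have gw: "cmod (g \<zeta>) powr q \<le> w k" by (simp add: w_def mult_left_mono)
      have "ennreal (cmod (G \<zeta> * g \<zeta>) powr q) = ennreal (cmod (g \<zeta>) powr q) * v \<zeta>"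
        using \<zeta> by (simp add: v_def norm_mult powr_mult mult.commute flip: ennreal_mult)
      also have "\<dots> \<le> ennreal (w k) * v \<zeta>"
        using gw by (intro mult_right_mono ennreal_leI) auto
      also have "\<dots> = ennreal (w k) * (indicator {..<2 ^ (k + 1) * \<delta>} d * v \<zeta>)" using k by simp
      also have "\<dots> \<le> (\<Sum>k. ennreal (w k) * (indicator {..<2 ^ (k + 1) * \<delta>} d * v \<zeta>))"
        using sum_le_suminf[of "\<lambda>k. ennreal (w k) * (indicator {..<2 ^ (k + 1) * \<delta>} d * v \<zeta>)" "{k}"] by simp
      finally show ?thesis by (simp add: d_def)
    qed
    let ?M = "koranyi_maximal v \<xi>"
    have "ennreal (K * \<delta> ^ n * cmod (G z) powr q)
        \<le> (\<integral>\<^sup>+\<zeta>. indicator (cball 0 1) \<zeta> * ennreal (cmod (G \<zeta> * g \<zeta>) powr q) \<partial>surf)"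
      using hardy[OF hol R2 q z] by (simp add: gz \<delta>_def n_def)
    also have "\<dots> \<le> (\<integral>\<^sup>+\<zeta>. (\<Sum>k. ennreal (w k) * (indicator {..<2 ^ (k + 1) * \<delta>} (cmod (1 - herm \<zeta> \<xi>)) * v \<zeta>)) \<partial>surf)"
      by (rule nn_integral_mono_AE, use AE_surf in eventually_elim) (use pointwise in simp)
    also have "\<dots> = (\<Sum>k. \<integral>\<^sup>+\<zeta>. ennreal (w k) * (indicator {..<2 ^ (k + 1) * \<delta>} (cmod (1 - herm \<zeta> \<xi>)) * v \<zeta>) \<partial>surf)"
      by (rule nn_integral_suminf) measurable
    also have "\<dots> = (\<Sum>k. ennreal (w k) * (\<integral>\<^sup>+\<zeta>. indicator {..<2 ^ (k + 1) * \<delta>} (cmod (1 - herm \<zeta> \<xi>)) * v \<zeta> \<partial>surf))"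
      by (intro suminf_cong nn_integral_cmult) measurable
    also have "\<dots> \<le> (\<Sum>k. ennreal (w k) * (ennreal ((2 * (2 ^ (k + 1) * \<delta>)) ^ n) * ?M))"
      unfolding n_def using \<delta> by (intro suminf_le mult_left_mono koranyi_average_le v) auto
    also have "\<dots> = (\<Sum>k. ennreal (\<beta> powr b * 4 ^ n * \<delta> ^ n * (1/2) ^ k) * ?M)"
    proof (intro suminf_cong)
      fix k
      have half: "(1/2::real) ^ (k * (n + 1)) * (2 ^ k) ^ n = (1/2) ^ k"
      proof -
        have "(1/2::real) ^ (k * (n + 1)) * (2 ^ k) ^ n = (1/2) ^ k * ((1/2) ^ (k * n) * 2 ^ (k * n))"
          by (simp add: power_add power_mult)
        also have "(1/2::real) ^ (k * n) * 2 ^ (k * n) = 1" by (simp flip: power_mult_distrib)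
        finally show ?thesis by simp
      qed
      have "2 * (2 ^ (k + 1) * \<delta>) = 4 * 2 ^ k * \<delta>" by simp
      then have "w k * (2 * (2 ^ (k + 1) * \<delta>)) ^ n
          = \<beta> powr b * 4 ^ n * \<delta> ^ n * ((1/2) ^ (k * (n + 1)) * (2 ^ k) ^ n)"
        unfolding w_def by (simp only: power_mult_distrib mult_ac)
      then have eq: "w k * (2 * (2 ^ (k + 1) * \<delta>)) ^ n = \<beta> powr b * 4 ^ n * \<delta> ^ n * (1/2) ^ k"
        unfolding half .
      have "ennreal (w k) * ennreal ((2 * (2 ^ (k + 1) * \<delta>)) ^ n) = ennreal (w k * (2 * (2 ^ (k + 1) * \<delta>)) ^ n)"
        using \<delta> by (intro ennreal_mult[symmetric]) (auto simp: w_def)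
      then show "ennreal (w k) * (ennreal ((2 * (2 ^ (k + 1) * \<delta>)) ^ n) * ?M)
          = ennreal (\<beta> powr b * 4 ^ n * \<delta> ^ n * (1/2) ^ k) * ?M"
        unfolding eq by (simp only: mult.assoc[symmetric, of "ennreal (w k)"])
    qed
    also have "\<dots> = (\<Sum>k. ennreal (\<beta> powr b * 4 ^ n * \<delta> ^ n * (1/2) ^ k)) * ?M"
      by (rule ennreal_suminf_multc)
    also have "(\<Sum>k. ennreal (\<beta> powr b * 4 ^ n * \<delta> ^ n * (1/2) ^ k)) = ennreal (\<beta> powr b * 4 ^ n * \<delta> ^ n * 2)"
    proof (rule suminf_ennreal_eq)
      show "0 \<le> \<beta> powr b * 4 ^ n * \<delta> ^ n * (1/2) ^ k" for k using \<delta> by simp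
      have "(\<lambda>k. (1/2::real) ^ k) sums 2" using geometric_sums[of "1/2::real"] by simp
      then show "(\<lambda>k. \<beta> powr b * 4 ^ n * \<delta> ^ n * (1/2) ^ k) sums (\<beta> powr b * 4 ^ n * \<delta> ^ n * 2)"
        by (rule sums_mult)
    qed
    finally have main: "ennreal (K * \<delta> ^ n * cmod (G z) powr q) \<le> ennreal (\<beta> powr b * 4 ^ n * \<delta> ^ n * 2) * ?M" .
    have "ennreal (cmod (G z) powr q) = ennreal (1 / (K * \<delta> ^ n)) * ennreal (K * \<delta> ^ n * cmod (G z) powr q)"
      using K \<delta> by (subst ennreal_mult[symmetric]) auto
    also have "\<dots> \<le> ennreal (1 / (K * \<delta> ^ n)) * (ennreal (\<beta> powr b * 4 ^ n * \<delta> ^ n * 2) * ?M)"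
      by (rule mult_left_mono[OF main]) simp
    also have "\<dots> = ennreal C * ?M"
    proof -
      have "ennreal (1 / (K * \<delta> ^ n)) * ennreal (\<beta> powr b * 4 ^ n * \<delta> ^ n * 2) = ennreal C"
        using K \<delta> by (subst ennreal_mult[symmetric]) (auto simp: C_def)
      then show ?thesis by (simp add: mult.assoc[symmetric])
    qed
    finally show "ennreal (cmod (G z) powr q)
      \<le> ennreal C * koranyi_maximal (\<lambda>\<zeta>. indicator (cball 0 1) \<zeta> * ennreal (cmod (G \<zeta>) powr q)) \<xi>"
      by (simp add: v_def)
  qed
qed

section \<open>The maximal function over approach regions\<close>

lemma epowr_mono: "x \<le> y \<Longrightarrow> 0 < p \<Longrightarrow> epowr x p \<le> epowr y p"
  unfolding epowr_def by (auto intro!: ennreal_leI powr_mono2 enn2real_mono simp: top.not_eq_extremum top_unique)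

lemma epowr_ennreal: "0 \<le> x \<Longrightarrow> epowr (ennreal x) p = ennreal (x powr p)"
  by (simp add: epowr_def)

lemma borel_measurable_epowr [measurable]:
  assumes [measurable]: "f \<in> borel_measurable M"
  shows "(\<lambda>x. epowr (f x) p) \<in> borel_measurable M"
  unfolding epowr_def by measurable

text \<open>The point \<open>u\<close> is only a limit of its approach region, since at
  \<open>z = u\<close> both sides of the defining inequality vanish. The radial points
  \<open>s *\<^sub>R u\<close> with \<open>0 < s < 1\<close> belong to it:
  \<open>1 - s < \<alpha> / 2 * (1 - s\<^sup>2)\<close> as \<alpha> > 2. Continuity of
  \<open>f\<close> at \<open>u\<close> does the rest.\<close>

lemma le_nt_maximal:
  fixes f :: "complex ^ 'n \<Rightarrow> complex"
  assumes \<alpha>: "\<alpha> > 2" and f: "holomorphic_cn f unit_ball" and u: "u \<in> unit_ball" "u \<noteq> 0"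
  shows "ennreal (cmod (f u)) \<le> nt_maximal \<alpha> f u"
proof -
  have nu: "0 < norm u" "norm u < 1" using u by auto
  have region: "s *\<^sub>R u \<in> approach_region \<alpha> u" if s: "0 < s" "s < 1" for s :: real
  proof -
    have "herm (s *\<^sub>R u) (u /\<^sub>R (norm u)\<^sup>2) = of_real s"
      using nu by (simp add: herm_simps herm_self field_simps)
    then have "cmod (1 - herm (s *\<^sub>R u) (u /\<^sub>R (norm u)\<^sup>2)) = 1 - s"
      using s norm_of_real[of "1 - s", where 'a=complex] by simp
    also have "1 - s < \<alpha> / 2 * ((1 + s) * (1 - s))"
    proof -
      have "1 * 1 < \<alpha> / 2 * (1 + s)" using \<alpha> s by (intro mult_strict_mono) auto
      then show ?thesis using s mult_strict_right_mono[of 1 "\<alpha> / 2 * (1 + s)" "1 - s"] by (simp add: mult.assoc)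
    qed
    also have "(1 + s) * (1 - s) = 1 - (norm (s *\<^sub>R u))\<^sup>2 / (norm u)\<^sup>2"
      using nu by (simp add: power_mult_distrib power2_eq_square algebra_simps)
    finally show ?thesis
      using s nu by (auto simp: approach_region_def intro!: mult_le_less_imp_less[of s 1 "norm u" 1, simplified])
  qed
  have "((\<lambda>s. ennreal (cmod (f (s *\<^sub>R u)))) \<longlongrightarrow> ennreal (cmod (f u))) (at_left (1::real))"
  proof (intro tendsto_intros)
    have "isCont f u"
      using holomorphic_cn_imp_continuous_on[OF f] u by (simp add: continuous_on_eq_continuous_at)
    moreover have "((\<lambda>s. s *\<^sub>R u) \<longlongrightarrow> 1 *\<^sub>R u) (at_left (1::real))" by (intro tendsto_intros)
    ultimately show "((\<lambda>s. f (s *\<^sub>R u)) \<longlongrightarrow> f u) (at_left (1::real))"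
      using isCont_tendsto_compose by fastforce
  qed
  moreover have "\<forall>\<^sub>F s in at_left (1::real). ennreal (cmod (f (s *\<^sub>R u))) \<le> nt_maximal \<alpha> f u"
    using eventually_at_left_real[of 0 "1::real"]
  proof (rule eventually_mono)
    fix s :: real assume "s \<in> {0<..<1}"
    then show "ennreal (cmod (f (s *\<^sub>R u))) \<le> nt_maximal \<alpha> f u"
      unfolding nt_maximal_def using region by (intro SUP_upper) auto
  qed simp
  ultimately show ?thesis by (rule tendsto_upperbound) simp
qed

text \<open>Clearing the denominator \<open>(norm u)\<^sup>2\<close> makes the condition on
  \<open>u\<close> for fixed \<open>z\<close> an open one, so away from the origin every superlevel
  set is a union of open sets. At the origin the division is degenerate, and that single point is
  treated separately.\<close>

lemma borel_measurable_nt_maximal [measurable]: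
  fixes f :: "complex ^ 'n \<Rightarrow> complex"
  shows "nt_maximal \<alpha> f \<in> borel_measurable borel"
proof (rule borel_measurableI_greater)
  fix y :: ennreal
  define S where "S = (\<lambda>z. {u :: complex ^ 'n. cmod (of_real ((norm u)\<^sup>2) - herm z u) < \<alpha> / 2 * ((norm u)\<^sup>2 - (norm z)\<^sup>2)})"
  have "open (S z)" for z
    unfolding S_def by (intro open_Collect_less continuous_intros)
  then have op: "open (\<Union>z\<in>{z \<in> unit_ball. y < ennreal (cmod (f z))}. S z)" by blast
  have iff: "z \<in> approach_region \<alpha> u \<longleftrightarrow> z \<in> unit_ball \<and> u \<in> S z" if u: "u \<noteq> 0" for z u
  proof -
    define N where "N = (norm u)\<^sup>2"
    have N: "N > 0" using u by (simp add: N_def)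
    have "cmod (of_real N - herm z u) = N * cmod (1 - herm z (u /\<^sub>R N))"
    proof -
      have "of_real N - herm z u = of_real N * (1 - herm z (u /\<^sub>R N))"
        using N by (simp add: herm_simps field_simps)
      then show ?thesis using N by (simp add: norm_mult)
    qed
    moreover have "\<alpha> / 2 * (N - (norm z)\<^sup>2) = N * (\<alpha> / 2 * (1 - (norm z)\<^sup>2 / N))"
      using N by (simp add: field_simps)
    ultimately have "u \<in> S z \<longleftrightarrow> cmod (1 - herm z (u /\<^sub>R N)) < \<alpha> / 2 * (1 - (norm z)\<^sup>2 / N)"
      unfolding S_def mem_Collect_eq N_def[symmetric] using N by (simp only: mult_less_cancel_left_pos)
    then show ?thesis by (simp add: approach_region_def flip: N_def)
  qed
  have eq: "{u. y < nt_maximal \<alpha> f u} - {0} = (\<Union>z\<in>{z \<in> unit_ball. y < ennreal (cmod (f z))}. S z) - {0}"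
    unfolding nt_maximal_def by (auto simp: less_SUP_iff iff)
  have "{u. y < nt_maximal \<alpha> f u} = ({u. y < nt_maximal \<alpha> f u} - {0}) \<union> ({u. y < nt_maximal \<alpha> f u} \<inter> {0})"
    by blast
  moreover have "{u. y < nt_maximal \<alpha> f u} \<inter> {0} \<in> sets borel"
    by (cases "y < nt_maximal \<alpha> f 0") auto
  moreover have "{u. y < nt_maximal \<alpha> f u} - {0} \<in> sets borel"
    unfolding eq using op by (intro sets.Diff) auto
  ultimately have "{u. y < nt_maximal \<alpha> f u} \<in> sets borel" by (metis sets.Un)
  then show "{u \<in> space borel. y < nt_maximal \<alpha> f u} \<in> sets borel" by simp
qed

text \<open>Approach regions scale: dividing by \<open>r\<close> maps the region at
  \<open>r *\<^sub>R \<xi>\<close> into the one at \<xi>. So the dilate \<open>G\<close>,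
  holomorphic on the ball of radius \<open>1 / r\<close>, can replace \<open>f\<close>, and the
  earlier constants do not depend on that radius.\<close>

lemma nt_maximal_sphere_bound:
  assumes \<alpha>: "\<alpha> > 2" and p: "p > 0"
  obtains C :: real where "C > 0"
    "\<And>(f :: complex ^ 'n \<Rightarrow> complex) r. holomorphic_cn f unit_ball \<Longrightarrow> 0 < r \<Longrightarrow> r < 1 \<Longrightarrow>
      (\<integral>\<^sup>+\<xi>. epowr (nt_maximal \<alpha> f (r *\<^sub>R \<xi>)) p \<partial>surf)
      \<le> ennreal C * (\<integral>\<^sup>+\<xi>. indicator unit_ball (r *\<^sub>R \<xi>) * ennreal (cmod (f (r *\<^sub>R \<xi>)) powr p) \<partial>surf)"
proof -
  define q where "q = p / 2"
  have q: "q > 0" using p by (simp add: q_def)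
  have "\<alpha> > 0" using \<alpha> by simp
  obtain C1 :: real where C1: "C1 > 0"
    and dom: "\<And>(G :: complex ^ 'n \<Rightarrow> complex) R z \<xi>. holomorphic_cn G (ball 0 R) \<Longrightarrow> R > 1 \<Longrightarrow>
      norm z < 1 \<Longrightarrow> norm \<xi> = 1 \<Longrightarrow> cmod (1 - herm z \<xi>) < \<alpha> / 2 * (1 - (norm z)\<^sup>2) \<Longrightarrow>
      ennreal (cmod (G z) powr q)
      \<le> ennreal C1 * koranyi_maximal (\<lambda>\<zeta>. indicator (cball 0 1) \<zeta> * ennreal (cmod (G \<zeta>) powr q)) \<xi>"
    by (rule koranyi_maximal_dominates[OF \<open>\<alpha> > 0\<close> q, where 'n='n]) (rule that)
  define C2 :: real where "C2 = 8 * 8 ^ CARD('n) * (8 ^ CARD('n) * 36 ^ CARD('n))"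
  show ?thesis
  proof (rule that[of "C1 ^ 2 * C2"])
    show "C1 ^ 2 * C2 > 0" using C1 by (simp add: C2_def)
    fix f :: "complex ^ 'n \<Rightarrow> complex" and r :: real
    assume f: "holomorphic_cn f unit_ball" and r: "0 < r" "r < 1"
    define G where "G = (\<lambda>z. f (r *\<^sub>R z))"
    define v where "v = (\<lambda>\<zeta>. indicator (cball 0 1) \<zeta> * ennreal (cmod (G \<zeta>) powr q))"
    have R: "1 / r > 1" using r by simp
    have G: "holomorphic_cn G (ball 0 (1 / r))"
      unfolding G_def by (rule holomorphic_cn_scaleR[OF f]) (use r in \<open>auto simp: field_simps\<close>)
    have v [measurable]: "v \<in> borel_measurable borel"
      unfolding v_def by (rule borel_measurable_holomorphic_modulus[OF G _ _ q]) (use R in auto)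
    have le: "epowr (nt_maximal \<alpha> f (r *\<^sub>R \<xi>)) p \<le> (ennreal C1 * koranyi_maximal v \<xi>) ^ 2" if \<xi>: "norm \<xi> = 1" for \<xi>
    proof (cases "ennreal C1 * koranyi_maximal v \<xi>")
      case top
      then show ?thesis by (simp add: power2_eq_square ennreal_top_mult)
    next
      case (real x)
      have "nt_maximal \<alpha> f (r *\<^sub>R \<xi>) \<le> ennreal (x powr (1 / q))"
        unfolding nt_maximal_def
      proof (rule SUP_least)
        fix z assume "z \<in> approach_region \<alpha> (r *\<^sub>R \<xi>)"
        then have z: "cmod (1 - herm z ((r *\<^sub>R \<xi>) /\<^sub>R r\<^sup>2)) < \<alpha> / 2 * (1 - (norm z)\<^sup>2 / r\<^sup>2)"
          using r by (simp add: approach_region_def \<xi>)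
        define z' where "z' = z /\<^sub>R r"
        have "herm z ((r *\<^sub>R \<xi>) /\<^sub>R r\<^sup>2) = herm z' \<xi>"
          using r by (simp add: z'_def herm_simps power2_eq_square field_simps)
        moreover have "(norm z)\<^sup>2 / r\<^sup>2 = (norm z')\<^sup>2"
          using r by (simp add: z'_def power_mult_distrib field_simps)
        ultimately have cone: "cmod (1 - herm z' \<xi>) < \<alpha> / 2 * (1 - (norm z')\<^sup>2)" using z by simp
        \<comment> \<open>The cone condition itself forces \<open>z'\<close> into the open ball: its
          right-hand side exceeds a modulus.\<close>
        then have "0 < \<alpha> / 2 * (1 - (norm z')\<^sup>2)" using norm_ge_zero le_less_trans by blast
        then have "(norm z')\<^sup>2 < 1" using \<alpha> by (simp add: zero_less_mult_iff)
        then have "norm z' < 1" by (simp add: abs_square_less_1)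
        then have "ennreal (cmod (G z') powr q) \<le> ennreal x"
          using dom[OF G R _ \<xi> cone] real by (simp add: v_def)
        then have "cmod (G z') powr q \<le> x" using real by (simp add: ennreal_le_iff)
        then have "(cmod (G z') powr q) powr (1 / q) \<le> x powr (1 / q)"
          using q by (intro powr_mono2) auto
        moreover have "G z' = f z" using r by (simp add: G_def z'_def)
        ultimately show "ennreal (cmod (f z)) \<le> ennreal (x powr (1 / q))"
          using q by (intro ennreal_leI) (simp add: powr_powr)
      qed
      then have "epowr (nt_maximal \<alpha> f (r *\<^sub>R \<xi>)) p \<le> ennreal ((x powr (1 / q)) powr p)"
        using epowr_mono[OF _ p] epowr_ennreal[of "x powr (1 / q)" p] by fastforce
      also have "(x powr (1 / q)) powr p = x ^ 2"
        using real p by (simp add: powr_powr q_def powr_numeral)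
      finally show ?thesis using real by (simp add: ennreal_power)
    qed
    have "(\<integral>\<^sup>+\<xi>. epowr (nt_maximal \<alpha> f (r *\<^sub>R \<xi>)) p \<partial>surf)
        \<le> (\<integral>\<^sup>+\<xi>. ennreal (C1 ^ 2) * koranyi_maximal v \<xi> ^ 2 \<partial>surf)"
      by (rule nn_integral_mono_AE, use AE_surf in eventually_elim)
        (use le C1 in \<open>simp add: power_mult_distrib ennreal_power\<close>)
    also have "\<dots> = ennreal (C1 ^ 2) * (\<integral>\<^sup>+\<xi>. koranyi_maximal v \<xi> ^ 2 \<partial>surf)"
      by (rule nn_integral_cmult) measurable
    also have "\<dots> \<le> ennreal (C1 ^ 2) * (ennreal C2 * (\<integral>\<^sup>+\<xi>. v \<xi> ^ 2 \<partial>surf))"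
      unfolding C2_def by (intro mult_left_mono koranyi_maximal_L2 v) simp
    also have "\<dots> = ennreal (C1 ^ 2 * C2) * (\<integral>\<^sup>+\<xi>. v \<xi> ^ 2 \<partial>surf)"
      using C1 by (subst ennreal_mult) (auto simp: C2_def mult.assoc)
    also have "(\<integral>\<^sup>+\<xi>. v \<xi> ^ 2 \<partial>surf)
        = (\<integral>\<^sup>+\<xi>. indicator unit_ball (r *\<^sub>R \<xi>) * ennreal (cmod (f (r *\<^sub>R \<xi>)) powr p) \<partial>surf)"
    proof (rule nn_integral_cong_AE, use AE_surf in eventually_elim)
      fix \<xi> :: "complex ^ 'n" assume "norm \<xi> = 1"
      moreover have "(cmod (G \<xi>) powr q) ^ 2 = cmod (f (r *\<^sub>R \<xi>)) powr p"
        by (simp add: G_def q_def power2_eq_square flip: powr_add)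
      ultimately show "v \<xi> ^ 2 = indicator unit_ball (r *\<^sub>R \<xi>) * ennreal (cmod (f (r *\<^sub>R \<xi>)) powr p)"
        using r by (simp add: v_def ennreal_power)
    qed
    finally show "(\<integral>\<^sup>+\<xi>. epowr (nt_maximal \<alpha> f (r *\<^sub>R \<xi>)) p \<partial>surf)
      \<le> ennreal (C1 ^ 2 * C2) * (\<integral>\<^sup>+\<xi>. indicator unit_ball (r *\<^sub>R \<xi>) * ennreal (cmod (f (r *\<^sub>R \<xi>)) powr p) \<partial>surf)" .
  qed
qed

section \<open>From spheres to weighted integrals over the ball\<close>

lemma nn_integral_dV:
  fixes g :: "complex ^ 'n \<Rightarrow> ennreal"
  assumes "g \<in> borel_measurable (lebesgue_on unit_ball)"
  shows "(\<integral>\<^sup>+u. g u \<partial>dV) = (\<integral>\<^sup>+u. indicator unit_ball u * g u \<partial>lebesgue) / emeasure lborel (unit_ball :: (complex ^ 'n) set)"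
proof -
  have "(\<integral>\<^sup>+u. g u \<partial>dV) = (\<integral>\<^sup>+u. g u * indicator unit_ball u \<partial>lebesgue_on unit_ball)
      / emeasure (lebesgue_on unit_ball) (unit_ball :: (complex ^ 'n) set)"
    unfolding dV_def using assms by (intro nn_integral_uniform_measure) (auto simp: sets_restrict_space)
  also have "emeasure (lebesgue_on unit_ball) (unit_ball :: (complex ^ 'n) set) = emeasure lborel (unit_ball :: (complex ^ 'n) set)"
    by (subst emeasure_restrict_space) auto
  also have "(\<integral>\<^sup>+u. g u * indicator unit_ball u \<partial>lebesgue_on unit_ball) = (\<integral>\<^sup>+u. indicator unit_ball u * g u \<partial>lebesgue)"
    by (subst nn_integral_restrict_space) (auto intro!: nn_integral_cong simp: indicator_def)
  finally show ?thesis .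
qed

text \<open>A radial weight need not be Borel, and a Borel version of it is radial only almost everywhere;
  on almost every sphere it is constant up to a null set, by integration in polar coordinates.\<close>

lemma radial_weight_comparison:
  fixes \<omega> :: "complex ^ 'n \<Rightarrow> real" and g h :: "complex ^ 'n \<Rightarrow> ennreal"
  assumes \<omega>: "radial_weight \<omega>"
    and [measurable]: "g \<in> borel_measurable borel" "h \<in> borel_measurable borel"
    and sphere: "\<And>r. 0 < r \<Longrightarrow> r < 1 \<Longrightarrow> (\<integral>\<^sup>+\<xi>. g (r *\<^sub>R \<xi>) \<partial>surf) \<le> ennreal C * (\<integral>\<^sup>+\<xi>. h (r *\<^sub>R \<xi>) \<partial>surf)"
  shows "(\<integral>\<^sup>+u. g u * ennreal (\<omega> u) \<partial>dV) \<le> ennreal C * (\<integral>\<^sup>+u. h u * ennreal (\<omega> u) \<partial>dV)"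
proof -
  let ?B = "unit_ball :: (complex ^ 'n) set"
  have "\<omega> \<in> borel_measurable dV" using \<omega> by (auto simp: radial_weight_def)
  then have \<omega>m [measurable]: "\<omega> \<in> borel_measurable (lebesgue_on ?B)"
    by (simp add: dV_def cong: measurable_cong_sets)
  have \<omega>e: "(\<lambda>u. ennreal (\<omega> u)) \<in> borel_measurable (lebesgue_on ?B)" by measurable
  have "(\<lambda>u. indicator ?B u * ennreal (\<omega> u)) \<in> borel_measurable lebesgue"
  proof -
    show ?thesis
      using \<omega>e by (subst (asm) borel_measurable_restrict_space_iff_ennreal) (auto simp: mult.commute)
  qed
  \<comment> \<open>Polar coordinates and Fubini are available for Borel functions only, hence the
    Borel version \<open>W\<close> of the weight.\<close>
  from completion_ex_borel_measurable[OF this] obtain W where W: "W \<in> borel_measurable lborel"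
    and W_ae: "AE u in lborel. indicator ?B u * ennreal (\<omega> u) = W u" by blast
  have [measurable]: "W \<in> borel_measurable borel" using W by simp
  have to_lborel: "(\<integral>\<^sup>+u. k u * ennreal (\<omega> u) \<partial>dV) = (\<integral>\<^sup>+u. indicator ?B u * (k u * W u) \<partial>lborel) / emeasure lborel ?B"
    if k [measurable]: "k \<in> borel_measurable borel" for k
  proof -
    have "k \<in> borel_measurable (lebesgue_on ?B)"
      by (intro measurable_restrict_space1 measurable_completion) simp
    then have "(\<integral>\<^sup>+u. k u * ennreal (\<omega> u) \<partial>dV) = (\<integral>\<^sup>+u. indicator ?B u * (k u * ennreal (\<omega> u)) \<partial>lebesgue) / emeasure lborel ?B"
      by (intro nn_integral_dV borel_measurable_times_ennreal \<omega>e)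
    also have "(\<integral>\<^sup>+u. indicator ?B u * (k u * ennreal (\<omega> u)) \<partial>lebesgue) = (\<integral>\<^sup>+u. indicator ?B u * (k u * W u) \<partial>lebesgue)"
    proof (rule nn_integral_cong_AE)
      show "AE u in lebesgue. indicator ?B u * (k u * ennreal (\<omega> u)) = indicator ?B u * (k u * W u)"
        using AE_completion[OF W_ae] by eventually_elim (auto simp: indicator_def split: if_splits)
    qed
    also have "\<dots> = (\<integral>\<^sup>+u. indicator ?B u * (k u * W u) \<partial>lborel)"
      by (rule nn_integral_completion) measurable
    finally show ?thesis .
  qed
  \<comment> \<open>A Borel null set that contains all points where \<open>W\<close> differs from
    the weight. The polar formula applied to its indicator shows that almost every sphere meets it
    in a null set.\<close>
  obtain Z where Z: "Z \<in> null_sets lborel" "{u \<in> space lborel. \<not> indicator ?B u * ennreal (\<omega> u) = W u} \<subseteq> Z"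
    using W_ae by (auto simp: eventually_ae_filter)
  then have [measurable]: "Z \<in> sets borel" by (auto simp: null_sets_def)
  have "(\<integral>\<^sup>+r. indicator {0<..<1} r * ennreal (DIM(complex ^ 'n) * r ^ (DIM(complex ^ 'n) - 1))
        * (\<integral>\<^sup>+\<xi>. indicator Z (r *\<^sub>R \<xi>) \<partial>(surf :: (complex ^ 'n) measure)) \<partial>lborel)
      = (\<integral>\<^sup>+y. indicator ?B y * indicator Z y \<partial>lborel)"
    by (rule nn_integral_polar[symmetric]) simp
  also have "\<dots> = 0"
    using AE_not_in[OF Z(1)] by (subst nn_integral_0_iff_AE) (auto elim!: eventually_mono)
  finally have "AE r in lborel. indicator {0<..<1} r * ennreal (DIM(complex ^ 'n) * r ^ (DIM(complex ^ 'n) - 1))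
        * (\<integral>\<^sup>+\<xi>. indicator Z (r *\<^sub>R \<xi>) \<partial>(surf :: (complex ^ 'n) measure)) = 0"
    by (subst (asm) nn_integral_0_iff_AE) auto
  then have slices: "AE r in lborel. 0 < r \<longrightarrow> r < 1 \<longrightarrow> (\<integral>\<^sup>+\<xi>. indicator Z (r *\<^sub>R \<xi>) \<partial>(surf :: (complex ^ 'n) measure)) = 0"
    by eventually_elim (auto simp: indicator_def ennreal_zero_less_mult_iff)
  \<comment> \<open>A reference direction: the original weight at \<open>r *\<^sub>R e\<close> is
    the constant value of the weight on the sphere of radius \<open>r\<close>.\<close>
  obtain e :: "complex ^ 'n" where e: "norm e = 1" using norm_cvec_axis by blast
  have const: "(\<integral>\<^sup>+\<xi>. k (r *\<^sub>R \<xi>) * W (r *\<^sub>R \<xi>) \<partial>surf) = (\<integral>\<^sup>+\<xi>. k (r *\<^sub>R \<xi>) \<partial>surf) * ennreal (\<omega> (r *\<^sub>R e))"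
    if r: "0 < r" "r < 1" and null: "(\<integral>\<^sup>+\<xi>. indicator Z (r *\<^sub>R \<xi>) \<partial>(surf :: (complex ^ 'n) measure)) = 0"
      and k [measurable]: "k \<in> borel_measurable borel" for r k
  proof -
    have "AE \<xi> in surf. indicator Z (r *\<^sub>R \<xi> :: complex ^ 'n) = (0 :: ennreal)"
      using null by (subst (asm) nn_integral_0_iff_AE) auto
    then have "AE \<xi> in surf. W (r *\<^sub>R \<xi>) = ennreal (\<omega> (r *\<^sub>R e))"
      using AE_surf
    proof eventually_elim
      fix \<xi> :: "complex ^ 'n" assume "indicator Z (r *\<^sub>R \<xi>) = (0 :: ennreal)" and \<xi>: "norm \<xi> = 1"
      then have "W (r *\<^sub>R \<xi>) = indicator ?B (r *\<^sub>R \<xi>) * ennreal (\<omega> (r *\<^sub>R \<xi>))"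
      proof -
        have "r *\<^sub>R \<xi> \<notin> Z"
          using \<open>indicator Z (r *\<^sub>R \<xi>) = (0 :: ennreal)\<close> by (simp add: indicator_eq_0_iff)
        then have "r *\<^sub>R \<xi> \<notin> {u \<in> space lborel. \<not> indicator ?B u * ennreal (\<omega> u) = W u}"
          using Z(2) by blast
        then show ?thesis by simp
      qed
      also have "r *\<^sub>R \<xi> \<in> ?B" "r *\<^sub>R e \<in> ?B" "norm (r *\<^sub>R \<xi>) = norm (r *\<^sub>R e)" using \<xi> e r by auto
      then have "\<omega> (r *\<^sub>R \<xi>) = \<omega> (r *\<^sub>R e)" using \<omega> unfolding radial_weight_def by blast
      finally show "W (r *\<^sub>R \<xi>) = ennreal (\<omega> (r *\<^sub>R e))" using \<open>r *\<^sub>R \<xi> \<in> ?B\<close> by simp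
    qed
    then have "(\<integral>\<^sup>+\<xi>. k (r *\<^sub>R \<xi>) * W (r *\<^sub>R \<xi>) \<partial>surf) = (\<integral>\<^sup>+\<xi>. k (r *\<^sub>R \<xi>) * ennreal (\<omega> (r *\<^sub>R e)) \<partial>surf)"
      by (intro nn_integral_cong_AE) (auto elim!: eventually_mono)
    also have "\<dots> = (\<integral>\<^sup>+\<xi>. k (r *\<^sub>R \<xi>) \<partial>surf) * ennreal (\<omega> (r *\<^sub>R e))"
      by (rule nn_integral_multc) measurable
    finally show ?thesis .
  qed
  define w where "w = (\<lambda>r::real. indicator {0<..<1} r * ennreal (DIM(complex ^ 'n) * r ^ (DIM(complex ^ 'n) - 1)))"
  have [measurable]: "w \<in> borel_measurable borel" unfolding w_def by measurable
  have polar: "(\<integral>\<^sup>+u. indicator ?B u * (k u * W u) \<partial>lborel) = (\<integral>\<^sup>+r. w r * (\<integral>\<^sup>+\<xi>. k (r *\<^sub>R \<xi>) * W (r *\<^sub>R \<xi>) \<partial>surf) \<partial>lborel)"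
    if [measurable]: "k \<in> borel_measurable borel" for k
    unfolding w_def by (rule nn_integral_polar) measurable
  have "(\<integral>\<^sup>+u. indicator ?B u * (g u * W u) \<partial>lborel) \<le> (\<integral>\<^sup>+r. ennreal C * (w r * (\<integral>\<^sup>+\<xi>. h (r *\<^sub>R \<xi>) * W (r *\<^sub>R \<xi>) \<partial>surf)) \<partial>lborel)"
    unfolding polar[OF \<open>g \<in> _\<close>]
  proof (rule nn_integral_mono_AE, use slices in eventually_elim)
    fix r :: real
    assume null: "0 < r \<longrightarrow> r < 1 \<longrightarrow> (\<integral>\<^sup>+\<xi>. indicator Z (r *\<^sub>R \<xi>) \<partial>(surf :: (complex ^ 'n) measure)) = 0"
    show "w r * (\<integral>\<^sup>+\<xi>. g (r *\<^sub>R \<xi>) * W (r *\<^sub>R \<xi>) \<partial>surf) \<le> ennreal C * (w r * (\<integral>\<^sup>+\<xi>. h (r *\<^sub>R \<xi>) * W (r *\<^sub>R \<xi>) \<partial>surf))"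
    proof (cases "0 < r \<and> r < 1")
      case True
      then have null: "(\<integral>\<^sup>+\<xi>. indicator Z (r *\<^sub>R \<xi>) \<partial>(surf :: (complex ^ 'n) measure)) = 0"
        and r: "0 < r" "r < 1" using null by auto
      have "(\<integral>\<^sup>+\<xi>. g (r *\<^sub>R \<xi>) * W (r *\<^sub>R \<xi>) \<partial>surf) \<le> ennreal C * (\<integral>\<^sup>+\<xi>. h (r *\<^sub>R \<xi>) \<partial>surf) * ennreal (\<omega> (r *\<^sub>R e))"
        unfolding const[OF r null \<open>g \<in> _\<close>] by (rule mult_right_mono[OF sphere[OF r]]) simp
      also have "\<dots> = ennreal C * (\<integral>\<^sup>+\<xi>. h (r *\<^sub>R \<xi>) * W (r *\<^sub>R \<xi>) \<partial>surf)"
        unfolding const[OF r null \<open>h \<in> _\<close>] by (simp only: mult.assoc)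
      finally have "w r * (\<integral>\<^sup>+\<xi>. g (r *\<^sub>R \<xi>) * W (r *\<^sub>R \<xi>) \<partial>surf)
          \<le> w r * (ennreal C * (\<integral>\<^sup>+\<xi>. h (r *\<^sub>R \<xi>) * W (r *\<^sub>R \<xi>) \<partial>surf))"
        by (rule mult_left_mono) simp
      then show ?thesis by (simp only: mult.left_commute[of "w r"])
    qed (simp add: w_def)
  qed
  also have "\<dots> = ennreal C * (\<integral>\<^sup>+u. indicator ?B u * (h u * W u) \<partial>lborel)"
    unfolding polar[OF \<open>h \<in> _\<close>] by (rule nn_integral_cmult) measurable
  finally show ?thesis
    unfolding to_lborel[OF \<open>g \<in> _\<close>] to_lborel[OF \<open>h \<in> _\<close>]
    by (simp add: divide_ennreal_def mult.assoc[symmetric] mult_right_mono)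
qed

theorem theorem3:
  fixes \<alpha> p :: real and \<omega> :: "complex ^ 'n \<Rightarrow> real"
  assumes "\<alpha> > 2" and "0 < p" and "radial_weight \<omega>"
  shows "\<exists>C::real. C > 0 \<and>
    (\<forall>f :: complex ^ 'n \<Rightarrow> complex. holomorphic_cn f unit_ball \<longrightarrow>
       Anorm_pow \<omega> p f \<le> Lnorm_pow \<omega> p (nt_maximal \<alpha> f) \<and>
       Lnorm_pow \<omega> p (nt_maximal \<alpha> f) \<le> ennreal C * Anorm_pow \<omega> p f)"
proof -
  have space_dV: "space (dV :: (complex ^ 'n) measure) = unit_ball"
    by (simp add: dV_def space_restrict_space)
  \<comment> \<open>The pointwise comparison with the maximal function fails to make sense at the
    origin, where the approach region is not defined.\<close>
  have ne0: "AE u in (dV :: (complex ^ 'n) measure). u \<noteq> 0"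
  proof -
    have "AE u in lebesgue_on (unit_ball :: (complex ^ 'n) set). u \<noteq> 0"
      using AE_completion[OF AE_lborel_singleton[of "0 :: complex ^ 'n"]]
      by (subst AE_restrict_space_iff) (auto elim!: eventually_mono)
    then show ?thesis
      unfolding dV_def by (intro AE_uniform_measureI) (auto simp: sets_restrict_space elim!: eventually_mono)
  qed
  obtain C :: real where C: "C > 0"
    and sphere: "\<And>(f :: complex ^ 'n \<Rightarrow> complex) r. holomorphic_cn f unit_ball \<Longrightarrow> 0 < r \<Longrightarrow> r < 1 \<Longrightarrow>
      (\<integral>\<^sup>+\<xi>. epowr (nt_maximal \<alpha> f (r *\<^sub>R \<xi>)) p \<partial>surf)
      \<le> ennreal C * (\<integral>\<^sup>+\<xi>. indicator unit_ball (r *\<^sub>R \<xi>) * ennreal (cmod (f (r *\<^sub>R \<xi>)) powr p) \<partial>surf)"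
    by (rule nt_maximal_sphere_bound[OF assms(1,2), where 'n='n]) (rule that)
  show ?thesis
  proof (intro exI[of _ C] conjI allI impI C)
    fix f :: "complex ^ 'n \<Rightarrow> complex" assume f: "holomorphic_cn f unit_ball"
    show "Anorm_pow \<omega> p f \<le> Lnorm_pow \<omega> p (nt_maximal \<alpha> f)"
      unfolding Anorm_pow_def Lnorm_pow_def
    proof (rule nn_integral_mono_AE, use ne0 AE_space in eventually_elim)
      fix u :: "complex ^ 'n" assume "u \<noteq> 0" "u \<in> space dV"
      then have "ennreal (cmod (f u)) \<le> nt_maximal \<alpha> f u"
        using le_nt_maximal[OF assms(1) f] by (simp add: space_dV)
      then show "epowr (ennreal (cmod (f u))) p * ennreal (\<omega> u) \<le> epowr (nt_maximal \<alpha> f u) p * ennreal (\<omega> u)"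
        by (intro mult_right_mono epowr_mono assms) simp_all
    qed
    \<comment> \<open>Outside the ball \<open>f\<close> is arbitrary; the cut-off makes the
      integrand Borel on the whole space without changing the integral.\<close>
    have [measurable]: "(\<lambda>u. indicator unit_ball u * ennreal (cmod (f u) powr p)) \<in> borel_measurable borel"
      by (rule borel_measurable_holomorphic_modulus[OF f _ _ assms(2)]) auto
    have "Lnorm_pow \<omega> p (nt_maximal \<alpha> f)
        \<le> ennreal C * (\<integral>\<^sup>+u. indicator unit_ball u * ennreal (cmod (f u) powr p) * ennreal (\<omega> u) \<partial>dV)"
      unfolding Lnorm_pow_def by (rule radial_weight_comparison[OF assms(3)]) (use sphere[OF f] in auto)
    also have "(\<integral>\<^sup>+u. indicator unit_ball u * ennreal (cmod (f u) powr p) * ennreal (\<omega> u) \<partial>dV) = Anorm_pow \<omega> p f"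
      unfolding Anorm_pow_def Lnorm_pow_def
      by (intro nn_integral_cong) (auto simp: space_dV epowr_ennreal indicator_def)
    finally show "Lnorm_pow \<omega> p (nt_maximal \<alpha> f) \<le> ennreal C * Anorm_pow \<omega> p f" .
  qed
qed

end
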